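(* For $\star\in\{\mathrm{MM},\mathrm{PM},\mathrm M\}$, the $\mathbb Z$-module $P^{\mathrm{sym}}_\star(d,r)$ is freely generated by the elements $\rho_\star([R_\star(\underline X,\underline r)])$ with $(\underline X,\underline r)\in\mathfrak p^{\mathrm{sym}}_\star(d,r)$.
   Context: $[d]=\{1,\dots,d\}$. A megamatroid on $[d]$ is $\mathrm{rk}:2^{[d]}\to\mathbb Z\cup\{\infty\}$ with $\mathrm{rk}(\emptyset)=0$, $\mathrm{rk}([d])\in\mathbb Z$, and such that whenever $\mathrm{rk}(A),\mathrm{rk}(B)\in\mathbb Z$ then $\mathrm{rk}(A\cup B),\mathrm{rk}(A\cap B)\in\mathbb Z$ and $\mathrm{rk}(A\cup B)+\mathrm{rk}(A\cap B)\le\mathrm{rk}(A)+\mathrm{rk}(B)$. Polymatroids are the monotone megamatroids with values in $\{0,1,\dots\}$; matroids are polymatroids with $\mathrm{rk}(\{i\})\le1$. Base polyhedron $Q(\mathrm{rk})=\{y\in\mathbb R^d:\sum_iy_i=\mathrm{rk}([d]),\ \sum_{i\in A}y_i\le\mathrm{rk}(A)\ \forall A\}$. $P_\star(d,r)$ is the $\mathbb Z$-module of functions $\mathbb R^d\to\mathbb Z$ generated by the indicator functions $[Q(\mathrm{rk})]$, $\mathrm{rk}$ a megamatroid/polymatroid/matroid on $[d]$ of rank $r$. $P^{\mathrm{sym}}_\star(d,r)$ is the quotient of $P_\star(d,r)$ by the subgroup generated by all $[Q(\mathrm{rk})]-[Q(\mathrm{rk}\circ\sigma)]$ ($\sigma$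 a permutation of $[d]$, $(\mathrm{rk}\circ\sigma)(A)=\mathrm{rk}(\sigma(A))$), and $\rho_\star$ is the quotient map. Let $\Delta_{\mathrm{PM}}(d,r)=\{y:y_i\ge0,\sum y_i=r\}$, $\Delta_{\mathrm M}(d,r)=\{y:0\le y_i\le1,\sum y_i=r\}$. For a chain $\underline X:\emptyset\subset X_1\subset\dots\subset X_k=[d]$ (strict) and $\underline r\in\mathbb Z^k$, $R_{\mathrm{MM}}(\underline X,\underline r)=\{y:\sum_iy_i=r_k,\ \sum_{i\in X_j}y_i\le r_j\ \forall j\}$, $R_{\mathrm{PM}}=R_{\mathrm{MM}}\cap\Delta_{\mathrm{PM}}(d,r)$, $R_{\mathrm M}=R_{\mathrm{MM}}\cap\Delta_{\mathrm M}(d,r)$. With $X_0=\emptyset$, $r_0=0$: for $d\ge1$, $\mathfrak p_{\mathrm{MM}}(d,r)$ is the set of $(\underline X,\underline r)$ with $1\le k\le d$ and $r_k=r$; $\mathfrak p_{\mathrm{PM}}(d,r)$ the subset with $0\le r_1<\dots<r_k=r$; $\mathfrak p_{\mathrm M}(d,r)$ the subset of the latter with $0<|X_1|-r_1<\dots<|X_{k-1}|-r_{k-1}\le|X_k|-r_k=d-r$; for $d=0$ they are empty unless $r=0$, when they are a single pair (unique chain, empty vector). $\mathfrak p^{\mathrm{sym}}_\star(d,r)$ is the set of $(\underline X,\underline r)\in\mathfrak p_\star(d,r)$ such that each $X_j$ is of the form $\{1,2,\dots,i\}$ for some $i$. *)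

theory Defs
  imports
    "HOL-Algebra.Free_Abelian_Groups"
    "HOL-Combinatorics.Permutations"
    "HOL-Library.Extended_Real"
    "HOL-Library.Indicator_Function"
begin

text \<open>
  A rank function on \<open>[d] = {1..d}\<close> is a total function on sets of naturals, of which only the
  values on subsets of \<open>{1..d}\<close> matter. The target \<open>\<int> \<union> {\<infinity>}\<close> is rendered inside \<^typ>\<open>ereal\<close>,
  the finite values being those in \<open>ereal ` \<int>\<close>.
\<close>

definition megamatroid :: "nat \<Rightarrow> (nat set \<Rightarrow> ereal) \<Rightarrow> bool" where
  "megamatroid d rk \<longleftrightarrow>
     (\<forall>A\<subseteq>{1..d}. rk A \<in> ereal ` \<int> \<union> {\<infinity>}) \<and>
     rk {} = 0 \<and> rk {1..d} \<in> ereal ` \<int> \<and>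
     (\<forall>A\<subseteq>{1..d}. \<forall>B\<subseteq>{1..d}. rk A \<in> ereal ` \<int> \<longrightarrow> rk B \<in> ereal ` \<int> \<longrightarrow>
        rk (A \<union> B) \<in> ereal ` \<int> \<and> rk (A \<inter> B) \<in> ereal ` \<int> \<and>
        rk (A \<union> B) + rk (A \<inter> B) \<le> rk A + rk B)"

definition polymatroid :: "nat \<Rightarrow> (nat set \<Rightarrow> ereal) \<Rightarrow> bool" where
  "polymatroid d rk \<longleftrightarrow> megamatroid d rk \<and>
     (\<forall>B\<subseteq>{1..d}. \<forall>A\<subseteq>B. rk A \<le> rk B) \<and>
     (\<forall>A\<subseteq>{1..d}. rk A \<in> ereal ` \<nat>)"

definition matroid :: "nat \<Rightarrow> (nat set \<Rightarrow> ereal) \<Rightarrow> bool" where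
  "matroid d rk \<longleftrightarrow> polymatroid d rk \<and> (\<forall>i\<in>{1..d}. rk {i} \<le> 1)"

datatype kind = MegaMatroid | PolyMatroid | Matroid

fun is_star_matroid :: "kind \<Rightarrow> nat \<Rightarrow> (nat set \<Rightarrow> ereal) \<Rightarrow> bool" where
  "is_star_matroid MegaMatroid d rk = megamatroid d rk"
| "is_star_matroid PolyMatroid d rk = polymatroid d rk"
| "is_star_matroid Matroid d rk = matroid d rk"

definition star_matroids :: "kind \<Rightarrow> nat \<Rightarrow> int \<Rightarrow> (nat set \<Rightarrow> ereal) set" where
  "star_matroids s d r = {rk. is_star_matroid s d rk \<and> rk {1..d} = ereal (of_int r)}"

text \<open>
  The space \<open>\<real>\<^sup>d\<close> as the extensional functions on \<open>{1..d}\<close>, so that \<open>d\<close> may be any natural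
  number; for \<open>d = 0\<close> it has exactly one point.
\<close>

definition Rspace :: "nat \<Rightarrow> (nat \<Rightarrow> real) set" where
  "Rspace d = {1..d} \<rightarrow>\<^sub>E UNIV"

definition base_polyhedron :: "nat \<Rightarrow> (nat set \<Rightarrow> ereal) \<Rightarrow> (nat \<Rightarrow> real) set" where
  "base_polyhedron d rk =
     {y \<in> Rspace d. ereal (\<Sum>i\<in>{1..d}. y i) = rk {1..d} \<and>
                    (\<forall>A\<subseteq>{1..d}. ereal (\<Sum>i\<in>A. y i) \<le> rk A)}"

text \<open>
  Abelian groups are in the multiplicative notation of HOL-Algebra; the group of all functions
  \<open>\<real>\<^sup>d \<rightarrow> \<int>\<close> under pointwise addition is a product of copies of the integers.
\<close>

definition fun_group :: "nat \<Rightarrow> ((nat \<Rightarrow> real) \<Rightarrow> int) monoid" where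
  "fun_group d = product_group (Rspace d) (\<lambda>_. integer_group)"

definition ind :: "nat \<Rightarrow> (nat \<Rightarrow> real) set \<Rightarrow> (nat \<Rightarrow> real) \<Rightarrow> int" where
  "ind d Q = (\<lambda>y\<in>Rspace d. indicator Q y)"

definition P_group :: "kind \<Rightarrow> nat \<Rightarrow> int \<Rightarrow> ((nat \<Rightarrow> real) \<Rightarrow> int) monoid" where
  "P_group s d r =
     subgroup_generated (fun_group d) {ind d (base_polyhedron d rk) |rk. rk \<in> star_matroids s d r}"

definition sym_relations :: "kind \<Rightarrow> nat \<Rightarrow> int \<Rightarrow> ((nat \<Rightarrow> real) \<Rightarrow> int) set" where
  "sym_relations s d r = generate (P_group s d r)
     {\<lambda>y\<in>Rspace d. ind d (base_polyhedron d rk) y - ind d (base_polyhedron d (\<lambda>A. rk (\<sigma> ` A))) y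
      |rk \<sigma>. rk \<in> star_matroids s d r \<and> \<sigma> permutes {1..d}}"

definition P_sym :: "kind \<Rightarrow> nat \<Rightarrow> int \<Rightarrow> ((nat \<Rightarrow> real) \<Rightarrow> int) set monoid" where
  "P_sym s d r = P_group s d r Mod sym_relations s d r"

definition rho :: "kind \<Rightarrow> nat \<Rightarrow> int \<Rightarrow> ((nat \<Rightarrow> real) \<Rightarrow> int) \<Rightarrow> ((nat \<Rightarrow> real) \<Rightarrow> int) set" where
  "rho s d r f = sym_relations s d r #>\<^bsub>P_group s d r\<^esub> f"

text \<open>
  A pair \<open>(X, r)\<close> is a pair of lists \<open>[X\<^sub>1, \<dots>, X\<^sub>k]\<close>, \<open>[r\<^sub>1, \<dots>, r\<^sub>k]\<close> of the same length \<open>k\<close>.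
  Since list positions start at \<open>0\<close>, \<open>Xs ! j\<close> is \<open>X\<close> with index \<open>j + 1\<close>, whereas \<open>({} # Xs) ! j\<close> and
  \<open>(0 # rs) ! j\<close> are \<open>X\<^sub>j\<close> and \<open>r\<^sub>j\<close> with the convention \<open>X\<^sub>0 = {}\<close>, \<open>r\<^sub>0 = 0\<close>.
\<close>

definition R_MM :: "nat \<Rightarrow> nat set list \<Rightarrow> int list \<Rightarrow> (nat \<Rightarrow> real) set" where
  "R_MM d Xs rs =
     {y \<in> Rspace d. (\<Sum>i\<in>{1..d}. y i) = of_int (last (0 # rs)) \<and>
                    (\<forall>j<length Xs. (\<Sum>i\<in>Xs ! j. y i) \<le> of_int (rs ! j))}"

definition Delta_PM :: "nat \<Rightarrow> int \<Rightarrow> (nat \<Rightarrow> real) set" where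
  "Delta_PM d r =
     {y \<in> Rspace d. (\<forall>i\<in>{1..d}. 0 \<le> y i) \<and> (\<Sum>i\<in>{1..d}. y i) = of_int r}"

definition Delta_M :: "nat \<Rightarrow> int \<Rightarrow> (nat \<Rightarrow> real) set" where
  "Delta_M d r =
     {y \<in> Rspace d. (\<forall>i\<in>{1..d}. 0 \<le> y i \<and> y i \<le> 1) \<and> (\<Sum>i\<in>{1..d}. y i) = of_int r}"

fun R_star :: "kind \<Rightarrow> nat \<Rightarrow> int \<Rightarrow> nat set list \<Rightarrow> int list \<Rightarrow> (nat \<Rightarrow> real) set" where
  "R_star MegaMatroid d r Xs rs = R_MM d Xs rs"
| "R_star PolyMatroid d r Xs rs = R_MM d Xs rs \<inter> Delta_PM d r"
| "R_star Matroid d r Xs rs = R_MM d Xs rs \<inter> Delta_M d r"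

text \<open>
  For \<open>d \<ge> 1\<close> the chain condition forces \<open>1 \<le> k \<le> d\<close>; for \<open>d = 0\<close> it forces \<open>k = 0\<close>, and then
  the condition on the last rank reads \<open>0 = r\<close>
  (see \<open>p_MM_length\<close> and \<open>p_star_0\<close> below).
\<close>

definition p_MM :: "nat \<Rightarrow> int \<Rightarrow> (nat set list \<times> int list) set" where
  "p_MM d r =
     {(Xs, rs). length rs = length Xs \<and> sorted_wrt (\<subset>) ({} # Xs) \<and>
                last ({} # Xs) = {1..d} \<and> last (0 # rs) = r}"

definition p_PM :: "nat \<Rightarrow> int \<Rightarrow> (nat set list \<times> int list) set" where
  "p_PM d r = {(Xs, rs) \<in> p_MM d r. sorted_wrt (<) rs \<and> (\<forall>x\<in>set rs. 0 \<le> x)}"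

text \<open>
  \<open>corank Xs rs j\<close> is \<open>|X\<^sub>j| - r\<^sub>j\<close>. It is required to increase strictly along \<open>j = 0, \<dots>, k\<close>, except
  for the last step (for \<open>k = 1\<close> the only one), which may be an equality.
\<close>

definition corank :: "nat set list \<Rightarrow> int list \<Rightarrow> nat \<Rightarrow> int" where
  "corank Xs rs j = int (card (({} # Xs) ! j)) - (0 # rs) ! j"

definition p_M :: "nat \<Rightarrow> int \<Rightarrow> (nat set list \<times> int list) set" where
  "p_M d r =
     {(Xs, rs) \<in> p_PM d r.
        (\<forall>j. Suc j < length Xs \<longrightarrow> corank Xs rs j < corank Xs rs (Suc j)) \<and>
        corank Xs rs (length Xs - 1) \<le> corank Xs rs (length Xs)}"

fun p_star :: "kind \<Rightarrow> nat \<Rightarrow> int \<Rightarrow> (nat set list \<times> int list) set" where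
  "p_star MegaMatroid d r = p_MM d r"
| "p_star PolyMatroid d r = p_PM d r"
| "p_star Matroid d r = p_M d r"

definition p_sym :: "kind \<Rightarrow> nat \<Rightarrow> int \<Rightarrow> (nat set list \<times> int list) set" where
  "p_sym s d r = {(Xs, rs) \<in> p_star s d r. \<forall>X\<in>set Xs. \<exists>i. X = {1..i}}"

lemma p_MM_length:
  assumes "(Xs, rs) \<in> p_MM d r" and "1 \<le> d"
  shows "1 \<le> length Xs \<and> length Xs \<le> d"
proof -
  have chain: "sorted_wrt (\<subset>) Xs" and last: "last ({} # Xs) = {1..d}" and ne: "\<forall>X\<in>set Xs. {} \<subset> X"
    using assms by (auto simp: p_MM_def)
  have "Xs \<noteq> []"
    using last assms(2) by auto
  have fin: "finite X" if "X \<in> set Xs" for X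
  proof -
    have lastX: "last Xs = {1..d}"
      using last \<open>Xs \<noteq> []\<close> by simp
    obtain ys where ys: "Xs = ys @ [{1..d}]"
      using \<open>Xs \<noteq> []\<close> lastX by (metis append_butlast_last_id)
    have "X \<subseteq> {1..d}"
      using chain that unfolding ys by (auto simp: sorted_wrt_append)
    then show ?thesis
      by (rule finite_subset) simp
  qed
  have "j < length Xs \<Longrightarrow> Suc j \<le> card (Xs ! j)" for j
  proof (induction j)
    case 0
    then have "Xs ! 0 \<in> set Xs" by simp
    then have "card (Xs ! 0) \<noteq> 0" using ne fin by (metis card_0_eq psubset_eq)
    then show ?case by simp
  next
    case (Suc j)
    then have "Xs ! j \<subset> Xs ! Suc j"
      using chain by (simp add: sorted_wrt_iff_nth_less)
    then have "card (Xs ! j) < card (Xs ! Suc j)"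
      using fin Suc.prems by (simp add: psubset_card_mono)
    then show ?case using Suc by simp
  qed
  from this[of "length Xs - 1"] have "length Xs \<le> card (last Xs)"
    using \<open>Xs \<noteq> []\<close> by (simp add: last_conv_nth)
  moreover have "card (last Xs) = d"
    using \<open>Xs \<noteq> []\<close> last by simp
  moreover have "1 \<le> length Xs"
    using \<open>Xs \<noteq> []\<close> by (cases Xs) auto
  ultimately show ?thesis by simp
qed

lemma p_star_0: "p_star s 0 r = (if r = 0 then {([], [])} else {})"
proof -
  have nil: "Xs = []" if "\<forall>X\<in>set Xs. {} \<subset> X" "last ({} # Xs) = {}" for Xs :: "nat set list"
    using that by (cases Xs rule: rev_cases) auto
  have mem: "(Xs, rs) \<in> p_MM 0 r \<longleftrightarrow> Xs = [] \<and> rs = [] \<and> r = 0" for Xs rs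
  proof (cases "Xs = []")
    case True
    then show ?thesis by (cases rs) (auto simp: p_MM_def)
  next
    case False
    then show ?thesis
      using nil[of Xs] by (auto simp: p_MM_def)
  qed
  have mm: "p_MM 0 r = (if r = 0 then {([], [])} else {})"
  proof (rule Set.set_eqI)
    fix p
    show "p \<in> p_MM 0 r \<longleftrightarrow> p \<in> (if r = 0 then {([], [])} else {})"
      by (cases p) (simp add: mem)
  qed
  show ?thesis
    by (cases s) (auto simp: mm p_PM_def p_M_def split: if_splits)
qed

text \<open>
  The family \<open>b\<close> indexed by \<open>I\<close> is a \<open>\<int>\<close>-basis of \<open>G\<close>: the homomorphism from the free abelian
  group on \<open>I\<close> that extends \<open>b\<close> is an isomorphism.
\<close>

definition freely_generated_by :: "('b, 'm) monoid_scheme \<Rightarrow> ('a \<Rightarrow> 'b) \<Rightarrow> 'a set \<Rightarrow> bool" where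
  "freely_generated_by G b I \<longleftrightarrow>
     comm_group G \<and> b \<in> I \<rightarrow> carrier G \<and>
     (\<exists>h \<in> iso (free_Abelian_group I) G. \<forall>i\<in>I. h (frag_of i) = b i)"

end

(*
  The indicators of the polyhedra R(X, r) for all chains X form a basis of P(d, r), which the
  symmetric group permutes; hence the quotient is free on the orbits.

  Spanning. For y of total rank r let V be the family of sets A with y(A) > rk(A). By submodularity V
  is closed under union with a minimizer M of rk(A) - y(A), so the alternating sum over the chains in V
  vanishes unless V is empty, i.e. unless y lies in Q(rk). This writes [Q(rk)] as a signed sum over
  chains of products of [y(A) > rk(A)] = 1 - [y(A) <= rk(A)], that is, of indicators of R(X, r).

  Independence. Near the centre of the minimal face of a longest chain polyhedron occurring in a linear
  relation, the relation becomes one between cones cut out by chains. Projecting along e_a - e_b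
  turns fibres into rays and lines, and repeated projections isolate the coefficient of that chain.

  Quotient. The coefficients of a relation modulo symmetry are killed by summing over all coordinate
  permutations, which reduces injectivity to the independence of the full family.
*)

theory Submission
  imports Defs
begin

section \<open>Linear relations between cones of chains\<close>

text \<open>The obstacle to independence is that several chain polyhedra of a relation may pass
  through the chosen centre. All kinds are therefore tested in a cube, and the distinguished chain
  is chosen in two stages: first as few coordinates as possible pinned to the boundary of the cube,
  only then maximal length. The first choice gives all competitors through the centre the same
  pinned coordinates, so that only free coordinates have to be perturbed; the second turns an
  inclusion between sets of constraints into equality of chains. In the spanning step the expansion
  yields chains with only weak inequalities between ranks and coranks. The strict inequalities of
  \<open>p_PM\<close> and \<open>p_M\<close> come from discarding constraints that others imply
  inside the ambient polytope. That the chain polyhedra lie in the group at all requires a rank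
  function for each: infinite off the chain for megamatroids, otherwise a minimum combining chain
  bounds with coordinate bounds. In the quotient, symmetrizing multiplies a coefficient by the order
  of a stabilizer, which is nonzero.\<close>

lemma int_sum_of_bool_split:
  fixes c :: "'i \<Rightarrow> int"
  assumes "finite I"
  shows "(\<Sum>i\<in>I. c i * of_bool (P i)) = (\<Sum>i\<in>{i\<in>I. P i}. c i)"
  using assms by (simp add: sum.inter_filter of_bool_def if_distrib cong: if_cong)

text \<open>Just to the right of a point \<open>b\<close> exactly the rays ending at
  \<open>b\<close> from the left are lost, while the rays of the second kind are right-continuous.
  Comparing the two values isolates the coefficients with endpoint \<open>b\<close>. Evaluating far
  to the left and far to the right then yields \<open>k\<close> and the remaining sum.\<close>

lemma ray_sums:
  fixes c :: "'i \<Rightarrow> int" and \<beta> \<gamma> :: "'i \<Rightarrow> real"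
  assumes fin: "finite I" "finite J"
    and zero: "\<And>\<tau>. (\<Sum>i\<in>I. c i * of_bool (\<tau> \<le> \<beta> i)) + (\<Sum>i\<in>J. c i * of_bool (\<gamma> i \<le> \<tau>)) + k = 0"
  shows "(\<Sum>i\<in>I. c i) = 0" "(\<Sum>i\<in>J. c i) = 0" "k = 0"
proof -
  have endpoint: "(\<Sum>i\<in>{i\<in>I. \<beta> i = b}. c i) = 0" for b
  proof -
    have "\<forall>\<^sub>F \<tau> in at_right b. \<forall>i\<in>I. \<tau> \<le> \<beta> i \<longleftrightarrow> b < \<beta> i"
    proof (intro eventually_ball_finite ballI fin)
      fix i assume "i \<in> I"
      show "\<forall>\<^sub>F \<tau> in at_right b. \<tau> \<le> \<beta> i \<longleftrightarrow> b < \<beta> i"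
      proof (cases "b < \<beta> i")
        case True
        then show ?thesis
          by (auto simp: eventually_at_right_field intro!: exI[of _ "\<beta> i"])
      next
        case False
        then show ?thesis
          by (auto simp: eventually_at_right_field intro!: exI[of _ "b + 1"])
      qed
    qed
    moreover have "\<forall>\<^sub>F \<tau> in at_right b. \<forall>i\<in>J. \<gamma> i \<le> \<tau> \<longleftrightarrow> \<gamma> i \<le> b"
    proof (intro eventually_ball_finite ballI fin)
      fix i assume "i \<in> J"
      show "\<forall>\<^sub>F \<tau> in at_right b. \<gamma> i \<le> \<tau> \<longleftrightarrow> \<gamma> i \<le> b"
      proof (cases "b < \<gamma> i")
        case True
        then show ?thesis
          by (auto simp: eventually_at_right_field intro!: exI[of _ "\<gamma> i"])
      next
        case False
        then show ?thesis
          by (auto simp: eventually_at_right_field intro!: exI[of _ "b + 1"])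
      qed
    qed
    ultimately have "\<forall>\<^sub>F \<tau> in at_right b. (\<forall>i\<in>I. \<tau> \<le> \<beta> i \<longleftrightarrow> b < \<beta> i) \<and>
        (\<forall>i\<in>J. \<gamma> i \<le> \<tau> \<longleftrightarrow> \<gamma> i \<le> b)"
      by eventually_elim blast
    then obtain \<tau> where \<tau>: "\<forall>i\<in>I. \<tau> \<le> \<beta> i \<longleftrightarrow> b < \<beta> i" "\<forall>i\<in>J. \<gamma> i \<le> \<tau> \<longleftrightarrow> \<gamma> i \<le> b"
      using eventually_happens'[of "at_right b"] by fastforce
    have "(\<Sum>i\<in>J. c i * of_bool (\<gamma> i \<le> \<tau>)) = (\<Sum>i\<in>J. c i * of_bool (\<gamma> i \<le> b))"
      using \<tau>(2) by (intro sum.cong) auto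
    moreover have "(\<Sum>i\<in>I. c i * of_bool (\<tau> \<le> \<beta> i)) = (\<Sum>i\<in>I. c i * of_bool (b < \<beta> i))"
      using \<tau>(1) by (intro sum.cong) auto
    ultimately have "0 = (\<Sum>i\<in>I. c i * of_bool (b \<le> \<beta> i)) - (\<Sum>i\<in>I. c i * of_bool (b < \<beta> i))"
      using zero[of b] zero[of \<tau>] by simp
    also have "\<dots> = (\<Sum>i\<in>I. c i * of_bool (\<beta> i = b))"
      unfolding sum_subtractf[symmetric] by (intro sum.cong) auto
    finally show ?thesis
      using int_sum_of_bool_split[OF fin(1)] by metis
  qed
  have "(\<Sum>i\<in>I. c i) = (\<Sum>b\<in>\<beta> ` I. \<Sum>i\<in>{i\<in>I. \<beta> i = b}. c i)"
    by (rule sum.image_gen[OF fin(1)])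
  then show I: "(\<Sum>i\<in>I. c i) = 0"
    by (simp add: endpoint)
  \<comment> \<open>Inserting 0 keeps \<open>Min\<close> and \<open>Max\<close> defined when there
    are no rays at all.\<close>
  define lo where "lo = Min (insert 0 (\<beta> ` I \<union> \<gamma> ` J)) - 1"
  define hi where "hi = Max (insert 0 (\<beta> ` I \<union> \<gamma> ` J)) + 1"
  have lo: "lo < \<beta> i" "i \<in> I \<Longrightarrow> hi > \<beta> i" if "i \<in> I" for i
  proof -
    have "Min (insert 0 (\<beta> ` I \<union> \<gamma> ` J)) \<le> \<beta> i" "\<beta> i \<le> Max (insert 0 (\<beta> ` I \<union> \<gamma> ` J))"
      using fin that by (auto intro!: Min_le Max_ge)
    then show "lo < \<beta> i" "hi > \<beta> i" by (auto simp: lo_def hi_def)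
  qed
  have hi: "lo < \<gamma> i" "hi > \<gamma> i" if "i \<in> J" for i
  proof -
    have "Min (insert 0 (\<beta> ` I \<union> \<gamma> ` J)) \<le> \<gamma> i" "\<gamma> i \<le> Max (insert 0 (\<beta> ` I \<union> \<gamma> ` J))"
      using fin that by (auto intro!: Min_le Max_ge)
    then show "lo < \<gamma> i" "hi > \<gamma> i" by (auto simp: lo_def hi_def)
  qed
  have "(\<Sum>i\<in>I. c i * of_bool (lo \<le> \<beta> i)) = (\<Sum>i\<in>I. c i)"
    using lo by (intro sum.cong) (auto simp: less_imp_le)
  moreover have "(\<Sum>i\<in>J. c i * of_bool (\<gamma> i \<le> lo)) = 0"
    using hi by (intro sum.neutral) (auto simp: not_le)
  ultimately show k: "k = 0"
    using zero[of lo] I by simp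
  have "(\<Sum>i\<in>I. c i * of_bool (hi \<le> \<beta> i)) = 0"
    using lo by (intro sum.neutral) (auto simp: not_le)
  moreover have "(\<Sum>i\<in>J. c i * of_bool (\<gamma> i \<le> hi)) = (\<Sum>i\<in>J. c i)"
    using hi by (intro sum.cong) (auto simp: less_imp_le)
  ultimately show "(\<Sum>i\<in>J. c i) = 0"
    using zero[of hi] k by simp
qed

text \<open>Moving in such a direction preserves the total and every coordinate outside
  \<open>M\<close>. Later \<open>M\<close> collects the coordinates of a point that lie strictly
  inside the cube, so that small moves stay in the cube.\<close>

definition directions :: "'a set \<Rightarrow> ('a \<Rightarrow> real) set" where
  "directions M = {u. (\<forall>x. x \<notin> M \<longrightarrow> u x = 0) \<and> sum u M = 0}"

lemma sum_shift:
  fixes u :: "'a \<Rightarrow> real"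
  assumes "finite A"
  shows "(\<Sum>x\<in>A. u x + \<tau> * (of_bool (x = a) - of_bool (x = b)))
       = sum u A + \<tau> * (of_bool (a \<in> A) - of_bool (b \<in> A))"
proof -
  have "(\<Sum>x\<in>A. of_bool (x = a) :: real) = of_bool (a \<in> A)" for a
    using assms by (simp add: of_bool_def)
  then show ?thesis
    by (simp add: sum.distrib sum_subtractf flip: sum_distrib_left)
qed

lemma shift_directions:
  assumes "finite M" "u \<in> directions M" "a \<in> M" "b \<in> M"
  shows "(\<lambda>x. u x + \<tau> * (of_bool (x = a) - of_bool (x = b))) \<in> directions M"
  using assms by (auto simp: directions_def sum_shift)

text \<open>
  Along \<open>e\<^sub>a - e\<^sub>b\<close> a chain of constraints cuts out a ray or the whole line, since it cannot
  contain both a set separating \<open>a\<close> from \<open>b\<close> and one separating \<open>b\<close> from \<open>a\<close>. Summing the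
  one-dimensional relations over all endpoints projects the constraints along this direction.
\<close>

lemma cone_relation_project:
  fixes c :: "'i \<Rightarrow> int" and act :: "'i \<Rightarrow> 'a set set"
  assumes fin: "finite I" "\<And>i. i \<in> I \<Longrightarrow> finite (act i)" "\<And>i A. i \<in> I \<Longrightarrow> A \<in> act i \<Longrightarrow> finite A"
    and M: "finite M" "a \<in> M" "b \<in> M"
    and chain: "\<And>i A B. i \<in> I \<Longrightarrow> A \<in> act i \<Longrightarrow> B \<in> act i \<Longrightarrow> A \<subseteq> B \<or> B \<subseteq> A"
    and zero: "\<And>u. u \<in> directions M \<Longrightarrow> (\<Sum>i\<in>I. c i * of_bool (\<forall>A\<in>act i. sum u A \<le> 0)) = 0"
    and u: "u \<in> directions M"
  shows cone_relation_restrict: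
      "(\<Sum>i\<in>{i\<in>I. \<exists>A\<in>act i. a \<in> A \<and> b \<notin> A}.
          c i * of_bool (\<forall>A\<in>{A\<in>act i. a \<in> A \<longleftrightarrow> b \<in> A}. sum u A \<le> 0)) = 0" (is ?restrict)
    and cone_relation_merge:
      "(\<Sum>i\<in>I. c i * of_bool (\<forall>A\<in>{A\<in>act i. a \<in> A \<longleftrightarrow> b \<in> A}. sum u A \<le> 0)) = 0" (is ?merge)
proof -
  \<comment> \<open>Sets containing both or neither of \<open>a\<close> and \<open>b\<close> have
    constant sum along the line; if one of them is violated, the whole fibre is empty.\<close>
  define ok where "ok i \<longleftrightarrow> (\<forall>A\<in>{A\<in>act i. a \<in> A \<longleftrightarrow> b \<in> A}. sum u A \<le> 0)" for i
  define lo where "lo i \<longleftrightarrow> (\<exists>A\<in>act i. a \<in> A \<and> b \<notin> A)" for i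
  define up where "up i \<longleftrightarrow> (\<exists>A\<in>act i. b \<in> A \<and> a \<notin> A)" for i
  \<comment> \<open>The nonempty fibres: rays bounded above by \<beta>, rays bounded below by
    \<gamma>, and whole lines.\<close>
  define Lo where "Lo = {i\<in>I. ok i \<and> lo i}"
  define Up where "Up = {i\<in>I. ok i \<and> up i}"
  define Li where "Li = {i\<in>I. ok i \<and> \<not> lo i \<and> \<not> up i}"
  define \<beta> where "\<beta> i = Min ((\<lambda>A. - sum u A) ` {A\<in>act i. a \<in> A \<and> b \<notin> A})" for i
  define \<gamma> where "\<gamma> i = Max ((\<lambda>A. sum u A) ` {A\<in>act i. b \<in> A \<and> a \<notin> A})" for i
  have lo_up: "\<not> (lo i \<and> up i)" if "i \<in> I" for i
    using chain[OF that] unfolding lo_def up_def by blast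
  have split_ok: "{i\<in>I. ok i} = Lo \<union> Up \<union> Li"
    unfolding Lo_def Up_def Li_def by blast
  have disj: "Lo \<inter> Up = {}" "(Lo \<union> Up) \<inter> Li = {}"
    using lo_up unfolding Lo_def Up_def Li_def by blast+
  have finL: "finite Lo" "finite Up" "finite Li"
    using fin(1) by (auto simp: Lo_def Up_def Li_def)
  have "(\<Sum>i\<in>Lo. c i * of_bool (\<tau> \<le> \<beta> i)) + (\<Sum>i\<in>Up. c i * of_bool (\<gamma> i \<le> \<tau>)) + sum c Li = 0" for \<tau>
  proof -
    define v where "v = (\<lambda>x. u x + \<tau> * (of_bool (x = a) - of_bool (x = b)))"
    have v: "sum v A = sum u A + \<tau> * (of_bool (a \<in> A) - of_bool (b \<in> A))" if "i \<in> I" "A \<in> act i" for i A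
      unfolding v_def using sum_shift[OF fin(3)[OF that]] .
    have all: "(\<forall>A\<in>act i. sum v A \<le> 0) \<longleftrightarrow> ok i \<and> (\<forall>A\<in>{A\<in>act i. a \<in> A \<and> b \<notin> A}. \<tau> \<le> - sum u A)
        \<and> (\<forall>A\<in>{A\<in>act i. b \<in> A \<and> a \<notin> A}. sum u A \<le> \<tau>)" if i: "i \<in> I" for i
    proof -
      have "sum v A \<le> 0 \<longleftrightarrow> ((a \<in> A \<longleftrightarrow> b \<in> A) \<longrightarrow> sum u A \<le> 0) \<and> (a \<in> A \<and> b \<notin> A \<longrightarrow> \<tau> \<le> - sum u A)
          \<and> (b \<in> A \<and> a \<notin> A \<longrightarrow> sum u A \<le> \<tau>)" if "A \<in> act i" for A
        unfolding v[OF i that] by auto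
      then show ?thesis unfolding ok_def by auto
    qed
    have Lo: "(\<forall>A\<in>act i. sum v A \<le> 0) \<longleftrightarrow> \<tau> \<le> \<beta> i" if i: "i \<in> Lo" for i
    proof -
      have "i \<in> I" "ok i" "{A\<in>act i. a \<in> A \<and> b \<notin> A} \<noteq> {}" "{A\<in>act i. b \<in> A \<and> a \<notin> A} = {}"
        using i lo_up[of i] unfolding Lo_def lo_def up_def by blast+
      then show ?thesis
        using fin(2)[of i] all[of i] unfolding \<beta>_def
        by (subst Min_ge_iff) auto
    qed
    have Up: "(\<forall>A\<in>act i. sum v A \<le> 0) \<longleftrightarrow> \<gamma> i \<le> \<tau>" if i: "i \<in> Up" for i
    proof -
      have "i \<in> I" "ok i" "{A\<in>act i. b \<in> A \<and> a \<notin> A} \<noteq> {}" "{A\<in>act i. a \<in> A \<and> b \<notin> A} = {}"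
        using i lo_up[of i] unfolding Up_def lo_def up_def by blast+
      then show ?thesis
        using fin(2)[of i] all[of i] unfolding \<gamma>_def
        by (subst Max_le_iff) auto
    qed
    have Li: "\<forall>A\<in>act i. sum v A \<le> 0" if i: "i \<in> Li" for i
    proof -
      have "i \<in> I" "ok i" "{A\<in>act i. b \<in> A \<and> a \<notin> A} = {}" "{A\<in>act i. a \<in> A \<and> b \<notin> A} = {}"
        using i unfolding Li_def lo_def up_def by blast+
      then show ?thesis
        unfolding all[OF \<open>i \<in> I\<close>] by blast
    qed
    have "0 = (\<Sum>i\<in>I. c i * of_bool (\<forall>A\<in>act i. sum v A \<le> 0))"
      using zero[of v] shift_directions[OF M(1) u M(2,3), of \<tau>] by (simp add: v_def)
    also have "\<dots> = (\<Sum>i\<in>{i\<in>I. ok i}. c i * of_bool (\<forall>A\<in>act i. sum v A \<le> 0))"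
      using fin(1) all by (intro sum.mono_neutral_right) auto
    also have "\<dots> = (\<Sum>i\<in>Lo. c i * of_bool (\<forall>A\<in>act i. sum v A \<le> 0))
        + (\<Sum>i\<in>Up. c i * of_bool (\<forall>A\<in>act i. sum v A \<le> 0))
        + (\<Sum>i\<in>Li. c i * of_bool (\<forall>A\<in>act i. sum v A \<le> 0))"
      unfolding split_ok using disj finL by (simp only: sum.union_disjoint finite_Un simp_thms)
    also have "\<dots> = (\<Sum>i\<in>Lo. c i * of_bool (\<tau> \<le> \<beta> i)) + (\<Sum>i\<in>Up. c i * of_bool (\<gamma> i \<le> \<tau>)) + sum c Li"
      using Lo Up Li by simp
    finally show ?thesis by simp
  qed
  from ray_sums[OF finL(1,2) this]
  have sums: "sum c Lo = 0" "sum c Up = 0" "sum c Li = 0" by auto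
  have "(\<Sum>i\<in>{i\<in>I. lo i}. c i * of_bool (ok i)) = sum c {i\<in>{i\<in>I. lo i}. ok i}"
    using fin(1) by (intro int_sum_of_bool_split) auto
  also have "{i\<in>{i\<in>I. lo i}. ok i} = Lo"
    unfolding Lo_def by blast
  finally show ?restrict
    using sums by (simp add: ok_def lo_def)
  have "(\<Sum>i\<in>I. c i * of_bool (ok i)) = sum c {i\<in>I. ok i}"
    by (rule int_sum_of_bool_split[OF fin(1)])
  also have "\<dots> = 0"
    unfolding split_ok using disj finL sums by (simp add: sum.union_disjoint)
  finally show ?merge
    by (simp add: ok_def)
qed

text \<open>Each projection returns a relation of the same shape with fewer constraints, so it can
  be iterated over \<open>E\<close>. It is used with \<open>E\<close> relating elements of one block
  of a fixed chain, to get rid of all constraints that cut through a block.\<close>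

lemma cone_relation_merge_all:
  fixes c :: "'i \<Rightarrow> int" and act :: "'i \<Rightarrow> 'a set set"
  assumes fin: "finite I" "\<And>i. i \<in> I \<Longrightarrow> finite (act i)" "\<And>i A. i \<in> I \<Longrightarrow> A \<in> act i \<Longrightarrow> finite A"
    and M: "finite M"
    and chain: "\<And>i A B. i \<in> I \<Longrightarrow> A \<in> act i \<Longrightarrow> B \<in> act i \<Longrightarrow> A \<subseteq> B \<or> B \<subseteq> A"
    and zero: "\<And>u. u \<in> directions M \<Longrightarrow> (\<Sum>i\<in>I. c i * of_bool (\<forall>A\<in>act i. sum u A \<le> 0)) = 0"
    and E: "finite E" "E \<subseteq> M \<times> M"
    and u: "u \<in> directions M"
  shows "(\<Sum>i\<in>I. c i * of_bool (\<forall>A\<in>{A\<in>act i. \<forall>(a, b)\<in>E. a \<in> A \<longleftrightarrow> b \<in> A}. sum u A \<le> 0)) = 0"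
  using E u
proof (induction E arbitrary: u rule: finite_induct)
  case empty
  then show ?case using zero by simp
next
  case (insert p E)
  obtain a b where p: "p = (a, b)" by force
  have "(\<Sum>i\<in>I. c i * of_bool (\<forall>A\<in>{A\<in>{A\<in>act i. \<forall>(a, b)\<in>E. a \<in> A \<longleftrightarrow> b \<in> A}. a \<in> A \<longleftrightarrow> b \<in> A}. sum u A \<le> 0)) = 0"
    using insert.prems p fin chain insert.IH
    by (intro cone_relation_merge[where M = M] M) auto
  moreover have "{A\<in>{A\<in>act i. \<forall>(a, b)\<in>E. a \<in> A \<longleftrightarrow> b \<in> A}. a \<in> A \<longleftrightarrow> b \<in> A}
      = {A\<in>act i. \<forall>(a, b)\<in>insert p E. a \<in> A \<longleftrightarrow> b \<in> A}" for i
    using p by auto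
  ultimately show ?case by (simp only:)
qed

text \<open>Step \<open>j\<close> projects along the direction given by \<open>x j\<close> and
  \<open>x (Suc j)\<close> and keeps only the chains bounded above in it. The condition on
  \<open>l < j\<close> records that a set eliminated by an earlier projection can no longer witness
  this, so a surviving witness contains all of \<open>x 0\<close> to \<open>x j\<close>.\<close>

lemma cone_relation_restrict_all:
  fixes c :: "'i \<Rightarrow> int" and act :: "'i \<Rightarrow> 'a set set" and x :: "nat \<Rightarrow> 'a"
  assumes fin: "finite I" "\<And>i. i \<in> I \<Longrightarrow> finite (act i)" "\<And>i A. i \<in> I \<Longrightarrow> A \<in> act i \<Longrightarrow> finite A"
    and M: "finite M"
    and chain: "\<And>i A B. i \<in> I \<Longrightarrow> A \<in> act i \<Longrightarrow> B \<in> act i \<Longrightarrow> A \<subseteq> B \<or> B \<subseteq> A"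
    and zero: "\<And>u. u \<in> directions M \<Longrightarrow> (\<Sum>i\<in>I. c i * of_bool (\<forall>A\<in>act i. sum u A \<le> 0)) = 0"
    and x: "\<And>j. j < n \<Longrightarrow> x j \<in> M \<and> x (Suc j) \<in> M"
    and u: "u \<in> directions M"
  shows "(\<Sum>i\<in>{i\<in>I. \<forall>j<n. \<exists>A\<in>act i. (\<forall>l<j. x l \<in> A \<longleftrightarrow> x (Suc l) \<in> A) \<and> x j \<in> A \<and> x (Suc j) \<notin> A}.
      c i * of_bool (\<forall>A\<in>{A\<in>act i. \<forall>l<n. x l \<in> A \<longleftrightarrow> x (Suc l) \<in> A}. sum u A \<le> 0)) = 0"
  using x u
proof (induction n arbitrary: u)
  case 0
  then show ?case using zero by simp
next
  case (Suc n)
  let ?I = "\<lambda>n. {i\<in>I. \<forall>j<n. \<exists>A\<in>act i. (\<forall>l<j. x l \<in> A \<longleftrightarrow> x (Suc l) \<in> A) \<and> x j \<in> A \<and> x (Suc j) \<notin> A}"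
  let ?act = "\<lambda>n i. {A\<in>act i. \<forall>l<n. x l \<in> A \<longleftrightarrow> x (Suc l) \<in> A}"
  have "(\<Sum>i\<in>{i\<in>?I n. \<exists>A\<in>?act n i. x n \<in> A \<and> x (Suc n) \<notin> A}.
      c i * of_bool (\<forall>A\<in>{A\<in>?act n i. x n \<in> A \<longleftrightarrow> x (Suc n) \<in> A}. sum u A \<le> 0)) = 0"
  proof (intro cone_relation_restrict[where M = M] M Suc.prems(2))
    show "x n \<in> M" "x (Suc n) \<in> M"
      using Suc.prems(1) by auto
    show "(\<Sum>i\<in>?I n. c i * of_bool (\<forall>A\<in>?act n i. sum u A \<le> 0)) = 0" if "u \<in> directions M" for u
      using Suc.prems(1) that by (intro Suc.IH) auto
    show "A \<subseteq> B \<or> B \<subseteq> A" if "i \<in> ?I n" "A \<in> ?act n i" "B \<in> ?act n i" for i A B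
      using that by (intro chain) auto
  qed (use fin in auto)
  moreover have "{i\<in>?I n. \<exists>A\<in>?act n i. x n \<in> A \<and> x (Suc n) \<notin> A} = ?I (Suc n)"
    by (auto simp: less_Suc_eq)
  moreover have "{A\<in>?act n i. x n \<in> A \<longleftrightarrow> x (Suc n) \<in> A} = ?act (Suc n) i" for i
    by (auto simp: less_Suc_eq)
  ultimately show ?case by (simp only:)
qed

section \<open>Chain polyhedra\<close>

text \<open>Two different heads would each occur in the tail of the other list and hence precede
  each other, against asymmetry.\<close>

lemma sorted_wrt_unique:
  assumes "\<And>x y. R x y \<Longrightarrow> \<not> R y x"
    and "sorted_wrt R xs" "sorted_wrt R ys" "set xs = set ys"
  shows "xs = ys"
  using assms(2-)
proof (induction xs arbitrary: ys)
  case Nil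
  then show ?case by simp
next
  case (Cons x xs)
  obtain y ys' where ys: "ys = y # ys'"
    using Cons.prems(3) by (cases ys) auto
  have irrefl: "\<not> R z z" for z
    using assms(1) by blast
  have "x = y"
  proof (rule ccontr)
    assume "x \<noteq> y"
    then have "x \<in> set ys'" "y \<in> set xs"
      using Cons.prems(3) unfolding ys by auto
    then have "R y x" "R x y"
      using Cons.prems(1,2) unfolding ys by auto
    then show False
      using assms(1) by blast
  qed
  moreover have "x \<notin> set xs" "y \<notin> set ys'"
    using Cons.prems irrefl unfolding ys by auto
  ultimately have "set xs = set ys'"
    using Cons.prems(3) unfolding ys by auto
  then show ?case
    using Cons ys \<open>x = y\<close> by auto
qed

text \<open>With the empty set and 0 prepended, positions run from 0 to \<open>length Xs\<close> as
  in the mathematical indexing, and the first block needs no separate treatment.\<close>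

lemma p_MM_nth:
  assumes "(Xs, rs) \<in> p_MM d r"
  shows "length rs = length Xs" "({} # Xs) ! length Xs = {1..d}" "(0 # rs) ! length Xs = r"
    "\<And>i j. i < j \<Longrightarrow> j \<le> length Xs \<Longrightarrow> ({} # Xs) ! i \<subset> ({} # Xs) ! j"
    "\<And>i j. i \<le> j \<Longrightarrow> j \<le> length Xs \<Longrightarrow> ({} # Xs) ! i \<subseteq> ({} # Xs) ! j"
    "\<And>j. j \<le> length Xs \<Longrightarrow> ({} # Xs) ! j \<subseteq> {1..d}"
proof -
  have len: "length rs = length Xs" and sorted: "sorted_wrt (\<subset>) ({} # Xs)"
    and last: "last ({} # Xs) = {1..d}" "last (0 # rs) = r"
    using assms unfolding p_MM_def by blast+
  show "length rs = length Xs" by (fact len)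
  have "last ({} # Xs) = ({} # Xs) ! (length ({} # Xs) - 1)" "last (0 # rs) = (0 # rs) ! (length (0 # rs) - 1)"
    by (rule last_conv_nth; simp)+
  then show top: "({} # Xs) ! length Xs = {1..d}" "(0 # rs) ! length Xs = r"
    unfolding last len length_Cons diff_Suc_1 by (simp_all only:)
  show strict: "({} # Xs) ! i \<subset> ({} # Xs) ! j" if "i < j" "j \<le> length Xs" for i j
    by (rule sorted_wrt_nth_less[OF sorted that(1)]) (use that(2) in simp)
  show weak: "({} # Xs) ! i \<subseteq> ({} # Xs) ! j" if "i \<le> j" "j \<le> length Xs" for i j
    using that strict[of i j] by (cases "i = j") auto
  show "({} # Xs) ! j \<subseteq> {1..d}" if "j \<le> length Xs" for j
    using weak[OF that order.refl] unfolding top .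
qed

lemma mem_set_zip_iff:
  assumes "length rs = length Xs"
  shows "(A, t) \<in> set (zip Xs rs) \<longleftrightarrow>
     (\<exists>j. 0 < j \<and> j \<le> length Xs \<and> A = ({} # Xs) ! j \<and> t = (0 # rs) ! j)"
proof
  assume "(A, t) \<in> set (zip Xs rs)"
  then obtain j where "j < length Xs" "A = Xs ! j" "t = rs ! j"
    using assms by (auto simp: set_zip)
  then show "\<exists>j. 0 < j \<and> j \<le> length Xs \<and> A = ({} # Xs) ! j \<and> t = (0 # rs) ! j"
    by (intro exI[of _ "Suc j"]) auto
next
  assume "\<exists>j. 0 < j \<and> j \<le> length Xs \<and> A = ({} # Xs) ! j \<and> t = (0 # rs) ! j"
  then obtain j where "0 < j" "j \<le> length Xs" "A = ({} # Xs) ! j" "t = (0 # rs) ! j"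
    by blast
  then show "(A, t) \<in> set (zip Xs rs)"
    using assms by (auto simp: set_zip gr0_conv_Suc)
qed

lemma mem_R_MM_iff:
  assumes "(Xs, rs) \<in> p_MM d r"
  shows "y \<in> R_MM d Xs rs \<longleftrightarrow> y \<in> Rspace d \<and> sum y {1..d} = of_int r \<and>
     (\<forall>(A, t)\<in>set (zip Xs rs). sum y A \<le> of_int t)"
proof -
  have "last (0 # rs) = r" "length rs = length Xs"
    using assms unfolding p_MM_def by blast+
  then show ?thesis
    by (auto simp: R_MM_def set_zip)
qed

text \<open>This allows chains to be compared through their sets of constraints, where an inclusion
  and a count suffice.\<close>

lemma p_MM_eqI:
  assumes "(Xs, rs) \<in> p_MM d r" "(Ys, ts) \<in> p_MM d r'" "set (zip Xs rs) = set (zip Ys ts)"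
  shows "(Xs, rs) = (Ys, ts)"
proof -
  have sorted: "sorted_wrt (\<lambda>p q. fst p \<subset> fst q) (zip Xs rs)" if "(Xs, rs) \<in> p_MM d r" for Xs rs r
  proof -
    have "sorted_wrt (\<subset>) Xs" "length rs = length Xs"
      using that unfolding p_MM_def by simp_all
    then have "sorted_wrt (\<subset>) (map fst (zip Xs rs))"
      by simp
    then show ?thesis
      unfolding sorted_wrt_map .
  qed
  have "zip Xs rs = zip Ys ts"
    by (rule sorted_wrt_unique[of "\<lambda>p q. fst p \<subset> fst q"]) (use assms sorted in auto)
  then have "map fst (zip Xs rs) = map fst (zip Ys ts)" "map snd (zip Xs rs) = map snd (zip Ys ts)"
    by simp_all
  then show ?thesis
    using p_MM_nth(1)[OF assms(1)] p_MM_nth(1)[OF assms(2)] by simp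
qed

lemma card_set_zip_p_MM:
  assumes "(Xs, rs) \<in> p_MM d r"
  shows "card (set (zip Xs rs)) = length Xs"
proof -
  have "sorted_wrt (\<subset>) Xs" and len: "length rs = length Xs"
    using assms unfolding p_MM_def by simp_all
  from this(1) have "distinct Xs"
    by (induction Xs) auto
  then show ?thesis
    using len by (simp add: distinct_card distinct_zipI1)
qed

text \<open>
  The conditions hold on \<open>p_M\<close> for \<open>lo = 0\<close> and \<open>hi = 1\<close>, on \<open>p_PM\<close> for \<open>lo = 0\<close> and
  \<open>hi = r + 1\<close> (with \<open>hi = r\<close> the cube degenerates for \<open>r = 0\<close>), and on any given finite subset
  of \<open>p_MM\<close> for \<open>lo = - N\<close> and \<open>hi = N\<close> with \<open>N\<close> large. Testing linear relations inside the
  cube \<open>[lo, hi]\<^sup>d\<close> thus treats the three kinds alike.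
\<close>

definition box_chains :: "int \<Rightarrow> int \<Rightarrow> nat \<Rightarrow> int \<Rightarrow> (nat set list \<times> int list) set" where
  "box_chains lo hi d r = {(Xs, rs) \<in> p_MM d r. \<forall>j<length Xs.
     let n = int (card (({} # Xs) ! Suc j - ({} # Xs) ! j)); \<delta> = (0 # rs) ! Suc j - (0 # rs) ! j
     in lo * n \<le> \<delta> \<and> \<delta> \<le> hi * n \<and> (0 < j \<longrightarrow> lo * n < \<delta>) \<and> (Suc j < length Xs \<longrightarrow> \<delta> < hi * n)}"

text \<open>In the cube the sum over the first set is at least \<open>lo\<close> times its size. If
  its bound has this value, the constraint pins all its coordinates to \<open>lo\<close>. The strict
  inequalities in \<open>box_chains\<close> exclude this for later blocks.\<close>

fun lower_face :: "int \<Rightarrow> nat set list \<times> int list \<Rightarrow> nat set" where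
  "lower_face lo (Xs, rs) =
     (if (0 # rs) ! 1 = lo * int (card (({} # Xs) ! 1)) then ({} # Xs) ! 1 else {})"

text \<open>Dually, these are the coordinates pinned to \<open>hi\<close>: the last block has total
  at least its rank increment, because the total over all coordinates is fixed.\<close>

fun upper_face :: "int \<Rightarrow> nat set list \<times> int list \<Rightarrow> nat set" where
  "upper_face hi (Xs, rs) =
     (let k = length Xs; K = ({} # Xs) ! k - ({} # Xs) ! (k - 1)
      in if (0 # rs) ! k - (0 # rs) ! (k - 1) = hi * int (card K) then K else {})"

section \<open>Coordinates pinned to the boundary of the cube\<close>

lemma sum_le_lower_bound_imp_eq:
  fixes y :: "'a \<Rightarrow> real"
  assumes "finite A" "\<And>i. i \<in> A \<Longrightarrow> lo \<le> y i" "sum y A \<le> lo * card A" "i \<in> A"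
  shows "y i = lo"
proof -
  have "(\<Sum>i\<in>A. y i - lo) = 0"
    using assms by (intro antisym sum_nonneg) (auto simp: sum_subtractf mult.commute)
  then show ?thesis
    using assms by (subst (asm) sum_nonneg_eq_0_iff) auto
qed

lemma face_values:
  assumes p: "(Xs, rs) \<in> p_MM d r" and d: "1 \<le> d"
    and y: "y \<in> R_MM d Xs rs" "\<And>i. i \<in> {1..d} \<Longrightarrow> of_int lo \<le> y i \<and> y i \<le> of_int hi"
  shows "i \<in> lower_face lo (Xs, rs) \<Longrightarrow> y i = of_int lo"
    and "i \<in> upper_face hi (Xs, rs) \<Longrightarrow> y i = of_int hi"
proof -
  note nth = p_MM_nth[OF p]
  let ?k = "length Xs"
  have k: "1 \<le> ?k"
    using p_MM_length[OF p d] by simp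
  have le: "sum y (({} # Xs) ! j) \<le> of_int ((0 # rs) ! j)" if "j \<le> ?k" for j
  proof (cases "j = 0")
    case False
    then have "(({} # Xs) ! j, (0 # rs) ! j) \<in> set (zip Xs rs)"
      unfolding mem_set_zip_iff[OF nth(1)] using that by blast
    then show ?thesis
      using y(1) unfolding mem_R_MM_iff[OF p] by fast
  qed simp
  have total: "sum y {1..d} = of_int r"
    using y(1) unfolding mem_R_MM_iff[OF p] by blast
  show "y i = of_int lo" if "i \<in> lower_face lo (Xs, rs)"
  proof -
    define A where "A = ({} # Xs) ! 1"
    have A: "i \<in> A" "(0 # rs) ! 1 = lo * int (card A)"
      using that unfolding lower_face.simps A_def[symmetric] by (metis empty_iff)+
    have sub: "A \<subseteq> {1..d}"
      using nth(6)[OF k] unfolding A_def .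
    have "sum y A \<le> of_int lo * card A"
      using le[OF k] unfolding A(2) A_def[symmetric] by simp
    then show ?thesis
      using sub A(1) y(2) finite_subset[OF sub] by (intro sum_le_lower_bound_imp_eq[of A]) auto
  qed
  show "y i = of_int hi" if "i \<in> upper_face hi (Xs, rs)"
  proof -
    define B where "B = ({} # Xs) ! (?k - 1)"
    define K where "K = {1..d} - B"
    have K: "i \<in> K" "r - (0 # rs) ! (?k - 1) = hi * int (card K)"
      using that unfolding upper_face.simps Let_def nth(2,3) B_def[symmetric] K_def[symmetric]
      by (metis empty_iff)+
    have sub: "B \<subseteq> {1..d}" "K \<subseteq> {1..d}"
      using nth(6)[of "?k - 1"] unfolding B_def K_def by auto
    \<comment> \<open>The fixed total turns the upper bound on \<open>B\<close> into a lower bound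
      on its complement.\<close>
    have "sum y K = of_int r - sum y B"
      using sub(1) total unfolding K_def by (subst sum_diff) auto
    also have "\<dots> \<ge> of_int r - of_int ((0 # rs) ! (?k - 1))"
      using le[of "?k - 1"] unfolding B_def by simp
    finally have "of_int (r - (0 # rs) ! (?k - 1)) \<le> sum y K"
      by simp
    then have "of_int hi * card K \<le> sum y K"
      unfolding K(2) by simp
    \<comment> \<open>The lower-bound argument applied to the negated point.\<close>
    then have "- y i = - of_int hi"
      using sub(2) K(1) y(2) finite_subset[OF sub(2)]
      by (intro sum_le_lower_bound_imp_eq[of K _ "\<lambda>i. - y i"]) (auto simp: sum_negf)
    then show ?thesis by simp
  qed
qed

text \<open>The centre of the minimal face of \<open>R_MM d Xs rs\<close> is constant on the blocks of the chain.\<close>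

lemma block_point_exists:
  assumes p: "(Xs, rs) \<in> p_MM d r"
  obtains z :: "nat \<Rightarrow> real" where "z \<in> Rspace d"
    and "\<And>j. j \<le> length Xs \<Longrightarrow> sum z (({} # Xs) ! j) = of_int ((0 # rs) ! j)"
    and "\<And>i j. j < length Xs \<Longrightarrow> i \<in> ({} # Xs) ! Suc j - ({} # Xs) ! j \<Longrightarrow>
      z i = of_int ((0 # rs) ! Suc j - (0 # rs) ! j) / card (({} # Xs) ! Suc j - ({} # Xs) ! j)"
proof -
  note nth = p_MM_nth[OF p]
  define X where "X = (\<lambda>j. ({} # Xs) ! j)"
  define \<rho> where "\<rho> = (\<lambda>j. (0 # rs) ! j)"
  define val :: "nat \<Rightarrow> real" where "val j = of_int (\<rho> (Suc j) - \<rho> j) / card (X (Suc j) - X j)" for j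
  define z where "z = (\<lambda>i\<in>{1..d}. val (LEAST j. i \<in> X (Suc j)))"
  have z: "z i = val j" if "j < length Xs" "i \<in> X (Suc j) - X j" for i j
  proof -
    have "(LEAST j. i \<in> X (Suc j)) = j"
    proof (rule Least_equality)
      fix l assume l: "i \<in> X (Suc l)"
      show "j \<le> l"
      proof (rule ccontr)
        assume "\<not> j \<le> l"
        then show False
          using nth(5)[of "Suc l" j] that l unfolding X_def by auto
      qed
    qed (use that in auto)
    then show ?thesis
      using that nth(6)[of "Suc j"] by (auto simp: z_def X_def)
  qed
  have sum: "sum z (X j) = of_int (\<rho> j)" if "j \<le> length Xs" for j
    using that
  proof (induction j)
    case 0
    then show ?case by (simp add: X_def \<rho>_def)
  next
    case (Suc j)
    have sub: "X j \<subset> X (Suc j)" and fin: "finite (X (Suc j))"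
      using nth(4)[of j "Suc j"] finite_subset[OF nth(6)[of "Suc j"]] Suc.prems
      unfolding X_def by auto
    have "sum z (X (Suc j)) = sum z (X j) + sum z (X (Suc j) - X j)"
      using sub fin by (subst sum.subset_diff[of "X j"]) (auto simp: add.commute)
    also have "sum z (X (Suc j) - X j) = (\<Sum>i\<in>X (Suc j) - X j. val j)"
      using Suc.prems by (intro sum.cong z) auto
    also have "\<dots> = of_int (\<rho> (Suc j) - \<rho> j)"
      using sub fin by (auto simp: val_def card_eq_0_iff)
    finally show ?case
      using Suc by simp
  qed
  show ?thesis
  proof (rule that)
    show "z \<in> Rspace d"
      by (simp add: z_def Rspace_def)
  qed (use sum z in \<open>simp_all add: X_def \<rho>_def val_def\<close>)
qed

lemma block_of_element:
  assumes "i \<in> X m" "X 0 = {}"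
  obtains j where "j < m" "i \<in> X (Suc j) - X j"
proof -
  have "\<exists>j<m. i \<in> X (Suc j) - X j"
    using assms
  proof (induction m)
    case (Suc m)
    then show ?case
      by (cases "i \<in> X m") (auto intro: less_SucI)
  qed simp
  then show ?thesis
    using that by blast
qed

text \<open>On a block the centre takes the average rank increment, which \<open>box_chains\<close>
  confines to \<open>[lo, hi]\<close>. An end of the interval can be attained only on the first
  block from below and on the last from above, and those are the two faces.\<close>

lemma box_chains_central_point:
  assumes box: "(Xs, rs) \<in> box_chains lo hi d r" and d: "1 \<le> d"
  obtains z :: "nat \<Rightarrow> real" where "z \<in> Rspace d"
    "\<And>j. j \<le> length Xs \<Longrightarrow> sum z (({} # Xs) ! j) = of_int ((0 # rs) ! j)"
    "\<And>i. i \<in> {1..d} \<Longrightarrow> of_int lo \<le> z i \<and> z i \<le> of_int hi"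
    "\<And>i. i \<in> lower_face lo (Xs, rs) \<Longrightarrow> z i = of_int lo"
    "\<And>i. i \<in> upper_face hi (Xs, rs) \<Longrightarrow> z i = of_int hi"
    "\<And>i. i \<in> {1..d} - lower_face lo (Xs, rs) - upper_face hi (Xs, rs) \<Longrightarrow> of_int lo < z i \<and> z i < of_int hi"
proof -
  have p: "(Xs, rs) \<in> p_MM d r"
    using box unfolding box_chains_def by blast
  note nth = p_MM_nth[OF p]
  define k where "k = length Xs"
  define X where "X = (\<lambda>j. ({} # Xs) ! j)"
  define \<rho> where "\<rho> = (\<lambda>j. (0 # rs) ! j)"
  have X0: "X 0 = {}" "\<rho> 0 = 0"
    by (simp_all add: X_def \<rho>_def)
  have Xk: "X k = {1..d}" "\<rho> k = r"
    using nth(2,3) unfolding X_def \<rho>_def k_def .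
  have X_less: "X i \<subset> X j" if "i < j" "j \<le> k" for i j
    using nth(4) that unfolding X_def k_def .
  have X_sub: "X j \<subseteq> {1..d}" if "j \<le> k" for j
    using nth(6) that unfolding X_def k_def .
  have k: "1 \<le> k"
    using p_MM_length[OF p d] unfolding k_def by simp
  define n where "n j = card (X (Suc j) - X j)" for j
  have step: "lo * int (n j) \<le> \<rho> (Suc j) - \<rho> j" "\<rho> (Suc j) - \<rho> j \<le> hi * int (n j)"
    "0 < j \<Longrightarrow> lo * int (n j) < \<rho> (Suc j) - \<rho> j"
    "Suc j < k \<Longrightarrow> \<rho> (Suc j) - \<rho> j < hi * int (n j)" if "j < k" for j
    using box that unfolding box_chains_def Let_def X_def \<rho>_def k_def n_def by blast+
  have n: "0 < n j" if "j < k" for j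
    using X_less[of j "Suc j"] X_sub[of "Suc j"] that finite_subset[of "X (Suc j)" "{1..d}"]
    unfolding n_def by (simp add: card_gt_0_iff)
  have L: "lower_face lo (Xs, rs) = (if \<rho> 1 = lo * int (card (X 1)) then X 1 else {})"
    unfolding X_def \<rho>_def lower_face.simps ..
  have n0: "n 0 = card (X 1)"
    using X0 by (simp add: n_def)
  have K: "upper_face hi (Xs, rs) =
      (if \<rho> k - \<rho> (k - 1) = hi * int (n (k - 1)) then X k - X (k - 1) else {})"
    unfolding n_def Suc_diff_1[OF k[unfolded One_nat_def Suc_le_eq]] upper_face.simps Let_def
      X_def[symmetric] \<rho>_def[symmetric] k_def[symmetric] ..
  obtain z where z: "z \<in> Rspace d"
      "\<And>j. j \<le> k \<Longrightarrow> sum z (X j) = of_int (\<rho> j)"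
      "\<And>i j. j < k \<Longrightarrow> i \<in> X (Suc j) - X j \<Longrightarrow> z i = of_int (\<rho> (Suc j) - \<rho> j) / n j"
    using block_point_exists[OF p] unfolding X_def \<rho>_def k_def n_def by blast
  have le: "of_int lo \<le> z i" "z i \<le> of_int hi" if i: "j < k" "i \<in> X (Suc j) - X j" for i j
  proof -
    have "real_of_int (lo * int (n j)) \<le> real_of_int (\<rho> (Suc j) - \<rho> j)"
      "real_of_int (\<rho> (Suc j) - \<rho> j) \<le> real_of_int (hi * int (n j))"
      using step(1,2)[OF i(1)] by (simp_all only: of_int_le_iff)
    then show "of_int lo \<le> z i" "z i \<le> of_int hi"
      using n[OF i(1)] unfolding z(3)[OF i] by (simp_all add: field_simps)
  qed
  have less_lo: "of_int lo < z i" if i: "j < k" "i \<in> X (Suc j) - X j" "lo * int (n j) < \<rho> (Suc j) - \<rho> j" for i j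
  proof -
    have "real_of_int (lo * int (n j)) < real_of_int (\<rho> (Suc j) - \<rho> j)"
      using i(3) by (simp only: of_int_less_iff)
    then show ?thesis
      using n[OF i(1)] unfolding z(3)[OF i(1,2)] by (simp add: field_simps)
  qed
  have less_hi: "z i < of_int hi" if i: "j < k" "i \<in> X (Suc j) - X j" "\<rho> (Suc j) - \<rho> j < hi * int (n j)" for i j
  proof -
    have "real_of_int (\<rho> (Suc j) - \<rho> j) < real_of_int (hi * int (n j))"
      using i(3) by (simp only: of_int_less_iff)
    then show ?thesis
      using n[OF i(1)] unfolding z(3)[OF i(1,2)] by (simp add: field_simps)
  qed
  have block: "\<exists>j<k. i \<in> X (Suc j) - X j" if "i \<in> {1..d}" for i
    using block_of_element[of i X k] that X0(1) unfolding Xk(1) by blast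
  show ?thesis
  proof (rule that)
    show "z \<in> Rspace d" by (fact z(1))
    show "sum z (({} # Xs) ! j) = of_int ((0 # rs) ! j)" if "j \<le> length Xs" for j
      using z(2) that unfolding X_def \<rho>_def k_def .
    show "of_int lo \<le> z i \<and> z i \<le> of_int hi" if i: "i \<in> {1..d}" for i
      using block[OF i] le by blast
    show "z i = of_int lo" if i: "i \<in> lower_face lo (Xs, rs)" for i
    proof -
      have i: "i \<in> X (Suc 0) - X 0" "\<rho> (Suc 0) - \<rho> 0 = lo * int (n 0)"
        using i X0 n0 unfolding L by (simp_all split: if_splits)
      show ?thesis
        using z(3)[OF _ i(1)] k n[of 0] unfolding i(2) by simp
    qed
    show "z i = of_int hi" if i: "i \<in> upper_face hi (Xs, rs)" for i
    proof -
      have i: "i \<in> X (Suc (k - 1)) - X (k - 1)" "\<rho> (Suc (k - 1)) - \<rho> (k - 1) = hi * int (n (k - 1))"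
        using i k unfolding K by (simp_all split: if_splits)
      show ?thesis
        using z(3)[OF _ i(1)] k n[of "k - 1"] unfolding i(2) by simp
    qed
    show "of_int lo < z i \<and> z i < of_int hi"
      if i: "i \<in> {1..d} - lower_face lo (Xs, rs) - upper_face hi (Xs, rs)" for i
    proof -
      obtain j where j: "j < k" "i \<in> X (Suc j) - X j"
        using block i by blast
      have "lo * int (n j) < \<rho> (Suc j) - \<rho> j"
      proof (cases "j = 0")
        case True
        then have "\<rho> 1 \<noteq> lo * int (card (X 1))"
          using i j unfolding L by auto
        then show ?thesis
          using step(1)[OF j(1)] n0 X0(2) unfolding True by simp
      qed (use step(3)[OF j(1)] in auto)
      moreover have "\<rho> (Suc j) - \<rho> j < hi * int (n j)"
      proof (cases "Suc j = k")
        case True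
        then have "k - 1 = j" by simp
        then have "\<rho> (Suc j) - \<rho> j \<noteq> hi * int (n j)"
          using i j unfolding K True[symmetric] by auto
        then show ?thesis
          using step(2)[OF j(1)] by simp
      qed (use step(4)[OF j(1)] j(1) in auto)
      ultimately show ?thesis
        using less_lo less_hi j by blast
    qed
  qed
qed

text \<open>A slack or violated inequality survives a small step unchanged; at a tight one the sign
  of the direction decides.\<close>

lemma eventually_perturbed_le:
  fixes a b t :: real
  shows "\<forall>\<^sub>F \<epsilon> in at_right 0. a + \<epsilon> * b \<le> t \<longleftrightarrow> a < t \<or> a = t \<and> b \<le> 0"
proof -
  have cont: "((\<lambda>\<epsilon>. a + \<epsilon> * b) \<longlongrightarrow> a + 0 * b) (at_right 0)"
    by (intro tendsto_intros)
  have pos: "\<forall>\<^sub>F \<epsilon> in at_right (0::real). \<epsilon> > 0"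
    by (simp add: eventually_at_right_less)
  consider "a < t" | "a = t" | "t < a" by linarith
  then show ?thesis
  proof cases
    case 1
    then have "\<forall>\<^sub>F \<epsilon> in at_right 0. a + \<epsilon> * b < t"
      using order_tendstoD(2)[OF cont, of t] by simp
    then show ?thesis by eventually_elim (use 1 in simp)
  next
    case 2
    show ?thesis using pos by eventually_elim (use 2 in \<open>simp add: mult_le_0_iff\<close>)
  next
    case 3
    then have "\<forall>\<^sub>F \<epsilon> in at_right 0. t < a + \<epsilon> * b"
      using order_tendstoD(1)[OF cont, of t] by simp
    then show ?thesis by eventually_elim (use 3 in simp)
  qed
qed

text \<open>
  Near the central point \<open>z\<close> only the constraints that are tight at \<open>z\<close> matter, so a linear
  relation between indicators becomes one between indicators of cones.
\<close>

lemma local_cone_relation: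
  fixes c :: "nat set list \<times> int list \<Rightarrow> int"
  assumes fin: "finite I" and I: "I \<subseteq> p_MM d r"
    and zero: "\<And>y. y \<in> Rspace d \<Longrightarrow> (\<And>i. i \<in> {1..d} \<Longrightarrow> of_int lo \<le> y i \<and> y i \<le> of_int hi) \<Longrightarrow>
      (\<Sum>q\<in>I. c q * of_bool (y \<in> R_MM d (fst q) (snd q))) = 0"
    and z: "z \<in> Rspace d" "\<And>i. i \<in> {1..d} \<Longrightarrow> of_int lo \<le> z i \<and> z i \<le> of_int hi"
    and M: "M \<subseteq> {1..d}" "\<And>i. i \<in> M \<Longrightarrow> of_int lo < z i \<and> z i < of_int hi"
    and u: "u \<in> directions M"
  shows "(\<Sum>q\<in>{q\<in>I. z \<in> R_MM d (fst q) (snd q)}.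
     c q * of_bool (\<forall>A\<in>{A. \<exists>t. (A, t) \<in> set (zip (fst q) (snd q)) \<and> sum z A = of_int t}. sum u A \<le> 0)) = 0"
proof -
  have "finite M"
    using M(1) finite_subset by blast
  have "\<forall>\<^sub>F \<epsilon> in at_right 0. \<forall>i\<in>M. of_int lo < z i + \<epsilon> * u i \<and> z i + \<epsilon> * u i < of_int hi"
  proof (intro eventually_ball_finite ballI \<open>finite M\<close>)
    fix i assume i: "i \<in> M"
    have cont: "((\<lambda>\<epsilon>. z i + \<epsilon> * u i) \<longlongrightarrow> z i + 0 * u i) (at_right 0)"
      by (intro tendsto_intros)
    show "\<forall>\<^sub>F \<epsilon> in at_right 0. of_int lo < z i + \<epsilon> * u i \<and> z i + \<epsilon> * u i < of_int hi"
      using order_tendstoD[OF cont] M(2)[OF i] by (auto intro: eventually_conj)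
  qed
  moreover have "\<forall>\<^sub>F \<epsilon> in at_right 0. \<forall>q\<in>I. \<forall>p\<in>set (zip (fst q) (snd q)).
      sum z (fst p) + \<epsilon> * sum u (fst p) \<le> of_int (snd p) \<longleftrightarrow>
      sum z (fst p) < of_int (snd p) \<or> sum z (fst p) = of_int (snd p) \<and> sum u (fst p) \<le> 0"
    by (intro eventually_ball_finite ballI eventually_perturbed_le fin) simp_all
  ultimately have "\<forall>\<^sub>F \<epsilon> in at_right 0. (\<forall>i\<in>M. of_int lo < z i + \<epsilon> * u i \<and> z i + \<epsilon> * u i < of_int hi) \<and>
      (\<forall>q\<in>I. \<forall>p\<in>set (zip (fst q) (snd q)).
      sum z (fst p) + \<epsilon> * sum u (fst p) \<le> of_int (snd p) \<longleftrightarrow>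
      sum z (fst p) < of_int (snd p) \<or> sum z (fst p) = of_int (snd p) \<and> sum u (fst p) \<le> 0)"
    by (rule eventually_conj)
  then obtain \<epsilon> where \<epsilon>: "\<And>i. i \<in> M \<Longrightarrow> of_int lo < z i + \<epsilon> * u i \<and> z i + \<epsilon> * u i < of_int hi"
    "\<And>q A t. q \<in> I \<Longrightarrow> (A, t) \<in> set (zip (fst q) (snd q)) \<Longrightarrow> sum z A + \<epsilon> * sum u A \<le> of_int t \<longleftrightarrow>
      sum z A < of_int t \<or> sum z A = of_int t \<and> sum u A \<le> 0"
    using eventually_happens'[of "at_right (0::real)"] by fastforce
  \<comment> \<open>Coordinates outside \<open>M\<close> are not moved, since \<open>u\<close>
    vanishes there; hence the point stays in the cube even where \<open>z\<close> lies on its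
    boundary.\<close>
  define y where "y = (\<lambda>i\<in>{1..d}. z i + \<epsilon> * u i)"
  have u0: "u i = 0" if "i \<notin> M" for i
    using u that by (simp add: directions_def)
  have y: "y \<in> Rspace d"
    by (simp add: y_def Rspace_def)
  have sum_y: "sum y A = sum z A + \<epsilon> * sum u A" if "A \<subseteq> {1..d}" for A
    using that by (simp add: y_def sum.distrib sum_distrib_left subset_eq)
  have "sum u {1..d} = sum u M"
    using M(1) u0 by (intro sum.mono_neutral_right) auto
  then have u_total: "sum u {1..d} = 0"
    using u by (simp add: directions_def)
  have box: "of_int lo \<le> y i \<and> y i \<le> of_int hi" if "i \<in> {1..d}" for i
    using that z(2)[OF that] u0[of i] \<epsilon>(1)[of i] by (cases "i \<in> M") (auto simp: y_def)
  define act where "act q = {A. \<exists>t. (A, t) \<in> set (zip (fst q) (snd q)) \<and> sum z A = of_int t}" for q :: "nat set list \<times> int list"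
  have mem: "y \<in> R_MM d (fst q) (snd q) \<longleftrightarrow> z \<in> R_MM d (fst q) (snd q) \<and> (\<forall>A\<in>act q. sum u A \<le> 0)"
    if q: "q \<in> I" for q
  proof -
    have q': "(fst q, snd q) \<in> p_MM d r"
      using q I by auto
    have "sum y A \<le> of_int t \<longleftrightarrow> sum z A < of_int t \<or> sum z A = of_int t \<and> sum u A \<le> 0"
      if At: "(A, t) \<in> set (zip (fst q) (snd q))" for A t
    proof -
      have "A \<subseteq> {1..d}"
        using At p_MM_nth(6)[OF q'] unfolding mem_set_zip_iff[OF p_MM_nth(1)[OF q']] by blast
      then show ?thesis
        using \<epsilon>(2)[OF q At] sum_y by simp
    qed
    then have "(\<forall>(A, t)\<in>set (zip (fst q) (snd q)). sum y A \<le> of_int t) \<longleftrightarrow>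
        (\<forall>(A, t)\<in>set (zip (fst q) (snd q)). sum z A \<le> of_int t) \<and> (\<forall>A\<in>act q. sum u A \<le> 0)"
      unfolding act_def by fastforce
    then show ?thesis
      unfolding mem_R_MM_iff[OF q'] using y z(1) sum_y[of "{1..d}"] u_total by simp
  qed
  have "0 = (\<Sum>q\<in>I. c q * of_bool (y \<in> R_MM d (fst q) (snd q)))"
    using zero[OF y box] by simp
  also have "\<dots> = (\<Sum>q\<in>{q\<in>I. z \<in> R_MM d (fst q) (snd q)}. c q * of_bool (\<forall>A\<in>act q. sum u A \<le> 0))"
    using fin mem by (intro sum.mono_neutral_cong_right) auto
  finally show ?thesis
    by (simp add: act_def)
qed

text \<open>The constraints of \<open>Xs\<close> not covered by \<open>mid\<close> are the full set,
  whose rank is \<open>r\<close> in both chains, and those bounding the two faces, which are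
  recovered from the equality of the faces. So every constraint of \<open>Xs\<close> occurs in
  \<open>Ys\<close>, and the bound on the length leaves no room for others.\<close>

lemma box_chains_tight_unique:
  assumes p: "(Xs, rs) \<in> p_MM d r" and q: "(Ys, ts) \<in> p_MM d r" and d: "1 \<le> d"
    and L: "lower_face lo (Ys, ts) = lower_face lo (Xs, rs)"
    and K: "upper_face hi (Ys, ts) = upper_face hi (Xs, rs)"
    and len: "length Ys \<le> length Xs"
    and mid: "\<And>j. 0 < j \<Longrightarrow> j < length Xs \<Longrightarrow> ({} # Xs) ! j \<noteq> lower_face lo (Xs, rs) \<Longrightarrow>
       ({} # Xs) ! j \<noteq> {1..d} - upper_face hi (Xs, rs) \<Longrightarrow>
       (({} # Xs) ! j, (0 # rs) ! j) \<in> set (zip Ys ts)"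
  shows "(Ys, ts) = (Xs, rs)"
proof -
  define k where "k = length Xs"
  define m where "m = length Ys"
  define X where "X = (\<lambda>j. ({} # Xs) ! j)"
  define \<rho> where "\<rho> = (\<lambda>j. (0 # rs) ! j)"
  define Y where "Y = (\<lambda>j. ({} # Ys) ! j)"
  define \<tau> where "\<tau> = (\<lambda>j. (0 # ts) ! j)"
  note nth = p_MM_nth[OF p, folded X_def \<rho>_def k_def]
  note nth' = p_MM_nth[OF q, folded Y_def \<tau>_def m_def]
  have k: "1 \<le> k" "1 \<le> m"
    using p_MM_length[OF p d] p_MM_length[OF q d] unfolding k_def m_def by simp_all
  have X0: "X 0 = {}" "Y 0 = {}" "\<rho> 0 = 0" "\<tau> 0 = 0"
    by (simp_all add: X_def Y_def \<rho>_def \<tau>_def)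
  have memX: "(A, t) \<in> set (zip Xs rs) \<longleftrightarrow> (\<exists>j. 0 < j \<and> j \<le> k \<and> A = X j \<and> t = \<rho> j)" for A t
    using mem_set_zip_iff[OF nth(1)[unfolded k_def]] unfolding X_def \<rho>_def k_def .
  have memY: "(A, t) \<in> set (zip Ys ts) \<longleftrightarrow> (\<exists>j. 0 < j \<and> j \<le> m \<and> A = Y j \<and> t = \<tau> j)" for A t
    using mem_set_zip_iff[OF nth'(1)[unfolded m_def]] unfolding Y_def \<tau>_def m_def .
  have LX: "lower_face lo (Xs, rs) = (if \<rho> 1 = lo * int (card (X 1)) then X 1 else {})"
    and LY: "lower_face lo (Ys, ts) = (if \<tau> 1 = lo * int (card (Y 1)) then Y 1 else {})"
    unfolding X_def \<rho>_def Y_def \<tau>_def lower_face.simps by (rule refl)+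
  have KX: "upper_face hi (Xs, rs) =
      (if r - \<rho> (k - 1) = hi * int (card ({1..d} - X (k - 1))) then {1..d} - X (k - 1) else {})"
    unfolding upper_face.simps Let_def X_def[symmetric] \<rho>_def[symmetric] k_def[symmetric] nth(2,3) ..
  have KY: "upper_face hi (Ys, ts) =
      (if r - \<tau> (m - 1) = hi * int (card ({1..d} - Y (m - 1))) then {1..d} - Y (m - 1) else {})"
    unfolding upper_face.simps Let_def Y_def[symmetric] \<tau>_def[symmetric] m_def[symmetric] nth'(2,3) ..
  have "set (zip Xs rs) \<subseteq> set (zip Ys ts)"
  proof (rule subrelI)
    fix A t assume "(A, t) \<in> set (zip Xs rs)"
    then obtain j where j: "0 < j" "j \<le> k" "A = X j" "t = \<rho> j"
      unfolding memX by blast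
    have Xj: "X j \<noteq> {}" "X j \<subseteq> {1..d}"
      using nth(4)[OF j(1,2)] nth(6)[OF j(2)] X0 by auto
    consider "j = k" | "X j = lower_face lo (Xs, rs)" | "j < k" "X j = {1..d} - upper_face hi (Xs, rs)"
      | "j < k" "X j \<noteq> lower_face lo (Xs, rs)" "X j \<noteq> {1..d} - upper_face hi (Xs, rs)"
      using j(2) by fastforce
    then have "(X j, \<rho> j) \<in> set (zip Ys ts)"
    proof cases
      case 1
      then show ?thesis
        using k nth(2,3) nth'(2,3) unfolding memY by (intro exI[of _ m]) auto
    next
      case 2
      then have X1: "X j = X 1" "\<rho> 1 = lo * int (card (X 1))"
        using Xj(1) unfolding LX by (auto split: if_splits)
      have "j = 1"
        using nth(4)[of 1 j] j(1,2) X1(1) by (cases "j = 1") auto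
      have "lower_face lo (Ys, ts) = X j"
        using 2 L by simp
      then have "Y 1 = X j" "\<tau> 1 = lo * int (card (Y 1))"
        using Xj(1) unfolding LY by (auto split: if_splits)
      then show ?thesis
        using k X1 \<open>j = 1\<close> unfolding memY by (intro exI[of _ 1]) auto
    next
      case 3
      \<comment> \<open>A chain member strictly below the full set shows that the upper face is
        nonempty, so its complement is the last proper member of either chain.\<close>
      have ne: "upper_face hi (Xs, rs) \<noteq> {}"
        using nth(4)[OF 3(1) order.refl] 3(2) unfolding nth(2) by auto
      then have Xk: "upper_face hi (Xs, rs) = {1..d} - X (k - 1)"
          "r - \<rho> (k - 1) = hi * int (card ({1..d} - X (k - 1)))"
        unfolding KX by (auto split: if_splits)
      have Yk: "upper_face hi (Xs, rs) = {1..d} - Y (m - 1)"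
          "r - \<tau> (m - 1) = hi * int (card ({1..d} - Y (m - 1)))"
        using ne unfolding K[symmetric] KY by (auto split: if_splits)
      have sub: "X (k - 1) \<subseteq> {1..d}" "Y (m - 1) \<subseteq> {1..d}"
        using nth(6)[of "k - 1"] nth'(6)[of "m - 1"] by auto
      then have eq: "X (k - 1) = Y (m - 1)" "X j = X (k - 1)"
        using Xk(1) Yk(1) 3(2) by auto
      have "j = k - 1"
      proof (rule ccontr)
        assume "j \<noteq> k - 1"
        then have "j < k - 1" using 3(1) by simp
        then show False using nth(4)[of j "k - 1"] eq(2) by auto
      qed
      moreover have "\<rho> (k - 1) = \<tau> (m - 1)"
        using Xk(2) Yk(2) eq(1) by simp
      moreover have "m - 1 \<noteq> 0"
        using Xj(1) eq X0(2) by metis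
      ultimately show ?thesis
        using eq unfolding memY by (intro exI[of _ "m - 1"]) auto
    next
      case 4
      show ?thesis
        using mid[folded X_def \<rho>_def k_def, OF j(1) 4] .
    qed
    then show "(A, t) \<in> set (zip Ys ts)"
      unfolding j .
  qed
  moreover have "card (set (zip Ys ts)) \<le> card (set (zip Xs rs))"
    unfolding card_set_zip_p_MM[OF p] card_set_zip_p_MM[OF q] by (rule len)
  ultimately have "set (zip Xs rs) = set (zip Ys ts)"
    by (intro card_seteq) auto
  then show ?thesis
    using p_MM_eqI[OF q p] by simp
qed

section \<open>Linear independence\<close>

text \<open>Merging within blocks leaves only tight sets that are unions of blocks on
  \<open>M\<close>; projecting along consecutive block representatives then keeps only chains with a
  tight set at every cut between blocks. Equal faces and the bound on the length identify such a
  chain with \<open>(Xs, rs)\<close>.\<close>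

lemma chain_relation_coefficient_zero:
  fixes c :: "nat set list \<times> int list \<Rightarrow> int" and z :: "nat \<Rightarrow> real"
  assumes p: "(Xs, rs) \<in> box_chains lo hi d r" and d: "1 \<le> d"
    and I: "finite I" "(Xs, rs) \<in> I" "\<And>q. q \<in> I \<Longrightarrow> q \<in> p_MM d r"
    and faces: "\<And>q. q \<in> I \<Longrightarrow> lower_face lo q = lower_face lo (Xs, rs)"
      "\<And>q. q \<in> I \<Longrightarrow> upper_face hi q = upper_face hi (Xs, rs)"
    and len: "\<And>q. q \<in> I \<Longrightarrow> length (fst q) \<le> length Xs"
    and z: "\<And>j. j \<le> length Xs \<Longrightarrow> sum z (({} # Xs) ! j) = of_int ((0 # rs) ! j)"
    and M: "M = {1..d} - lower_face lo (Xs, rs) - upper_face hi (Xs, rs)"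
    and act: "\<And>q. act q = {A. \<exists>t. (A, t) \<in> set (zip (fst q) (snd q)) \<and> sum z A = of_int t}"
    and zero: "\<And>u. u \<in> directions M \<Longrightarrow> (\<Sum>q\<in>I. c q * of_bool (\<forall>A\<in>act q. sum u A \<le> 0)) = 0"
  shows "c (Xs, rs) = 0"
proof -
  have pMM: "(Xs, rs) \<in> p_MM d r"
    using p unfolding box_chains_def by blast
  define k where "k = length Xs"
  define X where "X = (\<lambda>j. ({} # Xs) ! j)"
  define \<rho> where "\<rho> = (\<lambda>j. (0 # rs) ! j)"
  note nth = p_MM_nth[OF pMM, folded X_def \<rho>_def k_def]
  have k: "1 \<le> k"
    using p_MM_length[OF pMM d] unfolding k_def by simp
  have X0: "X 0 = {}" "\<rho> 0 = 0"
    by (simp_all add: X_def \<rho>_def)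
  define L where "L = lower_face lo (Xs, rs)"
  define K where "K = upper_face hi (Xs, rs)"
  have L: "L = (if \<rho> 1 = lo * int (card (X 1)) then X 1 else {})"
    unfolding L_def X_def \<rho>_def lower_face.simps ..
  have K: "K = (if r - \<rho> (k - 1) = hi * int (card ({1..d} - X (k - 1))) then {1..d} - X (k - 1) else {})"
    unfolding K_def upper_face.simps Let_def X_def[symmetric] \<rho>_def[symmetric] k_def[symmetric] nth(2,3) ..
  \<comment> \<open>\<open>X a\<close> is the lower face and \<open>X b\<close> the complement of
    the upper one, so \<open>M\<close> consists of the blocks between \<open>X a\<close> and
    \<open>X b\<close>.\<close>
  define a where "a = (if L = {} then 0 else 1::nat)"
  define b where "b = (if K = {} then k else k - 1)"
  have Xa: "X a = L"
    using X0 L unfolding a_def by (auto split: if_splits)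
  have Xb: "X b = {1..d} - K"
    using K nth(2) nth(6)[of "k - 1"] unfolding b_def by (auto split: if_splits)
  have ab: "a \<le> k" "b \<le> k"
    using k unfolding a_def b_def by auto
  \<comment> \<open>A representative of block number \<open>j\<close> of \<open>M\<close>, counted
    from 0.\<close>
  define x where "x j = (SOME e. e \<in> X (a + Suc j) - X (a + j))" for j
  have x: "x j \<in> X (a + Suc j) - X (a + j)" if "a + Suc j \<le> k" for j
    unfolding x_def by (rule someI_ex) (use nth(4)[of "a + j" "a + Suc j"] that in auto)
  have xX: "x j \<in> X (a + l) \<longleftrightarrow> j < l" if "a + Suc j \<le> k" "a + l \<le> k" for j l
  proof (cases "j < l")
    case True
    then show ?thesis
      using x[OF that(1)] nth(5)[of "a + Suc j" "a + l"] that(2) by auto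
  next
    case False
    then show ?thesis
      using x[OF that(1)] nth(5)[of "a + l" "a + j"] that by auto
  qed
  have xM: "x j \<in> M" if "a + Suc j \<le> b" for j
  proof -
    have "a + Suc j \<le> k" using that ab by simp
    note x[OF this]
    moreover have "X (a + Suc j) \<subseteq> {1..d} - K" "L \<subseteq> X (a + j)"
      using nth(5)[OF that] nth(5)[of a "a + j"] ab that unfolding Xa Xb by auto
    ultimately show ?thesis
      unfolding M L_def[symmetric] K_def[symmetric] by auto
  qed
  \<comment> \<open>The number of cuts between neighbouring blocks of \<open>M\<close>, one less
    than the number of blocks; truncated subtraction gives 0 if there is at most one block.\<close>
  define n where "n = b - a - 1"
  \<comment> \<open>Pairs of elements in a common block of \<open>Xs\<close>.\<close>
  define E where "E = {(e, e') \<in> M \<times> M. \<forall>j\<le>k. e \<in> X j \<longleftrightarrow> e' \<in> X j}"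
  define blockwise where "blockwise A \<longleftrightarrow> (\<forall>(e, e')\<in>E. e \<in> A \<longleftrightarrow> e' \<in> A)" for A
  have finM: "finite M"
    unfolding M by simp
  have E: "finite E" "E \<subseteq> M \<times> M"
    using finM unfolding E_def by (auto intro: finite_subset[of _ "M \<times> M"])
  \<comment> \<open>Because all chains of \<open>I\<close> have the same two faces, a member of any
    of them is determined, apart from the full set, by its trace on \<open>M\<close>.\<close>
  have act_elem: "A \<subseteq> {1..d}" "L \<subseteq> A" "A = {1..d} \<or> A \<subseteq> {1..d} - K" if qI: "q \<in> I" and A: "A \<in> act q" for q A
  proof -
    obtain Ys ts where q: "q = (Ys, ts)" by force
    have qMM: "(Ys, ts) \<in> p_MM d r" using I(3)[OF qI] unfolding q .
    define m where "m = length Ys"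
    define Y where "Y = (\<lambda>j. ({} # Ys) ! j)"
    define \<tau> where "\<tau> = (\<lambda>j. (0 # ts) ! j)"
    note nth' = p_MM_nth[OF qMM, folded Y_def \<tau>_def m_def]
    obtain t where "(A, t) \<in> set (zip Ys ts)"
      using A unfolding act q by auto
    then obtain j where j: "0 < j" "j \<le> m" "A = Y j"
      using mem_set_zip_iff[OF nth'(1)[unfolded m_def]] unfolding Y_def m_def by blast
    have LY: "L = (if \<tau> 1 = lo * int (card (Y 1)) then Y 1 else {})"
      using faces(1)[OF qI, symmetric] unfolding L_def[symmetric] unfolding q Y_def \<tau>_def lower_face.simps .
    have KY: "K = (if r - \<tau> (m - 1) = hi * int (card ({1..d} - Y (m - 1))) then {1..d} - Y (m - 1) else {})"
      using faces(2)[OF qI, symmetric] unfolding K_def[symmetric] unfolding q upper_face.simps Let_def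
        Y_def[symmetric] \<tau>_def[symmetric] m_def[symmetric] nth'(2,3) .
    show "A \<subseteq> {1..d}"
      using nth'(6)[OF j(2)] unfolding j(3) .
    show "L \<subseteq> A"
      using nth'(5)[of 1 j] j unfolding LY by auto
    show "A = {1..d} \<or> A \<subseteq> {1..d} - K"
    proof (cases "j = m")
      case True
      then show ?thesis using j(3) nth'(2) by simp
    next
      case False
      then have "A \<subseteq> Y (m - 1)"
        using nth'(5)[of j "m - 1"] j by simp
      then show ?thesis
        using nth'(6)[OF j(2)] unfolding KY j(3) by auto
    qed
  qed
  have act_chain: "A \<subseteq> B \<or> B \<subseteq> A" if q: "q \<in> I" and AB: "A \<in> act q" "B \<in> act q" for q A B
  proof -
    have qMM: "(fst q, snd q) \<in> p_MM d r" using I(3)[OF q] by simp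
    obtain i j where ij: "i \<le> length (fst q)" "A = ({} # fst q) ! i" "j \<le> length (fst q)" "B = ({} # fst q) ! j"
      using AB unfolding act mem_Collect_eq mem_set_zip_iff[OF p_MM_nth(1)[OF qMM]] by blast
    show ?thesis
      using p_MM_nth(5)[OF qMM, of i j] p_MM_nth(5)[OF qMM, of j i] ij by (cases "i \<le> j") auto
  qed
  have act_fin: "finite (act q)" for q
    by (rule finite_subset[of _ "fst ` set (zip (fst q) (snd q))"]) (force simp: act)+
  define act1 where "act1 q = {A\<in>act q. blockwise A}" for q
  define good where "good q \<longleftrightarrow>
    (\<forall>j<n. \<exists>A\<in>act1 q. (\<forall>l<j. x l \<in> A \<longleftrightarrow> x (Suc l) \<in> A) \<and> x j \<in> A \<and> x (Suc j) \<notin> A)" for q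
  \<comment> \<open>The zero vector lies in every cone, so evaluating there leaves the bare sum of
    the coefficients of the \<open>good\<close> chains.\<close>
  have "(\<Sum>q\<in>{q\<in>I. good q}. c q *
      of_bool (\<forall>A\<in>{A\<in>act1 q. \<forall>l<n. x l \<in> A \<longleftrightarrow> x (Suc l) \<in> A}. sum (\<lambda>_. 0::real) A \<le> 0)) = 0"
    unfolding good_def
  proof (rule cone_relation_restrict_all[where M = M])
    show "(\<Sum>q\<in>I. c q * of_bool (\<forall>A\<in>act1 q. sum u A \<le> 0)) = 0" if u: "u \<in> directions M" for u
      unfolding act1_def blockwise_def
    proof (rule cone_relation_merge_all[OF I(1) _ _ finM _ zero E u])
      show "finite A" if "q \<in> I" "A \<in> act q" for q A
        using act_elem(1)[OF that] finite_subset by blast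
    qed (use act_fin act_chain in auto)
    show "finite A" if "q \<in> I" "A \<in> act1 q" for q A
      using act_elem(1)[OF that(1)] that(2) finite_subset unfolding act1_def by blast
    show "A \<subseteq> B \<or> B \<subseteq> A" if "q \<in> I" "A \<in> act1 q" "B \<in> act1 q" for q A B
      using act_chain[OF that(1)] that(2,3) unfolding act1_def by blast
    show "x j \<in> M \<and> x (Suc j) \<in> M" if "j < n" for j
      using xM that unfolding n_def by simp
  qed (use I(1) finM act_fin in \<open>auto simp: act1_def directions_def\<close>)
  then have sum_good: "(\<Sum>q\<in>{q\<in>I. good q}. c q) = 0"
    by simp
  have index: "a + Suc (Suc j) \<le> b" if "j < n" for j
    using that unfolding n_def by simp
  have "good (Xs, rs)"
    unfolding good_def
  proof (intro allI impI)
    fix j assume j: "j < n"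
    have jk: "a + Suc (Suc j) \<le> k"
      using index[OF j] ab by simp
    have xj: "x l \<in> X (a + Suc j) \<longleftrightarrow> l < Suc j" if "l \<le> Suc j" for l
      using xX[of l "Suc j"] jk that by simp
    show "\<exists>A\<in>act1 (Xs, rs). (\<forall>l<j. x l \<in> A \<longleftrightarrow> x (Suc l) \<in> A) \<and> x j \<in> A \<and> x (Suc j) \<notin> A"
    proof (intro bexI conjI allI impI)
      have "sum z (X (a + Suc j)) = of_int (\<rho> (a + Suc j))"
        using z[folded X_def \<rho>_def k_def, of "a + Suc j"] jk by simp
      moreover have "(X (a + Suc j), \<rho> (a + Suc j)) \<in> set (zip Xs rs)"
        using jk unfolding mem_set_zip_iff[OF nth(1)[unfolded k_def]] X_def \<rho>_def k_def
        by (intro exI[of _ "a + Suc j"]) auto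
      moreover have "blockwise (X (a + Suc j))"
        using jk unfolding blockwise_def E_def by auto
      ultimately show "X (a + Suc j) \<in> act1 (Xs, rs)"
        unfolding act1_def act fst_conv snd_conv by blast
    qed (use xj in simp_all)
  qed
  moreover have "q = (Xs, rs)" if q: "q \<in> I" "good q" for q
  proof -
    obtain Ys ts where qe: "q = (Ys, ts)" by force
    have qMM: "(Ys, ts) \<in> p_MM d r" using I(3)[OF q(1)] unfolding qe .
    have "\<exists>A. \<forall>j<n. A j \<in> act1 q \<and> (\<forall>l<j. x l \<in> A j \<longleftrightarrow> x (Suc l) \<in> A j) \<and> x j \<in> A j \<and> x (Suc j) \<notin> A j"
      using q(2) unfolding good_def Bex_def by (intro choice) blast
    then obtain A where A: "\<And>j. j < n \<Longrightarrow> A j \<in> act q" "\<And>j. j < n \<Longrightarrow> blockwise (A j)"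
      "\<And>j l. j < n \<Longrightarrow> l < j \<Longrightarrow> x l \<in> A j \<longleftrightarrow> x (Suc l) \<in> A j"
      "\<And>j. j < n \<Longrightarrow> x j \<in> A j" "\<And>j. j < n \<Longrightarrow> x (Suc j) \<notin> A j"
      unfolding act1_def by blast
    have below: "x l \<in> A j" if "l \<le> j" "j < n" for l j
      using that
    proof (induction rule: inc_induct)
      case base
      then show ?case using A(4) by simp
    next
      case (step l)
      then show ?case using A(3)[of j l] by simp
    qed
    \<comment> \<open>For \<open>l\<close> beyond \<open>Suc j\<close>, the set
      \<open>A (l - 1)\<close> contains \<open>x (Suc j)\<close> while \<open>A j\<close> does not.
      Comparability gives that \<open>A j\<close> is contained in \<open>A (l - 1)\<close>, which
      misses \<open>x l\<close>.\<close>
    have above: "x l \<notin> A j" if l: "j < l" "l \<le> n" and j: "j < n" for l j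
    proof (cases "l = Suc j")
      case True
      then show ?thesis using A(5)[OF j] by simp
    next
      case False
      then have l': "l - 1 < n" "Suc j \<le> l - 1" "Suc (l - 1) = l"
        using l by auto
      have "x (Suc j) \<in> A (l - 1)"
        using below[OF l'(2,1)] .
      then have "A j \<subseteq> A (l - 1)"
        using act_chain[OF q(1) A(1)[OF j] A(1)[OF l'(1)]] A(5)[OF j] by blast
      then show ?thesis
        using A(5)[OF l'(1)] l'(3) by auto
    qed
    have eq: "A j = X (a + Suc j)" if j: "j < n" for j
    proof -
      have jb: "a + Suc (Suc j) \<le> b"
        using index[OF j] .
      note elem = act_elem[OF q(1) A(1)[OF j]]
      have "x (Suc j) \<in> {1..d}"
        using xM[OF jb] unfolding M by blast
      then have "A j \<subseteq> {1..d} - K"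
        using elem(3) A(5)[OF j] by auto
      moreover have "L \<subseteq> X (a + Suc j)" "X (a + Suc j) \<subseteq> {1..d} - K"
        using nth(5)[of a "a + Suc j"] nth(5)[of "a + Suc j" b] ab jb unfolding Xa Xb by auto
      \<comment> \<open>On \<open>M\<close> both sets are unions of blocks, so it is enough to
        compare them on block representatives.\<close>
      moreover have "e \<in> A j \<longleftrightarrow> e \<in> X (a + Suc j)" if e: "e \<in> M" for e
      proof -
        have "e \<in> X b" "e \<notin> X a"
          using e unfolding M Xa Xb L_def K_def by auto
        then have "\<exists>l. a + Suc l \<le> b \<and> e \<in> X (a + Suc l) - X (a + l)"
        proof -
          obtain i where i: "i < b" "e \<in> X (Suc i) - X i"
            using block_of_element[of e X b] \<open>e \<in> X b\<close> X0(1) by blast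
          have "a \<le> i"
          proof (rule ccontr)
            assume "\<not> a \<le> i"
            then show False
              using nth(5)[of "Suc i" a] i \<open>e \<notin> X a\<close> ab by auto
          qed
          then show ?thesis
            using i by (intro exI[of _ "i - a"]) auto
        qed
        then obtain l where l: "a + Suc l \<le> b" "e \<in> X (a + Suc l) - X (a + l)"
          by blast
        have lk: "a + Suc l \<le> k" using l(1) ab by simp
        have same: "e \<in> X i \<longleftrightarrow> x l \<in> X i" if "i \<le> k" for i
        proof (cases "a + l < i")
          case True
          then show ?thesis
            using l(2) x[OF lk] nth(5)[of "a + Suc l" i] that by auto
        next
          case False
          then show ?thesis
            using l(2) x[OF lk] nth(5)[of i "a + l"] lk by auto
        qed
        then have "(e, x l) \<in> E"
          using e xM[OF l(1)] unfolding E_def by blast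
        then have "e \<in> A j \<longleftrightarrow> x l \<in> A j"
          using A(2)[OF j] unfolding blockwise_def by blast
        also have "\<dots> \<longleftrightarrow> l \<le> j"
        proof (cases "l \<le> j")
          case False
          then have "j < l" "l \<le> n"
            using j l(1) unfolding n_def by auto
          then show ?thesis
            using above j by simp
        qed (use below j in auto)
        also have "\<dots> \<longleftrightarrow> x l \<in> X (a + Suc j)"
          using xX[OF lk, of "Suc j"] jb ab by auto
        also have "\<dots> \<longleftrightarrow> e \<in> X (a + Suc j)"
          using same[of "a + Suc j"] jb ab by auto
        finally show ?thesis .
      qed
      ultimately show ?thesis
        using elem(2) unfolding M L_def[symmetric] K_def[symmetric] by blast
    qed
    have "(Ys, ts) = (Xs, rs)"
    proof (rule box_chains_tight_unique[OF pMM qMM d, where lo = lo and hi = hi, folded X_def \<rho>_def k_def])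
      show "lower_face lo (Ys, ts) = lower_face lo (Xs, rs)" "upper_face hi (Ys, ts) = upper_face hi (Xs, rs)"
        "length Ys \<le> k"
        using faces[OF q(1)] len[OF q(1)] unfolding qe k_def by simp_all
      fix j assume j: "0 < j" "j < k" "X j \<noteq> lower_face lo (Xs, rs)" "X j \<noteq> {1..d} - upper_face hi (Xs, rs)"
      have "j \<noteq> a" "j \<noteq> b"
        using j(3,4) Xa Xb unfolding L_def K_def by auto
      then have "a < j" "j < b"
        using j(1,2) unfolding a_def b_def by (auto split: if_splits)
      then have i: "j - a - 1 < n" "a + Suc (j - a - 1) = j"
        unfolding n_def by auto
      have "X j \<in> act q"
        using eq[OF i(1)] A(1)[OF i(1)] unfolding i(2) by simp
      then obtain t where t: "(X j, t) \<in> set (zip Ys ts)" "sum z (X j) = of_int t"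
        unfolding act qe by auto
      \<comment> \<open>Both chains are tight at \<open>z\<close> on the set \<open>X j\<close>,
        which forces their bounds to agree.\<close>
      have "t = \<rho> j"
        using t(2) z[folded X_def \<rho>_def k_def, of j] j(2) by simp
      then show "(X j, \<rho> j) \<in> set (zip Ys ts)"
        using t(1) by simp
    qed
    then show ?thesis
      unfolding qe .
  qed
  ultimately have "{q\<in>I. good q} = {(Xs, rs)}"
    using I(2) by blast
  then show ?thesis
    using sum_good by simp
qed

text \<open>The centre \<open>z\<close> of the chosen chain touches the boundary of the cube only in
  the coordinates that this chain pins, and any chain polyhedron through \<open>z\<close> can pin
  only such coordinates. Having the fewest pinned coordinates makes all faces coincide; having
  maximal length among those gives the length bound needed for
  \<open>chain_relation_coefficient_zero\<close>.\<close>

lemma box_chains_independent: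
  fixes c :: "nat set list \<times> int list \<Rightarrow> int"
  assumes fin: "finite I" and I: "I \<subseteq> box_chains lo hi d r" and d: "1 \<le> d" and lohi: "lo < hi"
    and zero: "\<And>y. y \<in> Rspace d \<Longrightarrow> (\<And>i. i \<in> {1..d} \<Longrightarrow> of_int lo \<le> y i \<and> y i \<le> of_int hi) \<Longrightarrow>
      (\<Sum>q\<in>I. c q * of_bool (y \<in> R_MM d (fst q) (snd q))) = 0"
    and q: "q \<in> I"
  shows "c q = 0"
proof (rule ccontr)
  assume "c q \<noteq> 0"
  define I1 where "I1 = {q\<in>I. c q \<noteq> 0}"
  have I1: "finite I1" "I1 \<subseteq> p_MM d r" "q \<in> I1"
    using fin I q \<open>c q \<noteq> 0\<close> unfolding I1_def box_chains_def by auto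
  define f where "f q = card (lower_face lo q) + card (upper_face hi q)" for q
  obtain p0 where p0: "p0 \<in> I1" "\<And>q. q \<in> I1 \<Longrightarrow> f p0 \<le> f q"
    using ex_has_least_nat[of "\<lambda>q. q \<in> I1" q f] I1(3) by blast
  \<comment> \<open>Minimizing \<open>d - length\<close> maximizes the length, as lengths are at
    most \<open>d\<close>.\<close>
  obtain p where p: "p \<in> I1" "f p = f p0"
      "\<And>q. q \<in> I1 \<Longrightarrow> f q = f p0 \<Longrightarrow> d - length (fst p) \<le> d - length (fst q)"
    using ex_has_least_nat[of "\<lambda>q. q \<in> I1 \<and> f q = f p0" p0 "\<lambda>q. d - length (fst q)"] p0(1) by blast
  obtain Xs rs where pe: "p = (Xs, rs)" by force
  have lohi': "real_of_int lo < of_int hi"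
    using lohi by simp
  have box: "(Xs, rs) \<in> box_chains lo hi d r"
    using p(1) I unfolding pe I1_def by auto
  obtain z where z: "z \<in> Rspace d"
    "\<And>j. j \<le> length Xs \<Longrightarrow> sum z (({} # Xs) ! j) = of_int ((0 # rs) ! j)"
    "\<And>i. i \<in> {1..d} \<Longrightarrow> of_int lo \<le> z i \<and> z i \<le> of_int hi"
    "\<And>i. i \<in> lower_face lo (Xs, rs) \<Longrightarrow> z i = of_int lo"
    "\<And>i. i \<in> upper_face hi (Xs, rs) \<Longrightarrow> z i = of_int hi"
    "\<And>i. i \<in> {1..d} - lower_face lo (Xs, rs) - upper_face hi (Xs, rs) \<Longrightarrow> of_int lo < z i \<and> z i < of_int hi"
    using box_chains_central_point[OF box d] by blast
  define I0 where "I0 = {q\<in>I1. z \<in> R_MM d (fst q) (snd q)}"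
  define M where "M = {1..d} - lower_face lo (Xs, rs) - upper_face hi (Xs, rs)"
  have pMM: "(Xs, rs) \<in> p_MM d r"
    using box unfolding box_chains_def by blast
  note nth = p_MM_nth[OF pMM]
  have zp: "z \<in> R_MM d Xs rs"
    unfolding mem_R_MM_iff[OF pMM]
  proof (intro conjI z(1))
    show "sum z {1..d} = of_int r"
      using z(2)[OF order.refl] unfolding nth(2,3) .
    show "\<forall>(A, t)\<in>set (zip Xs rs). sum z A \<le> of_int t"
    proof clarify
      fix A t assume "(A, t) \<in> set (zip Xs rs)"
      then obtain j where "j \<le> length Xs" "A = ({} # Xs) ! j" "t = (0 # rs) ! j"
        unfolding mem_set_zip_iff[OF nth(1)] by blast
      then show "sum z A \<le> of_int t"
        using z(2)[of j] by (simp only: order.refl)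
    qed
  qed
  have faces: "lower_face lo q = lower_face lo (Xs, rs) \<and> upper_face hi q = upper_face hi (Xs, rs)"
    if q: "q \<in> I0" for q
  proof -
    obtain Ys ts where qe: "q = (Ys, ts)" by force
    have qMM: "(Ys, ts) \<in> p_MM d r" and qz: "z \<in> R_MM d Ys ts" and q1: "q \<in> I1"
      using q I1(2) unfolding qe I0_def by auto
    have sub: "lower_face lo (Xs', rs') \<subseteq> {1..d}" "upper_face hi (Xs', rs') \<subseteq> {1..d}"
      if "(Xs', rs') \<in> p_MM d r" for Xs' rs'
    proof -
      have "1 \<le> length Xs'"
        using p_MM_length[OF that d] by simp
      note p_MM_nth(6)[OF that this]
      then show "lower_face lo (Xs', rs') \<subseteq> {1..d}"
        unfolding lower_face.simps by (simp only: empty_subsetI simp_thms split: if_split)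
      show "upper_face hi (Xs', rs') \<subseteq> {1..d}"
        unfolding upper_face.simps Let_def p_MM_nth(2,3)[OF that] by (simp only: Diff_subset empty_subsetI simp_thms split: if_split)
    qed
    \<comment> \<open>A coordinate at which \<open>z\<close> equals \<open>lo\<close> is neither
      free nor, as \<open>lo < hi\<close>, in the upper face of the chosen chain.\<close>
    have "lower_face lo q \<subseteq> lower_face lo (Xs, rs)"
    proof
      fix i assume i: "i \<in> lower_face lo q"
      have "z i = of_int lo" "i \<in> {1..d}"
        using face_values(1)[OF qMM d qz z(3)] i sub(1)[OF qMM] unfolding qe by auto
      then show "i \<in> lower_face lo (Xs, rs)"
        using z(5)[of i] z(6)[of i] lohi' by (cases "i \<in> lower_face lo (Xs, rs)"; cases "i \<in> upper_face hi (Xs, rs)") auto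
    qed
    moreover have "upper_face hi q \<subseteq> upper_face hi (Xs, rs)"
    proof
      fix i assume i: "i \<in> upper_face hi q"
      have "z i = of_int hi" "i \<in> {1..d}"
        using face_values(2)[OF qMM d qz z(3)] i sub(2)[OF qMM] unfolding qe by auto
      then show "i \<in> upper_face hi (Xs, rs)"
        using z(4)[of i] z(6)[of i] lohi' by (cases "i \<in> lower_face lo (Xs, rs)"; cases "i \<in> upper_face hi (Xs, rs)") auto
    qed
    moreover have fin_faces: "finite (lower_face lo (Xs, rs))" "finite (upper_face hi (Xs, rs))"
      using sub[OF pMM] finite_subset by blast+
    moreover have "f p \<le> f q"
      using p(2) p0(2)[OF q1] by simp
    ultimately show ?thesis
      using card_mono[of "lower_face lo (Xs, rs)" "lower_face lo q"]
        card_mono[of "upper_face hi (Xs, rs)" "upper_face hi q"]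
      unfolding f_def pe[symmetric] by (intro conjI card_subset_eq) linarith+
  qed
  have "c (Xs, rs) = 0"
  proof (rule chain_relation_coefficient_zero[OF box d, where I = I0 and z = z])
    show "finite I0" "(Xs, rs) \<in> I0"
      using I1(1) p(1) zp unfolding I0_def pe by auto
    show "q \<in> p_MM d r" if "q \<in> I0" for q
      using that I1(2) unfolding I0_def by auto
    show "length (fst q) \<le> length Xs" if q: "q \<in> I0" for q
    proof -
      have "f q = f p0"
        using faces[OF q] p(2) unfolding f_def pe by simp
      then have "d - length Xs \<le> d - length (fst q)"
        using p(3)[of q] q unfolding I0_def pe by simp
      moreover have "length (fst q) \<le> d"
        using p_MM_length[of "fst q" "snd q" d r] d q I1(2) unfolding I0_def by auto
      ultimately show ?thesis
        by simp
    qed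
    show "(\<Sum>q\<in>I0. c q * of_bool (\<forall>A\<in>{A. \<exists>t. (A, t) \<in> set (zip (fst q) (snd q)) \<and> sum z A = of_int t}. sum u A \<le> 0)) = 0"
      if u: "u \<in> directions M" for u
      unfolding I0_def
    proof (rule local_cone_relation[OF I1(1,2) _ z(1,3) _ _ u])
      fix y assume y: "y \<in> Rspace d" "\<And>i. i \<in> {1..d} \<Longrightarrow> of_int lo \<le> y i \<and> y i \<le> of_int hi"
      have "(\<Sum>q\<in>I1. c q * of_bool (y \<in> R_MM d (fst q) (snd q)))
          = (\<Sum>q\<in>I. c q * of_bool (y \<in> R_MM d (fst q) (snd q)))"
        unfolding I1_def using fin by (intro sum.mono_neutral_left) auto
      then show "(\<Sum>q\<in>I1. c q * of_bool (y \<in> R_MM d (fst q) (snd q))) = 0"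
        using zero[OF y] by simp
    qed (use z(6) in \<open>auto simp: M_def\<close>)
  qed (fact M_def | rule refl | use faces z(2) in blast)+
  then show False
    using p(1) unfolding I1_def pe by simp
qed

section \<open>Placing the index sets in cubes\<close>

lemma block_card_pos:
  assumes "(Xs, rs) \<in> p_MM d r" "j < length Xs"
  shows "1 \<le> card (({} # Xs) ! Suc j - ({} # Xs) ! j)"
proof -
  have "({} # Xs) ! j \<subset> ({} # Xs) ! Suc j" "({} # Xs) ! Suc j \<subseteq> {1..d}"
    using p_MM_nth(4,6)[OF assms(1)] assms(2) by (metis Suc_leI lessI)+
  then have "({} # Xs) ! Suc j - ({} # Xs) ! j \<noteq> {}" "finite (({} # Xs) ! Suc j - ({} # Xs) ! j)"
    using finite_subset by blast+
  then show ?thesis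
    by (metis One_nat_def Suc_leI card_gt_0_iff)
qed

lemma p_PM_ranks:
  assumes "(Xs, rs) \<in> p_PM d r"
  shows "\<And>i j. 0 < i \<Longrightarrow> i < j \<Longrightarrow> j \<le> length Xs \<Longrightarrow> (0 # rs) ! i < (0 # rs) ! j"
    and "\<And>j. j \<le> length Xs \<Longrightarrow> 0 \<le> (0 # rs) ! j"
    and "\<And>i j. i \<le> j \<Longrightarrow> j \<le> length Xs \<Longrightarrow> (0 # rs) ! i \<le> (0 # rs) ! j"
    and "\<And>j. j \<le> length Xs \<Longrightarrow> (0 # rs) ! j \<le> r"
proof -
  have p: "(Xs, rs) \<in> p_MM d r" and sorted: "sorted_wrt (<) rs" and nonneg: "\<forall>x\<in>set rs. 0 \<le> x"
    using assms unfolding p_PM_def by auto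
  note len = p_MM_nth(1)[OF p]
  show less: "(0 # rs) ! i < (0 # rs) ! j" if "0 < i" "i < j" "j \<le> length Xs" for i j
    using sorted_wrt_nth_less[OF sorted, of "i - 1" "j - 1"] that len by (cases i; cases j) auto
  show nonneg: "0 \<le> (0 # rs) ! j" if "j \<le> length Xs" for j
    using nonneg that len by (cases j) auto
  show le: "(0 # rs) ! i \<le> (0 # rs) ! j" if "i \<le> j" "j \<le> length Xs" for i j
    using less[of i j] nonneg[of j] that by (cases "i = 0"; cases "i = j") auto
  show "(0 # rs) ! j \<le> r" if "j \<le> length Xs" for j
    using le[OF that order.refl] unfolding p_MM_nth(3)[OF p] .
qed

text \<open>Ranks lie between 0 and \<open>r\<close>, so an increment is at most \<open>r\<close>,
  whereas a nonempty block allows at least \<open>r + 1\<close>; the upper bound is thus never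
  attained.\<close>

lemma p_PM_subset_box_chains: "p_PM d r \<subseteq> box_chains 0 (r + 1) d r"
proof (rule subrelI)
  fix Xs rs assume q: "(Xs, rs) \<in> p_PM d r"
  then have p: "(Xs, rs) \<in> p_MM d r"
    unfolding p_PM_def by blast
  note ranks = p_PM_ranks[OF q]
  have "0 \<le> \<delta> \<and> \<delta> \<le> (r + 1) * n \<and> (0 < j \<longrightarrow> 0 < \<delta>) \<and> \<delta> < (r + 1) * n"
    if j: "j < length Xs" and n: "n = int (card (({} # Xs) ! Suc j - ({} # Xs) ! j))"
      and \<delta>: "\<delta> = (0 # rs) ! Suc j - (0 # rs) ! j" for j n \<delta>
  proof -
    have n1: "1 \<le> n"
      using block_card_pos[OF p j] n by simp
    have "0 \<le> (0 # rs) ! j" "(0 # rs) ! j \<le> (0 # rs) ! Suc j" "(0 # rs) ! Suc j \<le> r"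
      using ranks(2)[of j] ranks(3)[of j "Suc j"] ranks(4)[of "Suc j"] j by (simp_all del: nth_Cons_Suc)
    moreover have "0 < j \<Longrightarrow> (0 # rs) ! j < (0 # rs) ! Suc j"
      using ranks(1)[of j "Suc j"] j by (simp del: nth_Cons_Suc)
    ultimately have b: "0 \<le> \<delta>" "\<delta> < r + 1" "0 < j \<Longrightarrow> 0 < \<delta>"
      unfolding \<delta> by linarith+
    have "\<delta> < (r + 1) * 1"
      using b(2) by simp
    also have "\<dots> \<le> (r + 1) * n"
      using n1 b by (intro mult_left_mono) auto
    finally show ?thesis
      using b(1,3) by simp
  qed
  then show "(Xs, rs) \<in> box_chains 0 (r + 1) d r"
    using p unfolding box_chains_def Let_def by (auto simp del: nth_Cons_Suc)
qed

text \<open>The increase of the corank over a block is its size minus its rank increment, so the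
  corank conditions are the upper bounds for \<open>hi = 1\<close>.\<close>

lemma p_M_subset_box_chains: "p_M d r \<subseteq> box_chains 0 1 d r"
proof (rule subrelI)
  fix Xs rs assume q: "(Xs, rs) \<in> p_M d r"
  then have q': "(Xs, rs) \<in> p_PM d r"
    and corank: "\<And>j. Suc j < length Xs \<Longrightarrow> corank Xs rs j < corank Xs rs (Suc j)"
      "corank Xs rs (length Xs - 1) \<le> corank Xs rs (length Xs)"
    unfolding p_M_def by blast+
  then have p: "(Xs, rs) \<in> p_MM d r"
    unfolding p_PM_def by blast
  note ranks = p_PM_ranks[OF q']
  have "0 \<le> \<delta> \<and> \<delta> \<le> n \<and> (0 < j \<longrightarrow> 0 < \<delta>) \<and> (Suc j < length Xs \<longrightarrow> \<delta> < n)"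
    if j: "j < length Xs" and n: "n = int (card (({} # Xs) ! Suc j - ({} # Xs) ! j))"
      and \<delta>: "\<delta> = (0 # rs) ! Suc j - (0 # rs) ! j" for j n \<delta>
  proof -
    have sub: "({} # Xs) ! j \<subseteq> ({} # Xs) ! Suc j" "({} # Xs) ! Suc j \<subseteq> {1..d}"
      using p_MM_nth(5)[OF p, of j "Suc j"] p_MM_nth(6)[OF p, of "Suc j"] j by (simp_all del: nth_Cons_Suc)
    then have "n = int (card (({} # Xs) ! Suc j)) - int (card (({} # Xs) ! j))"
      unfolding n using finite_subset[OF sub(2)] finite_subset[OF sub(1)]
      by (subst card_Diff_subset) (auto simp del: nth_Cons_Suc intro!: of_nat_diff card_mono)
    then have diff: "corank Xs rs (Suc j) - corank Xs rs j = n - \<delta>"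
      unfolding corank_def \<delta> by simp
    have "(0 # rs) ! j \<le> (0 # rs) ! Suc j"
      using ranks(3)[of j "Suc j"] j by (simp_all del: nth_Cons_Suc)
    moreover have "0 < j \<Longrightarrow> (0 # rs) ! j < (0 # rs) ! Suc j"
      using ranks(1)[of j "Suc j"] j by (simp del: nth_Cons_Suc)
    moreover have "\<delta> \<le> n" "Suc j < length Xs \<Longrightarrow> \<delta> < n"
    proof -
      show "Suc j < length Xs \<Longrightarrow> \<delta> < n"
        using corank(1)[of j] diff by simp
      have "Suc j = length Xs \<Longrightarrow> length Xs - 1 = j"
        by simp
      then have "Suc j = length Xs \<Longrightarrow> \<delta> \<le> n"
        using corank(2) diff by simp
      with corank(1)[of j] show "\<delta> \<le> n"
        using diff j by (cases "Suc j = length Xs") auto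
    qed
    ultimately show ?thesis
      unfolding \<delta> by auto
  qed
  then show "(Xs, rs) \<in> box_chains 0 1 d r"
    using p unfolding box_chains_def Let_def by (auto simp del: nth_Cons_Suc)
qed

lemma finite_p_MM_subset_box_chains:
  assumes fin: "finite I" and I: "I \<subseteq> p_MM d r"
  obtains N where "0 < N" "I \<subseteq> box_chains (- N) N d r"
proof -
  \<comment> \<open>One more than the sum of the absolute values of all rank increments, so each of
    them is strictly smaller than \<open>N\<close> in absolute value.\<close>
  define N where "N = 1 + (\<Sum>q\<in>I. \<Sum>j<length (fst q). \<bar>(0 # snd q) ! Suc j - (0 # snd q) ! j\<bar>)"
  have "I \<subseteq> box_chains (- N) N d r"
  proof (rule subrelI)
    fix Xs rs assume q: "(Xs, rs) \<in> I"
    then have p: "(Xs, rs) \<in> p_MM d r"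
      using I by blast
    have "(- N) * n \<le> \<delta> \<and> \<delta> \<le> N * n \<and> (0 < j \<longrightarrow> (- N) * n < \<delta>) \<and> (Suc j < length Xs \<longrightarrow> \<delta> < N * n)"
      if j: "j < length Xs" and n: "n = int (card (({} # Xs) ! Suc j - ({} # Xs) ! j))"
        and \<delta>: "\<delta> = (0 # rs) ! Suc j - (0 # rs) ! j" for j n \<delta>
    proof -
      have "\<bar>\<delta>\<bar> \<le> (\<Sum>j<length Xs. \<bar>(0 # rs) ! Suc j - (0 # rs) ! j\<bar>)"
        unfolding \<delta> using j by (intro member_le_sum) auto
      also have "\<dots> = (\<Sum>j<length (fst (Xs, rs)). \<bar>(0 # snd (Xs, rs)) ! Suc j - (0 # snd (Xs, rs)) ! j\<bar>)"
        by simp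
      also have "\<dots> \<le> (\<Sum>q\<in>I. \<Sum>j<length (fst q). \<bar>(0 # snd q) ! Suc j - (0 # snd q) ! j\<bar>)"
        by (rule member_le_sum[OF q _ fin]) (simp add: sum_nonneg)
      finally have "\<bar>\<delta>\<bar> < N"
        unfolding N_def by simp
      moreover have "N * 1 \<le> N * n"
        using block_card_pos[OF p j] n calculation by (intro mult_left_mono) auto
      ultimately show ?thesis
        by auto
    qed
    then show "(Xs, rs) \<in> box_chains (- N) N d r"
      using p unfolding box_chains_def Let_def by (auto simp del: nth_Cons_Suc)
  qed
  moreover have "0 < N"
    unfolding N_def by (intro add_pos_nonneg sum_nonneg) auto
  ultimately show ?thesis
    using that by blast
qed

lemma p_star_subset_p_MM: "p_star s d r \<subseteq> p_MM d r"
  by (cases s) (auto simp: p_PM_def p_M_def)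

text \<open>The part of \<open>R_star\<close> that does not depend on the chain; it allows the three
  kinds to be treated together.\<close>

fun ambient :: "kind \<Rightarrow> nat \<Rightarrow> int \<Rightarrow> (nat \<Rightarrow> real) set" where
  "ambient MegaMatroid d r = {y \<in> Rspace d. (\<Sum>i\<in>{1..d}. y i) = of_int r}"
| "ambient PolyMatroid d r = Delta_PM d r"
| "ambient Matroid d r = Delta_M d r"

lemma ambient_subset: "ambient s d r \<subseteq> {y \<in> Rspace d. (\<Sum>i\<in>{1..d}. y i) = of_int r}"
  by (cases s) (auto simp: Delta_PM_def Delta_M_def)

lemma mem_R_star_iff:
  assumes "(Xs, rs) \<in> p_MM d r"
  shows "y \<in> R_star s d r Xs rs \<longleftrightarrow>
    y \<in> ambient s d r \<and> (\<forall>(A, t)\<in>set (zip Xs rs). sum y A \<le> of_int t)"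
  using ambient_subset[of s d r] by (cases s) (auto simp: mem_R_MM_iff[OF assms] Delta_PM_def Delta_M_def)

text \<open>The cubes are chosen so that each of their points of total \<open>r\<close> lies in the
  ambient set. There \<open>R_star\<close> and \<open>R_MM\<close> agree, and the relation can be
  passed to \<open>box_chains_independent\<close>.\<close>

lemma R_star_independent:
  fixes c :: "nat set list \<times> int list \<Rightarrow> int"
  assumes fin: "finite I" and I: "I \<subseteq> p_star s d r"
    and zero: "\<And>y. y \<in> Rspace d \<Longrightarrow> (\<Sum>q\<in>I. c q * of_bool (y \<in> R_star s d r (fst q) (snd q))) = 0"
    and q: "q \<in> I"
  shows "c q = 0"
proof (cases "d = 0")
  case True
  then have r: "r = 0" "I = {([], [])}" "q = ([], [])"
    using I q unfolding True p_star_0 by (auto split: if_splits)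
  have "(\<lambda>_. undefined) \<in> Rspace d"
    \<comment> \<open>The only point of the space for \<open>d = 0\<close> is the function that is
      undefined everywhere.\<close>
    unfolding True Rspace_def by auto
  from zero[OF this] \<open>(\<lambda>_. undefined) \<in> Rspace d\<close> show ?thesis
    unfolding r True by (cases s) (auto simp: R_MM_def Delta_PM_def Delta_M_def)
next
  case False
  then have d: "1 \<le> d" by simp
  have pMM: "(fst q, snd q) \<in> p_MM d r" if "q \<in> I" for q
    using subsetD[OF p_star_subset_p_MM subsetD[OF I that]] by simp
  have concl: "c q = 0" if box: "I \<subseteq> box_chains lo hi d r" and lohi: "lo < hi"
    and amb: "\<And>y. y \<in> Rspace d \<Longrightarrow> (\<And>i. i \<in> {1..d} \<Longrightarrow> of_int lo \<le> y i \<and> y i \<le> of_int hi) \<Longrightarrow>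
      sum y {1..d} = of_int r \<Longrightarrow> y \<in> ambient s d r" for lo hi
  proof (rule box_chains_independent[OF fin box d lohi _ q])
    fix y assume y: "y \<in> Rspace d" "\<And>i. i \<in> {1..d} \<Longrightarrow> of_int lo \<le> y i \<and> y i \<le> of_int hi"
    have "y \<in> R_MM d (fst q) (snd q) \<longleftrightarrow> y \<in> R_star s d r (fst q) (snd q)" if "q \<in> I" for q
      using amb[OF y] ambient_subset[of s d r] y(1)
      unfolding mem_R_star_iff[OF pMM[OF that]] mem_R_MM_iff[OF pMM[OF that]] by auto
    then have "(\<Sum>q\<in>I. c q * of_bool (y \<in> R_MM d (fst q) (snd q)))
        = (\<Sum>q\<in>I. c q * of_bool (y \<in> R_star s d r (fst q) (snd q)))"
      by (intro sum.cong) auto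
    then show "(\<Sum>q\<in>I. c q * of_bool (y \<in> R_MM d (fst q) (snd q))) = 0"
      using zero[OF y(1)] by simp
  qed
  show ?thesis
  proof (cases s)
    case MegaMatroid
    then obtain N where N: "0 < N" "I \<subseteq> box_chains (- N) N d r"
      using finite_p_MM_subset_box_chains[OF fin] I by auto
    show ?thesis
      using concl[OF N(2)] N(1) MegaMatroid by auto
  next
    case PolyMatroid
    \<comment> \<open>Since \<open>q\<close> is an index, \<open>r\<close> is nonnegative; this
      gives \<open>0 < r + 1\<close>, the nondegeneracy of the cube.\<close>
    then have "0 \<le> r"
      using q I p_PM_ranks(2,4)[of "fst q" "snd q" d r 0] by auto
    then show ?thesis
      using concl[of 0 "r + 1"] p_PM_subset_box_chains[of d r] I PolyMatroid by (auto simp: Delta_PM_def)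
  next
    case Matroid
    then show ?thesis
      using concl[of 0 1] p_M_subset_box_chains[of d r] I by (auto simp: Delta_M_def)
  qed
qed

section \<open>Spanning\<close>

text \<open>
  The family \<open>V\<close> is conically contractible via \<open>A \<subseteq> A \<union> M \<supseteq> M\<close>. The involution toggles
  \<open>M \<union> A\<close> in a chain, where \<open>A\<close> is the largest member of the chain that does not contain \<open>M\<close>.
\<close>

lemma alternating_chain_sum_zero:
  assumes fin: "finite V" and M: "M \<in> V" and V: "\<And>A. A \<in> V \<Longrightarrow> A \<union> M \<in> V"
  shows "(\<Sum>C\<in>{C. C \<subseteq> V \<and> chain_subset C}. (- 1 :: int) ^ card C) = 0"
proof -
  let ?S = "{C. C \<subseteq> V \<and> chain_subset C}"
  \<comment> \<open>In a chain this union is the largest member not containing \<open>M\<close>,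
    joined with \<open>M\<close>; it is \<open>M\<close> itself if there is no such member.\<close>
  define h where "h C = M \<union> \<Union>{A\<in>C. \<not> M \<subseteq> A}" for C
  define toggle where "toggle C = (if h C \<in> C then C - {h C} else insert (h C) C)" for C
  have M_h: "M \<subseteq> h C" for C
    unfolding h_def by blast
  \<comment> \<open>As \<open>h C\<close> contains \<open>M\<close>, inserting or deleting it does
    not affect the family from which \<open>h\<close> is computed.\<close>
  have h_toggle: "h (toggle C) = h C" for C
  proof -
    have "{A\<in>toggle C. \<not> M \<subseteq> A} = {A\<in>C. \<not> M \<subseteq> A}"
      using M_h unfolding toggle_def by auto
    then show ?thesis
      unfolding h_def by simp
  qed
  then have toggle_toggle: "toggle (toggle C) = C" for C
    unfolding toggle_def[of "toggle C"] unfolding toggle_def by auto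
  have finC: "finite C" if "C \<in> ?S" for C
    using that fin finite_subset by blast
  have h_cases: "h C = M \<or> (\<exists>A\<in>C. \<not> M \<subseteq> A \<and> h C = A \<union> M \<and> (\<forall>B\<in>C. \<not> M \<subseteq> B \<longrightarrow> B \<subseteq> A))" if C: "C \<in> ?S" for C
  proof (cases "{A\<in>C. \<not> M \<subseteq> A} = {}")
    case False
    then obtain A where A: "A \<in> {A\<in>C. \<not> M \<subseteq> A}" "\<And>B. B \<in> {A\<in>C. \<not> M \<subseteq> A} \<Longrightarrow> A \<subseteq> B \<Longrightarrow> A = B"
      using finite_has_maximal[of "{A\<in>C. \<not> M \<subseteq> A}"] finC[OF C] by auto
    have "B \<subseteq> A" if "B \<in> {A\<in>C. \<not> M \<subseteq> A}" for B
      using A that C unfolding chain_subset_def by blast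
    then show ?thesis
      using A(1) unfolding h_def by blast
  qed (auto simp: h_def)
  have hV: "h C \<in> V" if "C \<in> ?S" for C
    using h_cases[OF that] M V that by auto
  have comparable: "B \<subseteq> h C \<or> h C \<subseteq> B" if C: "C \<in> ?S" and B: "B \<in> C" for B C
  proof (cases "M \<subseteq> B")
    case True
    show ?thesis
      using h_cases[OF C]
    proof
      assume "\<exists>A\<in>C. \<not> M \<subseteq> A \<and> h C = A \<union> M \<and> (\<forall>B\<in>C. \<not> M \<subseteq> B \<longrightarrow> B \<subseteq> A)"
      then obtain A where A: "A \<in> C" "\<not> M \<subseteq> A" "h C = A \<union> M"
        by blast
      \<comment> \<open>The second alternative would put \<open>M\<close> inside
        \<open>A\<close>.\<close>
      have "A \<subseteq> B \<or> B \<subseteq> A"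
        using A(1) B C unfolding chain_subset_def by blast
      then show ?thesis
        using A True by blast
    qed (use True in blast)
  next
    case False
    then show ?thesis
      using B unfolding h_def by blast
  qed
  have toggle_S: "toggle C \<in> ?S" if C: "C \<in> ?S" for C
  proof (cases "h C \<in> C")
    case True
    then have "toggle C \<subseteq> C"
      by (auto simp: toggle_def)
    then show ?thesis
      using C unfolding chain_subset_def mem_Collect_eq by blast
  next
    case False
    have "chain_subset (insert (h C) C)"
      unfolding chain_subset_def
    proof (intro ballI)
      fix A B assume AB: "A \<in> insert (h C) C" "B \<in> insert (h C) C"
      then consider "A = B" | "A = h C" "B \<in> C" | "B = h C" "A \<in> C" | "A \<in> C" "B \<in> C"
        by blast
      then show "A \<subseteq> B \<or> B \<subseteq> A"
      proof cases
        case 4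
        then show ?thesis
          using C unfolding chain_subset_def by blast
      qed (use comparable[OF C] in auto)
    qed
    moreover have "toggle C = insert (h C) C"
      using False by (simp add: toggle_def)
    ultimately show ?thesis
      using C hV[OF C] by simp
  qed
  have sign: "(- 1 :: int) ^ card (toggle C) = - ((- 1) ^ card C)" if C: "C \<in> ?S" for C
  proof (cases "h C \<in> C")
    case True
    then have "card C = Suc (card (C - {h C}))"
      by (rule card.remove[OF finC[OF C]])
    moreover have "toggle C = C - {h C}"
      using True by (simp add: toggle_def)
    ultimately show ?thesis
      by (simp only: power_Suc minus_mult_minus mult_1_left minus_minus mult_minus_left)
  qed (use finC[OF C] in \<open>simp add: toggle_def\<close>)
  have "(\<Sum>C\<in>?S. (- 1 :: int) ^ card C) = (\<Sum>C\<in>?S. - ((- 1) ^ card C))"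
    by (rule sum.reindex_bij_witness[of _ toggle toggle]) (use toggle_toggle toggle_S sign in auto)
  then show ?thesis
    by (simp add: sum_negf)
qed

text \<open>Meaningful for finite ranks only: an infinite rank is sent to 0.\<close>

definition int_rank :: "(nat set \<Rightarrow> ereal) \<Rightarrow> nat set \<Rightarrow> int" where
  "int_rank rk A = \<lfloor>real_of_ereal (rk A)\<rfloor>"

lemma int_rank: "rk A \<in> ereal ` \<int> \<Longrightarrow> rk A = ereal (of_int (int_rank rk A))"
  by (auto simp: int_rank_def elim: Ints_cases)

lemma megamatroidD:
  assumes "megamatroid d rk"
  shows "int_rank rk {} = 0"
    and "\<And>A. A \<subseteq> {1..d} \<Longrightarrow> rk A \<notin> ereal ` \<int> \<Longrightarrow> rk A = \<infinity>"
    and "\<And>A B. A \<subseteq> {1..d} \<Longrightarrow> B \<subseteq> {1..d} \<Longrightarrow> rk A \<in> ereal ` \<int> \<Longrightarrow> rk B \<in> ereal ` \<int> \<Longrightarrow>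
      rk (A \<union> B) \<in> ereal ` \<int> \<and> rk (A \<inter> B) \<in> ereal ` \<int> \<and>
      int_rank rk (A \<union> B) + int_rank rk (A \<inter> B) \<le> int_rank rk A + int_rank rk B"
proof -
  note mm = assms[unfolded megamatroid_def]
  show "int_rank rk {} = 0"
    using mm by (simp add: int_rank_def)
  show "rk A = \<infinity>" if "A \<subseteq> {1..d}" "rk A \<notin> ereal ` \<int>" for A
    using mm that by blast
  fix A B assume AB: "A \<subseteq> {1..d}" "B \<subseteq> {1..d}" "rk A \<in> ereal ` \<int>" "rk B \<in> ereal ` \<int>"
  then have fin: "rk (A \<union> B) \<in> ereal ` \<int>" "rk (A \<inter> B) \<in> ereal ` \<int>"
    and le: "rk (A \<union> B) + rk (A \<inter> B) \<le> rk A + rk B"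
    using mm by blast+
  have "ereal (of_int (int_rank rk (A \<union> B) + int_rank rk (A \<inter> B)))
      \<le> ereal (of_int (int_rank rk A + int_rank rk B))"
    using le unfolding int_rank[of rk, OF fin(1)] int_rank[of rk, OF fin(2)] int_rank[of rk, OF AB(3)] int_rank[of rk, OF AB(4)] by simp
  then show "rk (A \<union> B) \<in> ereal ` \<int> \<and> rk (A \<inter> B) \<in> ereal ` \<int> \<and>
      int_rank rk (A \<union> B) + int_rank rk (A \<inter> B) \<le> int_rank rk A + int_rank rk B"
    using fin by (simp only: ereal_less_eq of_int_le_iff simp_thms)
qed

lemma violated_sets_chain_sum:
  assumes rk: "megamatroid d rk" and y: "ereal (sum y {1..d}) = rk {1..d}"
    and V: "V = {A. A \<subseteq> {1..d} \<and> rk A < ereal (sum y A)}"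
  shows "(\<Sum>C\<in>{C. C \<subseteq> V \<and> chain_subset C}. (- 1 :: int) ^ card C) = of_bool (V = {})"
proof (cases "V = {}")
  case True
  then have "{C. C \<subseteq> V \<and> chain_subset C} = {{}}"
    by (auto simp: chain_subset_def)
  then show ?thesis
    using True by simp
next
  case False
  have finV: "finite V"
    unfolding V by simp
  have fin: "rk A \<in> ereal ` \<int>" if "A \<in> V" for A
  proof (rule ccontr)
    assume "rk A \<notin> ereal ` \<int>"
    then have "rk A = \<infinity>"
      using megamatroidD(2)[OF rk, of A] that unfolding V by blast
    then show False
      using that unfolding V by simp
  qed
  define g where "g A = of_int (int_rank rk A) - sum y A" for A
  have V_iff: "A \<in> V \<longleftrightarrow> g A < 0" if "A \<subseteq> {1..d}" "rk A \<in> ereal ` \<int>" for A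
    using that int_rank[of rk, OF that(2)] unfolding V g_def by (simp add: less_ereal.simps(1))
  obtain M where M: "M \<in> V" "\<And>A. A \<in> V \<Longrightarrow> g M \<le> g A"
    using finV False ex_min_if_finite[of "g ` V"] by (auto simp: not_less)
  have "A \<union> M \<in> V" if A: "A \<in> V" for A
  proof -
    have sub: "A \<subseteq> {1..d}" "M \<subseteq> {1..d}" "A \<union> M \<subseteq> {1..d}" "A \<inter> M \<subseteq> {1..d}"
      using A M(1) unfolding V by auto
    note sm = megamatroidD(3)[OF rk sub(1,2) fin[OF A] fin[OF M(1)]]
    have "sum y (A \<union> M) + sum y (A \<inter> M) = sum y A + sum y M"
      using sub finite_subset[OF _ finite_atLeastAtMost] by (intro sum.union_inter) blast+
    moreover have "real_of_int (int_rank rk (A \<union> M) + int_rank rk (A \<inter> M))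
        \<le> of_int (int_rank rk A + int_rank rk M)"
      using sm by (simp only: of_int_le_iff)
    ultimately have "g (A \<union> M) + g (A \<inter> M) \<le> g A + g M"
      unfolding g_def by simp
    \<comment> \<open>\<open>M\<close> is minimal only within \<open>V\<close>, but outside
      \<open>V\<close> the value of \<open>g\<close> is nonnegative and so exceeds
      \<open>g M\<close>. Submodularity then bounds \<open>g\<close> at the union by
      \<open>g A\<close>, which is negative.\<close>
    moreover have "g M \<le> g (A \<inter> M)"
    proof (cases "A \<inter> M \<in> V")
      case False
      then have "0 \<le> g (A \<inter> M)" "g M < 0"
        using V_iff[OF sub(4)] V_iff[OF sub(2)] sm fin[OF M(1)] M(1) by auto
      then show ?thesis by simp
    qed (use M(2) in auto)
    moreover have "g A < 0"
      using V_iff[OF sub(1) fin[OF A]] A by simp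
    ultimately show ?thesis
      using V_iff[OF sub(3)] sm by simp
  qed
  then show ?thesis
    using alternating_chain_sum_zero[OF finV M(1)] False by simp
qed

lemma star_matroid_megamatroid: "is_star_matroid s d rk \<Longrightarrow> megamatroid d rk"
  by (cases s) (auto simp: polymatroid_def matroid_def)

text \<open>For a polymatroid, a coordinate is the total minus the sum over the other coordinates,
  and the latter is at most \<open>r\<close> by monotonicity of the rank. For a matroid the
  singleton constraints give the bound 1.\<close>

lemma base_polyhedron_subset_ambient:
  assumes "rk \<in> star_matroids s d r"
  shows "base_polyhedron d rk \<subseteq> ambient s d r"
proof
  fix y assume "y \<in> base_polyhedron d rk"
  then have y: "y \<in> Rspace d" "ereal (sum y {1..d}) = rk {1..d}"
      "\<And>A. A \<subseteq> {1..d} \<Longrightarrow> ereal (sum y A) \<le> rk A"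
    unfolding base_polyhedron_def by auto
  have r: "rk {1..d} = ereal (of_int r)" and s: "is_star_matroid s d rk"
    using assms unfolding star_matroids_def by auto
  have total: "sum y {1..d} = of_int r"
    using y(2) r by simp
  have nonneg: "0 \<le> y i" if "polymatroid d rk" "i \<in> {1..d}" for i
  proof -
    have "ereal (sum y ({1..d} - {i})) \<le> rk ({1..d} - {i})"
      by (intro y(3)) auto
    also have "\<dots> \<le> rk {1..d}"
      using that(1) unfolding polymatroid_def by blast
    finally have "sum y ({1..d} - {i}) \<le> of_int r"
      using r by simp
    then show ?thesis
      using total that(2) by (simp add: sum_diff1)
  qed
  have le1: "y i \<le> 1" if "matroid d rk" "i \<in> {1..d}" for i
  proof -
    have "ereal (sum y {i}) \<le> rk {i}"
      using that(2) by (intro y(3)) auto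
    also have "\<dots> \<le> 1"
      using that unfolding matroid_def by blast
    finally show ?thesis
      by (simp add: one_ereal_def)
  qed
  show "y \<in> ambient s d r"
    using s y(1) total nonneg le1
    by (cases s) (auto simp: Delta_PM_def Delta_M_def matroid_def)
qed

lemma polymatroidD:
  assumes "polymatroid d rk"
  shows "\<And>A. A \<subseteq> {1..d} \<Longrightarrow> rk A \<in> ereal ` \<int>"
    and "\<And>A. A \<subseteq> {1..d} \<Longrightarrow> 0 \<le> int_rank rk A"
    and "\<And>A B. A \<subseteq> B \<Longrightarrow> B \<subseteq> {1..d} \<Longrightarrow> int_rank rk A \<le> int_rank rk B"
proof -
  have nat: "rk A \<in> ereal ` \<nat>" if "A \<subseteq> {1..d}" for A
    using assms that unfolding polymatroid_def by blast
  then show int: "rk A \<in> ereal ` \<int>" if "A \<subseteq> {1..d}" for A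
    using that Nats_subset_Ints by blast
  show "0 \<le> int_rank rk A" if "A \<subseteq> {1..d}" for A
    using nat[OF that] by (auto simp: int_rank_def elim: Nats_cases)
  show "int_rank rk A \<le> int_rank rk B" if AB: "A \<subseteq> B" "B \<subseteq> {1..d}" for A B
  proof -
    have A: "A \<subseteq> {1..d}" using AB by blast
    have "rk A \<le> rk B"
      using assms AB unfolding polymatroid_def by blast
    then show ?thesis
      unfolding int_rank[of rk, OF int[OF A]] int_rank[of rk, OF int[OF AB(2)]] by simp
  qed
qed

text \<open>Elements are added one at a time; by submodularity each raises the rank by at most the
  rank of its singleton.\<close>

lemma matroid_rank_increment:
  assumes "matroid d rk" "A \<subseteq> B" "B \<subseteq> {1..d}"
  shows "int_rank rk B \<le> int_rank rk A + int (card (B - A))"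
proof -
  have poly: "polymatroid d rk" and mega: "megamatroid d rk"
    using assms(1) unfolding matroid_def polymatroid_def by auto
  have "int_rank rk (A \<union> S) \<le> int_rank rk A + int (card S)" if "finite S" "S \<subseteq> {1..d}" for S
    using that
  proof (induction S)
    case (insert i S)
    have sub: "A \<union> S \<subseteq> {1..d}" "{i} \<subseteq> {1..d}" "(A \<union> S) \<inter> {i} \<subseteq> {1..d}"
      using insert.prems assms(2,3) by auto
    have "rk {i} \<le> 1"
      using assms(1) insert.prems unfolding matroid_def by blast
    then have "int_rank rk {i} \<le> 1"
      unfolding int_rank[of rk, OF polymatroidD(1)[OF poly sub(2)]] one_ereal_def by simp
    moreover have "int_rank rk ((A \<union> S) \<union> {i}) + int_rank rk ((A \<union> S) \<inter> {i})
        \<le> int_rank rk (A \<union> S) + int_rank rk {i}"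
      using megamatroidD(3)[OF mega sub(1,2)] polymatroidD(1)[OF poly] sub by blast
    moreover have "0 \<le> int_rank rk ((A \<union> S) \<inter> {i})"
      using polymatroidD(2)[OF poly sub(3)] .
    ultimately show ?case
      using insert by simp
  qed simp
  from this[of "B - A"] have "int_rank rk (A \<union> (B - A)) \<le> int_rank rk A + int (card (B - A))"
    using assms(3) by (meson Diff_subset finite_atLeastAtMost finite_subset subset_trans)
  then show ?thesis
    using assms(2) by (simp add: Un_absorb1)
qed

section \<open>From chains of rank constraints to index pairs\<close>

lemma finite_chain_list_exists:
  assumes "finite C" "chain_subset C"
  obtains Xs where "set Xs = C" "sorted_wrt (\<subset>) Xs"
proof -
  have "\<exists>Xs. set Xs = C \<and> sorted_wrt (\<subset>) Xs"
    using assms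
  proof (induction "card C" arbitrary: C)
    case 0
    then show ?case by (intro exI[of _ "[]"]) simp
  next
    case (Suc n)
    then have "C \<noteq> {}" by auto
    then obtain A where A: "A \<in> C" "\<And>B. B \<in> C \<Longrightarrow> A \<subseteq> B \<Longrightarrow> A = B"
      using finite_has_maximal[OF Suc.prems(1)] by blast
    have max: "B \<subset> A" if "B \<in> C - {A}" for B
      using A that Suc.prems(2) unfolding chain_subset_def by blast
    have "n = card (C - {A})"
      using Suc.hyps(2) A(1) by simp
    moreover have "chain_subset (C - {A})"
      using Suc.prems(2) unfolding chain_subset_def by blast
    ultimately obtain Xs where "set Xs = C - {A}" "sorted_wrt (\<subset>) Xs"
      using Suc.hyps(1)[of "C - {A}"] Suc.prems(1) by blast
    then show ?case
      using max A(1) by (intro exI[of _ "Xs @ [A]"]) (auto simp: sorted_wrt_append)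
  qed
  then show ?thesis
    using that by blast
qed

lemma p_MM_of_chain:
  assumes C: "C \<subseteq> Pow {1..d} - {{}}" "chain_subset C" "{1..d} \<in> C" and d: "1 \<le> d"
    and t: "t {1..d} = r"
  obtains Xs where "set Xs = C" "(Xs, map t Xs) \<in> p_MM d r"
proof -
  have "finite C"
    using C(1) finite_subset by blast
  then obtain Xs where Xs: "set Xs = C" "sorted_wrt (\<subset>) Xs"
    using finite_chain_list_exists C(2) by blast
  have ne: "Xs \<noteq> []"
    using Xs(1) C(3) by auto
  obtain Ys A where YA: "Xs = Ys @ [A]"
    using ne by (metis append_butlast_last_id)
  have "A = {1..d}"
  proof (rule ccontr)
    assume "A \<noteq> {1..d}"
    then have "{1..d} \<in> set Ys"
      using Xs(1) C(3) YA by auto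
    then have "{1..d} \<subset> A"
      using Xs(2) unfolding YA by (auto simp: sorted_wrt_append)
    moreover have "A \<subseteq> {1..d}"
      using C(1) Xs(1) YA by auto
    ultimately show False by blast
  qed
  then have "last Xs = {1..d}"
    using YA by simp
  then have "(Xs, map t Xs) \<in> p_MM d r"
    using Xs C(1) ne t unfolding p_MM_def by (auto simp: last_map)
  then show ?thesis
    using that Xs(1) by blast
qed

text \<open>A subfamily of least cardinality with the same solutions contains no constraint implied
  by the others. The case of a single other constraint, and that of none, are the forms in which
  this later yields strict inequalities of ranks and coranks.\<close>

lemma chain_constraints_reduced:
  fixes t :: "nat set \<Rightarrow> int" and R :: "(nat \<Rightarrow> real) set"
  assumes "finite C"
  obtains D where "D \<subseteq> C" "{y \<in> R. \<forall>A\<in>D. sum y A \<le> of_int (t A)} = {y \<in> R. \<forall>A\<in>C. sum y A \<le> of_int (t A)}"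
    "\<forall>A\<in>D. \<forall>B\<in>D. A \<noteq> B \<longrightarrow> (\<exists>y\<in>R. sum y A \<le> of_int (t A) \<and> \<not> sum y B \<le> of_int (t B))"
    "\<forall>B\<in>D. \<exists>y\<in>R. \<not> sum y B \<le> of_int (t B)"
proof -
  define P where "P D \<longleftrightarrow> D \<subseteq> C \<and>
    {y \<in> R. \<forall>A\<in>D. sum y A \<le> of_int (t A)} = {y \<in> R. \<forall>A\<in>C. sum y A \<le> of_int (t A)}" for D
  have "P C" by (simp add: P_def)
  then obtain D where D: "P D" "\<And>E. P E \<Longrightarrow> card D \<le> card E"
    using ex_has_least_nat[of P C card] by blast
  have "finite D"
    using D(1) assms finite_subset unfolding P_def by blast
  have not_redundant: "\<not> P (D - {B})" if "B \<in> D" for B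
    using D(2)[of "D - {B}"] card_Diff1_less[OF \<open>finite D\<close> that] by auto
  show ?thesis
  proof (rule that)
    show "D \<subseteq> C" "{y \<in> R. \<forall>A\<in>D. sum y A \<le> of_int (t A)} = {y \<in> R. \<forall>A\<in>C. sum y A \<le> of_int (t A)}"
      using D(1) unfolding P_def by blast+
    have implied: "P (D - {B})"
      if "B \<in> D" "\<And>y. y \<in> R \<Longrightarrow> (\<forall>A\<in>D - {B}. sum y A \<le> of_int (t A)) \<Longrightarrow> sum y B \<le> of_int (t B)" for B
    proof -
      have "{y \<in> R. \<forall>A\<in>D - {B}. sum y A \<le> of_int (t A)} = {y \<in> R. \<forall>A\<in>D. sum y A \<le> of_int (t A)}"
        using that by blast
      then show ?thesis
        using D(1) unfolding P_def by auto
    qed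
    have "\<exists>y\<in>R. sum y A \<le> of_int (t A) \<and> \<not> sum y B \<le> of_int (t B)"
      if "A \<in> D" "B \<in> D" "A \<noteq> B" for A B
      using implied[OF that(2)] not_redundant[OF that(2)] that by blast
    then show "\<forall>A\<in>D. \<forall>B\<in>D. A \<noteq> B \<longrightarrow> (\<exists>y\<in>R. sum y A \<le> of_int (t A) \<and> \<not> sum y B \<le> of_int (t B))"
      by blast
    have "\<exists>y\<in>R. \<not> sum y B \<le> of_int (t B)" if "B \<in> D" for B
      using implied[OF that] not_redundant[OF that] by blast
    then show "\<forall>B\<in>D. \<exists>y\<in>R. \<not> sum y B \<le> of_int (t B)"
      by blast
  qed
qed

text \<open>A rank function only gives weak inequalities along the chain. If two ranks agree, the
  smaller set is redundant because coordinates are nonnegative; if two coranks agree, the larger set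
  is redundant because coordinates are at most 1. Passing to an irredundant subfamily therefore
  makes the inequalities strict.\<close>

lemma chain_polytope_in_p_star:
  assumes rk: "rk \<in> star_matroids s d r"
    and C: "C \<subseteq> {A. A \<subseteq> {1..d} \<and> A \<noteq> {} \<and> A \<noteq> {1..d}}" "chain_subset C" "\<And>A. A \<in> C \<Longrightarrow> rk A \<in> ereal ` \<int>"
  obtains Xs rs where "(Xs, rs) \<in> p_star s d r"
    "R_star s d r Xs rs = {y \<in> ambient s d r. \<forall>A\<in>C. sum y A \<le> of_int (int_rank rk A)}"
proof (cases "d = 0")
  case True
  have "C = {}"
    using C(1) True by auto
  moreover have "r = 0"
    using rk star_matroid_megamatroid[of s d rk] unfolding star_matroids_def True
    by (auto simp: megamatroid_def zero_ereal_def)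
  ultimately show ?thesis
    using that[of "[]" "[]"] True by (cases s) (auto simp: p_star_0 R_MM_def Delta_PM_def Delta_M_def)
next
  case False
  then have d: "1 \<le> d" by simp
  define t where "t = int_rank rk"
  have sm: "is_star_matroid s d rk" and r: "rk {1..d} = ereal (of_int r)"
    using rk unfolding star_matroids_def by auto
  have td: "t {1..d} = r"
    using r by (simp add: t_def int_rank_def)
  have t0: "t {} = 0"
    using megamatroidD(1)[OF star_matroid_megamatroid[OF sm]] by (simp add: t_def)
  have "finite C"
    using C(1) finite_subset[of C "Pow {1..d}"] by auto
  obtain D where D: "D \<subseteq> C"
      "{y \<in> ambient s d r. \<forall>A\<in>D. sum y A \<le> of_int (t A)} = {y \<in> ambient s d r. \<forall>A\<in>C. sum y A \<le> of_int (t A)}"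
    and pair: "\<forall>A\<in>D. \<forall>B\<in>D. A \<noteq> B \<longrightarrow>
      (\<exists>y\<in>ambient s d r. sum y A \<le> of_int (t A) \<and> \<not> sum y B \<le> of_int (t B))"
    and single: "\<forall>B\<in>D. \<exists>y\<in>ambient s d r. \<not> sum y B \<le> of_int (t B)"
    by (rule chain_constraints_reduced[OF \<open>finite C\<close>, of "ambient s d r" t])
  define E where "E = insert {1..d} D"
  have E: "E \<subseteq> Pow {1..d} - {{}}" "chain_subset E" "{1..d} \<in> E"
  proof -
    show "E \<subseteq> Pow {1..d} - {{}}" "{1..d} \<in> E"
      using C(1) D(1) d unfolding E_def by auto
    have "A \<subseteq> {1..d}" if "A \<in> D" for A
      using that C(1) D(1) by blast
    then show "chain_subset E"
      using C(2) D(1) unfolding E_def chain_subset_def by blast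
  qed
  obtain Xs where Xs: "set Xs = E" "(Xs, map t Xs) \<in> p_MM d r"
    using p_MM_of_chain[where t = t, OF E d td] by blast
  have amb_total: "sum y {1..d} = of_int r" if "y \<in> ambient s d r" for y
    using that ambient_subset by blast
  have notD: "{1..d} \<notin> D"
    using C(1) D(1) by auto
  \<comment> \<open>The bounds for the empty set and for \<open>{1..d}\<close> hold on the whole
    ambient set, so against them it suffices that the bound for \<open>B\<close> is violated
    somewhere.\<close>
  have pair': "\<exists>y\<in>ambient s d r. sum y A \<le> of_int (t A) \<and> \<not> sum y B \<le> of_int (t B)"
    if "A \<in> insert {} E" "B \<in> D" "A \<noteq> B" for A B
  proof (cases "A \<in> D")
    case False
    then have "A = {} \<or> A = {1..d}"
      using that(1) unfolding E_def by blast
    then have "sum y A \<le> of_int (t A)" if "y \<in> ambient s d r" for y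
      using t0 td amb_total[OF that] by auto
    then show ?thesis
      using single that(2) by blast
  qed (use pair that in blast)
  have "R_star s d r Xs (map t Xs) = {y \<in> ambient s d r. \<forall>A\<in>E. sum y A \<le> of_int (t A)}"
  proof -
    have "zip Xs (map t Xs) = map (\<lambda>A. (A, t A)) Xs"
      by (simp add: zip_map2 zip_same_conv_map)
    then have "(\<forall>(A, u)\<in>set (zip Xs (map t Xs)). sum y A \<le> of_int u) \<longleftrightarrow> (\<forall>A\<in>E. sum y A \<le> of_int (t A))"
      for y :: "nat \<Rightarrow> real"
      using Xs(1) by simp
    then show ?thesis
      using mem_R_star_iff[OF Xs(2), of _ s] by blast
  qed
  also have "\<dots> = {y \<in> ambient s d r. \<forall>A\<in>D. sum y A \<le> of_int (t A)}"
    using amb_total td unfolding E_def by auto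
  also note D(2)
  finally have R: "R_star s d r Xs (map t Xs) = {y \<in> ambient s d r. \<forall>A\<in>C. sum y A \<le> of_int (int_rank rk A)}"
    unfolding t_def .
  have PM: "(Xs, map t Xs) \<in> p_PM d r" if poly: "polymatroid d rk"
    and nonneg: "\<And>y i. y \<in> ambient s d r \<Longrightarrow> i \<in> {1..d} \<Longrightarrow> 0 \<le> y i"
  proof -
    have strict: "t A < t B" if AB: "A \<in> E" "B \<in> E" "A \<subset> B" for A B
    proof -
      have B: "B \<subseteq> {1..d}" using E(1) AB(2) by blast
      have "t A \<le> t B"
        unfolding t_def by (rule polymatroidD(3)[OF poly _ B]) (use AB in blast)
      moreover have "t A \<noteq> t B"
      proof
        \<comment> \<open>With nonnegative coordinates the bound for \<open>B\<close> would then
          imply the one for \<open>A\<close>.\<close>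
        assume eq: "t A = t B"
        have "A \<in> D"
          using AB E(1) unfolding E_def by auto
        then obtain y where y: "y \<in> ambient s d r" "sum y B \<le> of_int (t B)" "\<not> sum y A \<le> of_int (t A)"
          using pair'[of B A] AB by blast
        have "sum y A \<le> sum y B"
          using AB B nonneg[OF y(1)] finite_subset[OF B] by (intro sum_mono2) auto
        then show False
          using y eq by simp
      qed
      ultimately show ?thesis by simp
    qed
    have "sorted_wrt (\<subset>) Xs"
      using Xs(2) unfolding p_MM_def by simp
    then have "sorted_wrt (<) (map t Xs)"
      unfolding sorted_wrt_map by (rule sorted_wrt_mono_rel[rotated]) (use strict Xs(1) in auto)
    moreover have "0 \<le> t A" if "A \<in> E" for A
      unfolding t_def by (rule polymatroidD(2)[OF poly]) (use E(1) that in blast)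
    ultimately show ?thesis
      using Xs unfolding p_PM_def by auto
  qed
  have "(Xs, map t Xs) \<in> p_star s d r"
  proof (cases s)
    case MegaMatroid
    then show ?thesis using Xs(2) by simp
  next
    case PolyMatroid
    then show ?thesis
      using PM sm by (simp add: Delta_PM_def)
  next
    case Matroid
    then have mat: "matroid d rk"
      using sm by simp
    then have poly: "polymatroid d rk"
      unfolding matroid_def by blast
    have box: "0 \<le> y i" "y i \<le> 1" if "y \<in> ambient s d r" "i \<in> {1..d}" for y i
      using that Matroid by (auto simp: Delta_M_def)
    define X where "X = (\<lambda>j. ({} # Xs) ! j)"
    note nth = p_MM_nth[OF Xs(2), folded X_def]
    have X: "X j \<in> insert {} E" if "j \<le> length Xs" for j
      using that Xs(1) unfolding X_def by (cases j) auto
    have XE: "X j \<in> E" if "0 < j" "j \<le> length Xs" for j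
      using that Xs(1) unfolding X_def by (cases j) auto
    have corank: "corank Xs (map t Xs) j = int (card (X j)) - t (X j)" if "j \<le> length Xs" for j
      using that t0 unfolding corank_def X_def by (cases j) auto
    have le: "corank Xs (map t Xs) i \<le> corank Xs (map t Xs) j"
      and less: "j < length Xs \<Longrightarrow> i < j \<Longrightarrow> corank Xs (map t Xs) i < corank Xs (map t Xs) j"
      if ij: "i \<le> j" "j \<le> length Xs" for i j
    proof -
      have sub: "X i \<subseteq> X j" "X j \<subseteq> {1..d}" "finite (X j)"
        using nth(5)[OF ij] nth(6)[OF ij(2)] finite_subset by auto
      have card: "int (card (X j - X i)) = int (card (X j)) - int (card (X i))"
        using sub finite_subset[OF sub(1)] by (subst card_Diff_subset) (auto intro!: of_nat_diff card_mono)
      have "t (X j) \<le> t (X i) + int (card (X j - X i))"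
        using matroid_rank_increment[OF mat sub(1,2)] unfolding t_def .
      then show le: "corank Xs (map t Xs) i \<le> corank Xs (map t Xs) j"
        using card corank ij by simp
      assume j: "j < length Xs" "i < j"
      show "corank Xs (map t Xs) i < corank Xs (map t Xs) j"
      proof (rule ccontr)
        \<comment> \<open>The bound for \<open>X i\<close>, together with coordinates at most 1 on
          the difference, would then imply the bound for \<open>X j\<close>.\<close>
        assume "\<not> ?thesis"
        then have eq: "t (X j) = t (X i) + int (card (X j - X i))"
          using le card corank ij by simp
        \<comment> \<open>The full set belongs to every index chain and is not subject to the
          reduction; this is why the last corank step may be an equality.\<close>
        have "X j \<noteq> {1..d}"
          using nth(4)[OF j(1) order.refl] unfolding nth(2) by blast
        then have "X j \<in> D"
          using XE[of j] j ij unfolding E_def by auto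
        moreover have "X i \<noteq> X j"
          using nth(4)[OF j(2) ij(2)] by blast
        ultimately obtain y where y: "y \<in> ambient s d r" "sum y (X i) \<le> of_int (t (X i))" "\<not> sum y (X j) \<le> of_int (t (X j))"
          using pair'[OF X[of i], of "X j"] ij by auto
        have "sum y (X j) = sum y (X i) + sum y (X j - X i)"
          using sub by (subst sum.subset_diff[of "X i"]) (auto simp: add.commute)
        also have "sum y (X j - X i) \<le> (\<Sum>e\<in>X j - X i. 1)"
          by (intro sum_mono box(2)[OF y(1)]) (use sub in blast)
        finally have "sum y (X j) \<le> of_int (t (X j))"
          using y(2) eq by simp
        then show False
          using y(3) by simp
      qed
    qed
    have "(Xs, map t Xs) \<in> p_PM d r"
      by (rule PM[OF poly]) (use box in blast)
    then have "(Xs, map t Xs) \<in> p_M d r"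
      unfolding p_M_def using le less by auto
    then show ?thesis
      using Matroid by simp
  qed
  then show ?thesis
    using that R by blast
qed

text \<open>\<open>W\<close> stands for any family closed under sums and differences, so that the
  expansion can be applied directly to the preimage of a subgroup of the quotient.\<close>

lemma base_polyhedron_in_span:
  assumes rk: "rk \<in> star_matroids s d r"
    and gen: "\<And>Xs rs. (Xs, rs) \<in> p_star s d r \<Longrightarrow> ind d (R_star s d r Xs rs) \<in> W"
    and zero: "(\<lambda>y\<in>Rspace d. 0) \<in> W"
    and add: "\<And>f g. f \<in> W \<Longrightarrow> g \<in> W \<Longrightarrow> (\<lambda>y\<in>Rspace d. f y + g y) \<in> W"
    and diff: "\<And>f g. f \<in> W \<Longrightarrow> g \<in> W \<Longrightarrow> (\<lambda>y\<in>Rspace d. f y - g y) \<in> W"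
  shows "ind d (base_polyhedron d rk) \<in> W"
proof -
  \<comment> \<open>The sets left out are never violated on the ambient set: those of infinite rank,
    the empty set, and \<open>{1..d}\<close>, whose constraint is an equality there.\<close>
  define F where "F = {A. A \<subseteq> {1..d} \<and> A \<noteq> {} \<and> A \<noteq> {1..d} \<and> rk A \<in> ereal ` \<int>}"
  define t where "t = int_rank rk"
  define f where "f C D y = (of_bool (y \<in> ambient s d r \<and> (\<forall>A\<in>C. of_int (t A) < sum y A) \<and>
      (\<forall>A\<in>D. sum y A \<le> of_int (t A))) :: int)" for C D and y :: "nat \<Rightarrow> real"
  have mixed: "(\<lambda>y\<in>Rspace d. f C D y) \<in> W" if "finite C" "C \<union> D \<subseteq> F" "chain_subset (C \<union> D)" for C D
    using that
  proof (induction C arbitrary: D)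
    case empty
    then have "D \<subseteq> {A. A \<subseteq> {1..d} \<and> A \<noteq> {} \<and> A \<noteq> {1..d}}" "chain_subset D"
      "\<And>A. A \<in> D \<Longrightarrow> rk A \<in> ereal ` \<int>"
      unfolding F_def by auto
    then obtain Xs rs where "(Xs, rs) \<in> p_star s d r"
      "R_star s d r Xs rs = {y \<in> ambient s d r. \<forall>A\<in>D. sum y A \<le> of_int (t A)}"
      using chain_polytope_in_p_star[OF rk, of D] unfolding t_def by blast
    moreover have "(\<lambda>y\<in>Rspace d. f {} D y) = ind d {y \<in> ambient s d r. \<forall>A\<in>D. sum y A \<le> of_int (t A)}"
      unfolding f_def ind_def indicator_def by auto
    ultimately show ?case
      using gen by metis
  next
    case (insert B C)
    have chain: "chain_subset (C \<union> D)" "chain_subset (C \<union> insert B D)"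
      using insert.prems(2) unfolding chain_subset_def by blast+
    have "(\<lambda>y\<in>Rspace d. f C D y) \<in> W" "(\<lambda>y\<in>Rspace d. f C (insert B D) y) \<in> W"
      using insert.prems(1) chain by (auto intro!: insert.IH)
    note diff[OF this]
    \<comment> \<open>Passing from the condition that \<open>B\<close> is violated to its complement
      trades one violated set for a difference of two functions with fewer violated sets.\<close>
    also have "f C D y - f C (insert B D) y = f (insert B C) D y" for y
      unfolding f_def by (cases "sum y B \<le> of_int (t B)") (simp_all add: not_le)
    then have "(\<lambda>y\<in>Rspace d. (\<lambda>y\<in>Rspace d. f C D y) y - (\<lambda>y\<in>Rspace d. f C (insert B D) y) y)
        = (\<lambda>y\<in>Rspace d. f (insert B C) D y)"
      by (intro restrict_ext) simp
    finally show ?case .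
  qed
  have sums: "(\<lambda>y\<in>Rspace d. \<Sum>C\<in>S. (- 1) ^ card C * f C {} y) \<in> W"
    if "finite S" "\<And>C. C \<in> S \<Longrightarrow> C \<subseteq> F \<and> chain_subset C" for S
    using that
  proof (induction S)
    case empty
    then show ?case using zero by (simp only: sum.empty)
  next
    case (insert C S)
    have "finite F" unfolding F_def by simp
    then have C: "(\<lambda>y\<in>Rspace d. f C {} y) \<in> W"
      using insert.prems[of C] finite_subset by (intro mixed) auto
    have S: "(\<lambda>y\<in>Rspace d. \<Sum>C\<in>S. (- 1) ^ card C * f C {} y) \<in> W"
      by (rule insert.IH) (use insert.prems in auto)
    show ?case
    \<comment> \<open>The closure of \<open>W\<close> covers sums and differences, so the parity
      decides which of the two is used.\<close>
    proof (cases "even (card C)")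
      case True
      note add[OF S C]
      also have "(\<lambda>y\<in>Rspace d. (\<lambda>y\<in>Rspace d. \<Sum>C\<in>S. (- 1) ^ card C * f C {} y) y + (\<lambda>y\<in>Rspace d. f C {} y) y)
          = (\<lambda>y\<in>Rspace d. \<Sum>C\<in>insert C S. (- 1) ^ card C * f C {} y)"
        using insert.hyps True by (intro restrict_ext) simp
      finally show ?thesis .
    next
      case False
      note diff[OF S C]
      also have "(\<lambda>y\<in>Rspace d. (\<lambda>y\<in>Rspace d. \<Sum>C\<in>S. (- 1) ^ card C * f C {} y) y - (\<lambda>y\<in>Rspace d. f C {} y) y)
          = (\<lambda>y\<in>Rspace d. \<Sum>C\<in>insert C S. (- 1) ^ card C * f C {} y)"
        using insert.hyps False by (intro restrict_ext) simp
      finally show ?thesis .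
    qed
  qed
  have mm: "megamatroid d rk" and r: "rk {1..d} = ereal (of_int r)"
    using rk star_matroid_megamatroid unfolding star_matroids_def by auto
  let ?S = "{C. C \<subseteq> F \<and> chain_subset C}"
  have "finite ?S"
    unfolding F_def by simp
  have "(\<Sum>C\<in>?S. (- 1) ^ card C * f C {} y) = of_bool (y \<in> base_polyhedron d rk)" if y: "y \<in> Rspace d" for y
  proof (cases "y \<in> ambient s d r")
    case False
    then show ?thesis
      using base_polyhedron_subset_ambient[OF rk] by (auto simp: f_def)
  next
    case True
    define V where "V = {A. A \<subseteq> {1..d} \<and> rk A < ereal (sum y A)}"
    have total: "ereal (sum y {1..d}) = rk {1..d}"
      using True ambient_subset[of s d r] r by auto
    have F_V: "A \<in> V \<longleftrightarrow> of_int (t A) < sum y A" if "A \<in> F" for A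
      using that int_rank[of rk A] unfolding F_def V_def t_def by auto
    have "V \<subseteq> F"
    proof
      fix A assume A: "A \<in> V"
      have "rk A \<in> ereal ` \<int>"
        using A megamatroidD(2)[OF mm, of A] unfolding V_def by force
      moreover have "A \<noteq> {1..d}"
        using A total unfolding V_def by auto
      moreover have "A \<noteq> {}"
        using A mm unfolding V_def megamatroid_def by (auto simp: zero_ereal_def)
      ultimately show "A \<in> F"
        using A unfolding V_def F_def by blast
    qed
    \<comment> \<open>A summand survives exactly if all members of the chain are violated at
      \<open>y\<close>, which leaves the chains in \<open>V\<close>.\<close>
    have "(\<Sum>C\<in>?S. (- 1) ^ card C * f C {} y) = (\<Sum>C\<in>{C. C \<subseteq> V \<and> chain_subset C}. (- 1) ^ card C)"
    proof (rule sum.mono_neutral_cong_right[OF \<open>finite ?S\<close>])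
      show "{C. C \<subseteq> V \<and> chain_subset C} \<subseteq> ?S"
        using \<open>V \<subseteq> F\<close> by blast
      show "\<forall>C\<in>?S - {C. C \<subseteq> V \<and> chain_subset C}. (- 1) ^ card C * f C {} y = 0"
        using F_V by (auto simp: f_def)
      show "(- 1) ^ card C * f C {} y = (- 1) ^ card C" if "C \<in> {C. C \<subseteq> V \<and> chain_subset C}" for C
        using F_V \<open>V \<subseteq> F\<close> that True by (auto simp: f_def)
    qed
    also have "\<dots> = of_bool (V = {})"
      using violated_sets_chain_sum[OF mm total V_def] .
    also have "V = {} \<longleftrightarrow> y \<in> base_polyhedron d rk"
      using total y unfolding V_def base_polyhedron_def by (auto simp: not_less)
    finally show ?thesis .
  qed
  then have "(\<lambda>y\<in>Rspace d. \<Sum>C\<in>?S. (- 1) ^ card C * f C {} y) = ind d (base_polyhedron d rk)"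
    unfolding ind_def by (intro restrict_ext) (simp add: indicator_def of_bool_def)
  then show ?thesis
    using sums[OF \<open>finite ?S\<close>] by auto
qed

section \<open>Chain polyhedra as base polyhedra\<close>

text \<open>\<open>f A\<close> is the best bound on the sum over \<open>A\<close> that uses one
  chain constraint, nonnegativity, and the bound \<open>m\<close> for each coordinate outside that
  chain member. So the bounds by \<open>f\<close> follow from the listed ones and in turn contain
  them. The hypothesis \<open>top\<close> says that no such bound for \<open>{1..d}\<close> drops
  below \<open>r\<close>.\<close>

lemma min_rank_properties:
  fixes X :: "nat \<Rightarrow> nat set" and \<rho> :: "nat \<Rightarrow> int" and m :: int
  assumes X: "X 0 = {}" "X k = {1..d}" "\<And>i j. i \<le> j \<Longrightarrow> j \<le> k \<Longrightarrow> X i \<subseteq> X j"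
    and \<rho>: "\<rho> 0 = 0" "\<rho> k = r" "\<And>j. j \<le> k \<Longrightarrow> 0 \<le> \<rho> j" and m: "0 \<le> m"
    and top: "\<And>j. j \<le> k \<Longrightarrow> r \<le> \<rho> j + m * int (card ({1..d} - X j))"
    and f: "\<And>A. f A = Min ((\<lambda>j. \<rho> j + m * int (card (A - X j))) ` {..k})"
  shows "polymatroid d (\<lambda>A. ereal (of_int (f A)))"
    and "f {1..d} = r"
    and "\<And>i. f {i} \<le> m"
    and "base_polyhedron d (\<lambda>A. ereal (of_int (f A))) = {y \<in> Rspace d. sum y {1..d} = of_int r \<and>
       (\<forall>i\<in>{1..d}. 0 \<le> y i \<and> y i \<le> of_int m) \<and> (\<forall>j\<le>k. sum y (X j) \<le> of_int (\<rho> j))}"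
proof -
  define w where "w A j = \<rho> j + m * int (card (A - X j))" for A j
  have le: "f A \<le> w A j" if "j \<le> k" for A j
    unfolding f w_def using that by (intro Min_le) auto
  have ex: "\<exists>j\<le>k. f A = w A j" for A
  proof -
    have "f A \<in> w A ` {..k}"
      unfolding f w_def by (rule Min_in) auto
    then show ?thesis
      by auto
  qed
  have nonneg: "0 \<le> f A" for A
    using ex[of A] \<rho>(3) m unfolding w_def by fastforce
  have empty: "f {} = 0"
    using le[of 0 "{}"] nonneg[of "{}"] \<rho>(1) by (simp add: w_def)
  have mono: "f A \<le> f B" if "A \<subseteq> B" "finite B" for A B
  proof -
    obtain j where j: "j \<le> k" "f B = w B j"
      using ex by blast
    have "card (A - X j) \<le> card (B - X j)"
      using that by (intro card_mono) auto
    then have "w A j \<le> w B j"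
      using m by (simp add: w_def mult_left_mono)
    then show ?thesis
      using le[OF j(1), of A] j(2) by simp
  qed
  \<comment> \<open>The smaller index serves the intersection and the larger one the union; this
    works because an element of \<open>A - B\<close> outside \<open>X j\<close> is also outside
    \<open>X i\<close>.\<close>
  have submodular_aux: "w (A \<inter> B) i + w (A \<union> B) j \<le> w A i + w B j"
    if "i \<le> j" "j \<le> k" "finite A" "finite B" for A B i j
  proof -
    have "card ((A \<inter> B) - X i) + card ((A \<union> B) - X j) =
        card ((A \<inter> B) - X i) + card ((A - X j) \<union> (B - X j))"
      by (simp add: Un_Diff)
    also have "(A - X j) \<union> (B - X j) = (A - B - X j) \<union> (B - X j)"
      by blast
    also have "card ((A \<inter> B) - X i) + card ((A - B - X j) \<union> (B - X j))
        \<le> card ((A \<inter> B) - X i) + card (A - B - X j) + card (B - X j)"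
      using card_Un_le[of "A - B - X j" "B - X j"] by simp
    also have "card (A - B - X j) \<le> card (A - B - X i)"
      using X(3)[OF that(1,2)] that(3) by (intro card_mono) auto
    also have "card ((A \<inter> B) - X i) + card (A - B - X i) = card ((A \<inter> B - X i) \<union> (A - B - X i))"
      using that(3) by (subst card_Un_disjoint) auto
    also have "(A \<inter> B - X i) \<union> (A - B - X i) = A - X i"
      by blast
    finally have "int (card ((A \<inter> B) - X i)) + int (card ((A \<union> B) - X j)) \<le> int (card (A - X i)) + int (card (B - X j))"
      by linarith
    then have "m * (int (card ((A \<inter> B) - X i)) + int (card ((A \<union> B) - X j)))
        \<le> m * (int (card (A - X i)) + int (card (B - X j)))"
      using m by (rule mult_left_mono)
    then show ?thesis
      by (simp add: w_def algebra_simps)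
  qed
  have submodular: "f (A \<union> B) + f (A \<inter> B) \<le> f A + f B" if "finite A" "finite B" for A B
  proof -
    obtain i j where ij: "i \<le> k" "f A = w A i" "j \<le> k" "f B = w B j"
      using ex by metis
    show ?thesis
    proof (cases "i \<le> j")
      case True
      then show ?thesis
        using submodular_aux[OF True ij(3) that] le[OF ij(1), of "A \<inter> B"] le[OF ij(3), of "A \<union> B"] ij by linarith
    next
      case False
      then show ?thesis
        using submodular_aux[of j i B A] le[OF ij(3), of "B \<inter> A"] le[OF ij(1), of "B \<union> A"] ij that
        by (simp add: Un_commute Int_commute)
    qed
  qed
  show rank: "f {1..d} = r"
  proof (rule antisym)
    show "f {1..d} \<le> r"
      using le[OF order.refl, of "{1..d}"] X(2) \<rho>(2) by (simp add: w_def)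
    show "r \<le> f {1..d}"
      using ex[of "{1..d}"] top unfolding w_def by auto
  qed
  show single: "f {i} \<le> m" for i
    using le[of 0 "{i}"] X(1) \<rho>(1) by (simp add: w_def)
  show "polymatroid d (\<lambda>A. ereal (of_int (f A)))"
    unfolding polymatroid_def megamatroid_def
  proof (intro conjI allI impI)
    fix A B :: "nat set" assume AB: "B \<subseteq> {1..d}" "A \<subseteq> B"
    then show "ereal (of_int (f A)) \<le> ereal (of_int (f B))"
      using mono[of A B] finite_subset[OF AB(1)] by simp
  next
    fix A B :: "nat set" assume "A \<subseteq> {1..d}" "B \<subseteq> {1..d}"
    then have "f (A \<union> B) + f (A \<inter> B) \<le> f A + f B"
      by (intro submodular) (simp_all add: finite_subset[OF _ finite_atLeastAtMost])
    then have "real_of_int (f (A \<union> B) + f (A \<inter> B)) \<le> of_int (f A + f B)"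
      by (simp only: of_int_le_iff)
    then show "ereal (of_int (f (A \<union> B))) + ereal (of_int (f (A \<inter> B))) \<le> ereal (of_int (f A)) + ereal (of_int (f B))"
      by simp
  next
    fix A :: "nat set"
    show "ereal (of_int (f A)) \<in> ereal ` \<nat>"
      by (intro imageI) (metis nonneg[of A] of_int_of_nat_eq of_nat_in_Nats zero_le_imp_eq_int)
  qed (use empty in \<open>auto simp: zero_ereal_def\<close>)
  show "base_polyhedron d (\<lambda>A. ereal (of_int (f A))) = {y \<in> Rspace d. sum y {1..d} = of_int r \<and>
       (\<forall>i\<in>{1..d}. 0 \<le> y i \<and> y i \<le> of_int m) \<and> (\<forall>j\<le>k. sum y (X j) \<le> of_int (\<rho> j))}" (is "?Q = ?R")
  proof (intro subset_antisym subsetI)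
    fix y assume "y \<in> ?Q"
    then have y: "y \<in> Rspace d" "sum y {1..d} = of_int r" "\<And>A. A \<subseteq> {1..d} \<Longrightarrow> sum y A \<le> of_int (f A)"
      unfolding base_polyhedron_def using rank by auto
    have "0 \<le> y i" if i: "i \<in> {1..d}" for i
    proof -
      have "sum y ({1..d} - {i}) \<le> of_int (f ({1..d} - {i}))"
        by (rule y(3)) blast
      also have "\<dots> \<le> of_int (f {1..d})"
        using mono[of "{1..d} - {i}" "{1..d}"] by (simp only: of_int_le_iff Diff_subset finite_atLeastAtMost)
      finally show ?thesis
        using y(2) i rank by (simp add: sum_diff1)
    qed
    moreover have "y i \<le> of_int m" if i: "i \<in> {1..d}" for i
    proof -
      have "sum y {i} \<le> of_int (f {i})"
        by (rule y(3)) (use i in simp)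
      also have "\<dots> \<le> of_int m"
        using single[of i] by (simp only: of_int_le_iff)
      finally show ?thesis by simp
    qed
    moreover have "sum y (X j) \<le> of_int (\<rho> j)" if j: "j \<le> k" for j
    proof -
      have "sum y (X j) \<le> of_int (f (X j))"
        using X(3)[OF j order.refl] unfolding X(2) by (rule y(3))
      also have "\<dots> \<le> of_int (\<rho> j)"
        using le[OF j, of "X j"] by (simp add: w_def)
      finally show ?thesis .
    qed
    ultimately show "y \<in> ?R"
      using y by blast
  next
    fix y assume y: "y \<in> ?R"
    have "sum y A \<le> of_int (f A)" if A: "A \<subseteq> {1..d}" for A
    proof -
      obtain j where j: "j \<le> k" "f A = w A j"
        using ex by blast
      have fin: "finite A" "finite (X j)"
        using A X(3)[OF j(1) order.refl] finite_subset[OF _ finite_atLeastAtMost] unfolding X(2) by blast+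
      have "sum y A = sum y (A \<inter> X j) + sum y (A - X j)"
        using fin sum.Int_Diff by blast
      also have "sum y (A \<inter> X j) \<le> sum y (X j)"
        using fin y X(3)[OF j(1) order.refl] unfolding X(2) by (intro sum_mono2) auto
      also have "\<dots> \<le> of_int (\<rho> j)"
        using y j(1) by blast
      also have "sum y (A - X j) \<le> (\<Sum>i\<in>A - X j. of_int m)"
        using y A by (intro sum_mono) auto
      finally show ?thesis
        using j(2) by (simp add: w_def mult.commute)
    qed
    then show "y \<in> ?Q"
      using y rank unfolding base_polyhedron_def by auto
  qed
qed

lemma forall_zip_iff_nth:
  assumes "length rs = length Xs"
  shows "(\<forall>(A, t)\<in>set (zip Xs rs). sum y A \<le> of_int t) \<longleftrightarrow>
    (\<forall>j\<le>length Xs. sum y (({} # Xs) ! j) \<le> (of_int ((0 # rs) ! j) :: real))" (is "?l \<longleftrightarrow> ?r")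
proof
  assume l: ?l
  show ?r
  proof (intro allI impI)
    fix j assume j: "j \<le> length Xs"
    show "sum y (({} # Xs) ! j) \<le> of_int ((0 # rs) ! j)"
    proof (cases "j = 0")
      case False
      then have "(({} # Xs) ! j, (0 # rs) ! j) \<in> set (zip Xs rs)"
        unfolding mem_set_zip_iff[OF assms] using j by blast
      then show ?thesis
        using l by fast
    qed simp
  qed
next
  assume r: ?r
  show ?l
  proof clarify
    fix A t assume "(A, t) \<in> set (zip Xs rs)"
    then obtain j where "j \<le> length Xs" "A = ({} # Xs) ! j" "t = (0 # rs) ! j"
      unfolding mem_set_zip_iff[OF assms] by blast
    then show "sum y A \<le> of_int t"
      using r by blast
  qed
qed

text \<open>One construction serves two kinds: \<open>m\<close> is \<open>r\<close> for polymatroids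
  and 1 for matroids.\<close>

lemma R_PM_realised:
  assumes q: "(Xs, rs) \<in> p_PM d r" and m: "0 \<le> m"
    and top: "\<And>j. j \<le> length Xs \<Longrightarrow> r \<le> (0 # rs) ! j + m * int (card ({1..d} - ({} # Xs) ! j))"
  obtains rk where "polymatroid d rk" "rk {1..d} = ereal (of_int r)" "\<forall>i. rk {i} \<le> ereal (of_int m)"
    "base_polyhedron d rk = {y \<in> R_MM d Xs rs. \<forall>i\<in>{1..d}. 0 \<le> y i \<and> y i \<le> of_int m}"
proof -
  have p: "(Xs, rs) \<in> p_MM d r"
    using q unfolding p_PM_def by blast
  define X where "X = (\<lambda>j. ({} # Xs) ! j)"
  define \<rho> where "\<rho> = (\<lambda>j. (0 # rs) ! j)"
  define k where "k = length Xs"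
  note nth = p_MM_nth[OF p, folded X_def \<rho>_def k_def]
  have X0: "X 0 = {}" "\<rho> 0 = 0"
    by (simp_all add: X_def \<rho>_def)
  define f where "f A = Min ((\<lambda>j. \<rho> j + m * int (card (A - X j))) ` {..k})" for A
  note props = min_rank_properties[of X k d \<rho> r m f, OF X0(1) nth(2) nth(5) X0(2) nth(3)
      p_PM_ranks(2)[OF q, folded \<rho>_def k_def] m top[folded X_def \<rho>_def k_def] f_def]
  show ?thesis
  proof (rule that)
    show "polymatroid d (\<lambda>A. ereal (of_int (f A)))"
      by (rule props(1))
    show "ereal (of_int (f {1..d})) = ereal (of_int r)"
      using props(2) by simp
    show "\<forall>i. ereal (of_int (f {i})) \<le> ereal (of_int m)"
      using props(3) by simp
    have "y \<in> R_MM d Xs rs \<longleftrightarrow> y \<in> Rspace d \<and> sum y {1..d} = of_int r \<and>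
        (\<forall>j\<le>k. sum y (X j) \<le> of_int (\<rho> j))" for y
      unfolding mem_R_MM_iff[OF p] forall_zip_iff_nth[OF nth(1)[unfolded k_def]] X_def \<rho>_def k_def ..
    then show "base_polyhedron d (\<lambda>A. ereal (of_int (f A)))
        = {y \<in> R_MM d Xs rs. \<forall>i\<in>{1..d}. 0 \<le> y i \<and> y i \<le> of_int m}"
      using props(4) by auto
  qed
qed

text \<open>A rank that is infinite off the chain imposes no constraints but those of the chain.
  Submodularity holds with equality, since the union and intersection of comparable sets are these
  sets again.\<close>

lemma R_MM_realised:
  assumes p: "(Xs, rs) \<in> p_MM d r"
  obtains rk where "megamatroid d rk" "rk {1..d} = ereal (of_int r)" "base_polyhedron d rk = R_MM d Xs rs"
proof -
  define X where "X = (\<lambda>j. ({} # Xs) ! j)"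
  define \<rho> where "\<rho> = (\<lambda>j. (0 # rs) ! j)"
  define k where "k = length Xs"
  note nth = p_MM_nth[OF p, folded X_def \<rho>_def k_def]
  have X0: "X 0 = {}" "\<rho> 0 = 0"
    by (simp_all add: X_def \<rho>_def)
  \<comment> \<open>Off the chain this is an infimum over the empty set, hence infinite; on the
    chain the index is unique.\<close>
  define rk where "rk A = (INF j\<in>{j. j \<le> k \<and> A = X j}. ereal (of_int (\<rho> j)))" for A
  have rk_X: "rk (X j) = ereal (of_int (\<rho> j))" if j: "j \<le> k" for j
  proof -
    have "i = j" if "i \<le> k" "X j = X i" for i
    proof (rule ccontr)
      assume "i \<noteq> j"
      then consider "i < j" | "j < i" by linarith
      then show False
        by cases (use nth(4)[of i j] nth(4)[of j i] that j in simp_all)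
    qed
    then have "{i. i \<le> k \<and> X j = X i} = {j}"
      using j by auto
    then show ?thesis
      by (simp add: rk_def)
  qed
  have rk_top: "rk A = \<infinity>" if "\<not> (\<exists>j\<le>k. A = X j)" for A
  proof -
    have "{j. j \<le> k \<and> A = X j} = {}"
      using that by blast
    then show ?thesis
      unfolding rk_def by (simp only: image_empty Inf_empty top_ereal_def)
  qed
  have int_iff: "rk A \<in> ereal ` \<int> \<longleftrightarrow> (\<exists>j\<le>k. A = X j)" for A
    using rk_X rk_top[of A] by force
  show ?thesis
  proof (rule that)
    show rank: "rk {1..d} = ereal (of_int r)"
      using rk_X[OF order.refl] unfolding nth(2,3) .
    show "megamatroid d rk"
      unfolding megamatroid_def
    proof (intro conjI allI impI)
      show "rk A \<in> ereal ` \<int> \<union> {\<infinity>}" for A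
        using int_iff[of A] rk_top[of A] by blast
      show "rk {} = 0"
        using rk_X[of 0] X0 by (simp add: zero_ereal_def)
      show "rk {1..d} \<in> ereal ` \<int>"
        using rank by simp
      fix A B assume "rk A \<in> ereal ` \<int>" "rk B \<in> ereal ` \<int>"
      then obtain i j where ij: "i \<le> k" "A = X i" "j \<le> k" "B = X j"
        unfolding int_iff by blast
      then have "A \<subseteq> B \<or> B \<subseteq> A"
        using nth(5)[of i j] nth(5)[of j i] by (cases "i \<le> j") auto
      then have "{A \<union> B, A \<inter> B} = {A, B}" "rk (A \<union> B) + rk (A \<inter> B) = rk A + rk B"
        by (auto simp: Un_absorb1 Un_absorb2 Int_absorb1 Int_absorb2 add.commute)
      then show "rk (A \<union> B) \<in> ereal ` \<int>" "rk (A \<inter> B) \<in> ereal ` \<int>"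
        "rk (A \<union> B) + rk (A \<inter> B) \<le> rk A + rk B"
        using \<open>rk A \<in> ereal ` \<int>\<close> \<open>rk B \<in> ereal ` \<int>\<close> by (auto simp: doubleton_eq_iff)
    qed
    show "base_polyhedron d rk = R_MM d Xs rs"
    proof (rule Set.set_eqI)
      fix y
      have "(\<forall>A\<subseteq>{1..d}. ereal (sum y A) \<le> rk A) \<longleftrightarrow> (\<forall>j\<le>k. sum y (X j) \<le> of_int (\<rho> j))"
      proof (intro iffI allI impI)
        fix j assume "\<forall>A\<subseteq>{1..d}. ereal (sum y A) \<le> rk A" "j \<le> k"
        then have "ereal (sum y (X j)) \<le> rk (X j)"
          using nth(6) by blast
        then show "sum y (X j) \<le> of_int (\<rho> j)"
          unfolding rk_X[OF \<open>j \<le> k\<close>] by simp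
      next
        fix A assume r: "\<forall>j\<le>k. sum y (X j) \<le> of_int (\<rho> j)" "A \<subseteq> {1..d}"
        show "ereal (sum y A) \<le> rk A"
        proof (cases "\<exists>j\<le>k. A = X j")
          case True
          then show ?thesis
            using r(1) rk_X by auto
        qed (simp add: rk_top)
      qed
      then show "y \<in> base_polyhedron d rk \<longleftrightarrow> y \<in> R_MM d Xs rs"
        unfolding base_polyhedron_def mem_Collect_eq mem_R_MM_iff[OF p] rank
          forall_zip_iff_nth[OF nth(1)[unfolded k_def]] X_def[symmetric] \<rho>_def[symmetric] k_def[symmetric]
        by (simp only: ereal.inject)
    qed
  qed
qed

lemma R_star_realised:
  assumes "(Xs, rs) \<in> p_star s d r"
  obtains rk where "rk \<in> star_matroids s d r" "base_polyhedron d rk = R_star s d r Xs rs"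
proof (cases s)
  case MegaMatroid
  then have "(Xs, rs) \<in> p_MM d r"
    using assms by simp
  then obtain rk where "megamatroid d rk" "rk {1..d} = ereal (of_int r)" "base_polyhedron d rk = R_MM d Xs rs"
    using R_MM_realised by blast
  then show ?thesis
    using that MegaMatroid unfolding star_matroids_def by simp
next
  case PolyMatroid
  then have q: "(Xs, rs) \<in> p_PM d r"
    using assms by simp
  then have p: "(Xs, rs) \<in> p_MM d r"
    unfolding p_PM_def by blast
  have r: "0 \<le> r"
    using p_PM_ranks(2)[OF q order.refl] unfolding p_MM_nth(3)[OF p] .
  \<comment> \<open>Here \<open>m = r\<close>. A proper chain member misses at least one element,
    and that alone contributes \<open>r\<close>.\<close>
  have top: "r \<le> (0 # rs) ! j + r * int (card ({1..d} - ({} # Xs) ! j))" if j: "j \<le> length Xs" for j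
  proof (cases "j = length Xs")
    case True
    then show ?thesis
      using p_MM_nth(3)[OF p] r by simp
  next
    case False
    then have "{1..d} - ({} # Xs) ! j \<noteq> {}"
      using p_MM_nth(4)[OF p, of j "length Xs"] j unfolding p_MM_nth(2)[OF p] by auto
    then have "1 \<le> int (card ({1..d} - ({} # Xs) ! j))"
      by (metis One_nat_def Suc_leI card_gt_0_iff finite_Diff finite_atLeastAtMost of_nat_1 of_nat_le_iff)
    then have "r * 1 \<le> r * int (card ({1..d} - ({} # Xs) ! j))"
      using r by (rule mult_left_mono)
    then show ?thesis
      using p_PM_ranks(2)[OF q j] by linarith
  qed
  obtain rk where rk: "polymatroid d rk" "rk {1..d} = ereal (of_int r)" "\<forall>i. rk {i} \<le> ereal (of_int r)"
    "base_polyhedron d rk = {y \<in> R_MM d Xs rs. \<forall>i\<in>{1..d}. 0 \<le> y i \<and> y i \<le> of_int r}"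
    by (rule R_PM_realised[OF q r top])
  \<comment> \<open>The bound \<open>m = r\<close> cuts nothing off, as nonnegative coordinates of
    total \<open>r\<close> are at most \<open>r\<close>.\<close>
  have upper: "y i \<le> of_int r" if y: "y \<in> Delta_PM d r" and i: "i \<in> {1..d}" for y i
  proof -
    have "y i \<le> sum y {1..d}"
      by (rule member_le_sum[OF i]) (use y in \<open>simp_all add: Delta_PM_def\<close>)
    then show ?thesis
      using y by (simp add: Delta_PM_def)
  qed
  have "y \<in> base_polyhedron d rk \<longleftrightarrow> y \<in> R_star s d r Xs rs" for y
    unfolding rk(4) PolyMatroid R_star.simps mem_Collect_eq Int_iff
    using upper[of y] mem_R_MM_iff[OF p, of y] unfolding Delta_PM_def mem_Collect_eq by blast
  then have "base_polyhedron d rk = R_star s d r Xs rs"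
    by blast
  then show ?thesis
    using that rk(1,2) PolyMatroid unfolding star_matroids_def by simp
next
  case Matroid
  then have "(Xs, rs) \<in> p_M d r"
    using assms by simp
  then have q: "(Xs, rs) \<in> p_PM d r"
    and corank: "\<And>j. Suc j < length Xs \<Longrightarrow> corank Xs rs j < corank Xs rs (Suc j)"
      "corank Xs rs (length Xs - 1) \<le> corank Xs rs (length Xs)"
    unfolding p_M_def by blast+
  then have p: "(Xs, rs) \<in> p_MM d r"
    unfolding p_PM_def by blast
  \<comment> \<open>For \<open>m = 1\<close> the condition \<open>top\<close> says precisely that no
    corank exceeds the last one.\<close>
  have "corank Xs rs j \<le> corank Xs rs (length Xs)" if j: "j \<le> length Xs" for j
    using j
  proof (induction rule: inc_induct)
    case (step j)
    show ?case
    proof (cases "Suc j = length Xs")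
      case True
      then have "length Xs - 1 = j" by simp
      then show ?thesis
        using corank(2) by simp
    next
      case False
      then show ?thesis
        using corank(1)[of j] step by simp
    qed
  qed simp
  then have top: "r \<le> (0 # rs) ! j + 1 * int (card ({1..d} - ({} # Xs) ! j))" if j: "j \<le> length Xs" for j
  proof -
    have sub: "({} # Xs) ! j \<subseteq> {1..d}"
      by (rule p_MM_nth(6)[OF p j])
    have "int (card ({1..d} - ({} # Xs) ! j)) = int d - int (card (({} # Xs) ! j))"
      using sub finite_subset[OF sub] card_mono[OF _ sub] by (subst card_Diff_subset) auto
    moreover have "corank Xs rs (length Xs) = int d - r"
      unfolding corank_def p_MM_nth(2,3)[OF p] by simp
    ultimately show ?thesis
      using \<open>\<And>j. j \<le> length Xs \<Longrightarrow> corank Xs rs j \<le> corank Xs rs (length Xs)\<close>[OF j]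
      unfolding corank_def[of Xs rs j] by linarith
  qed
  obtain rk where rk: "polymatroid d rk" "rk {1..d} = ereal (of_int r)" "\<forall>i. rk {i} \<le> ereal (of_int 1)"
    "base_polyhedron d rk = {y \<in> R_MM d Xs rs. \<forall>i\<in>{1..d}. 0 \<le> y i \<and> y i \<le> of_int 1}"
    by (rule R_PM_realised[OF q zero_le_one top])
  have "y \<in> base_polyhedron d rk \<longleftrightarrow> y \<in> R_star s d r Xs rs" for y
    unfolding rk(4) Matroid R_star.simps mem_Collect_eq Int_iff Delta_M_def
    using mem_R_MM_iff[OF p, of y] by auto
  then have "base_polyhedron d rk = R_star s d r Xs rs"
    by blast
  moreover have "matroid d rk"
    using rk(1,3) unfolding matroid_def by (simp add: one_ereal_def)
  ultimately show ?thesis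
    using that rk(2) Matroid unfolding star_matroids_def by simp
qed

section \<open>Permutations of the coordinates\<close>

lemma comp_permutes_Rspace:
  assumes "\<sigma> permutes {1..d}" "y \<in> Rspace d"
  shows "y \<circ> \<sigma> \<in> Rspace d"
proof -
  have "(y \<circ> \<sigma>) x = undefined" if "x \<notin> {1..d}" for x
    using assms that permutes_not_in[OF assms(1) that] unfolding Rspace_def by (auto simp: PiE_def extensional_def)
  then show ?thesis
    unfolding Rspace_def by (auto simp: PiE_def extensional_def)
qed

lemma sum_comp_permutes:
  assumes "\<sigma> permutes S"
  shows "sum (y \<circ> \<sigma>) A = sum y (\<sigma> ` A)"
  using sum.reindex[of \<sigma> A y] permutes_inj_on[OF assms, of A] by simp

lemma image_permutes_subset:
  assumes "\<sigma> permutes S" "A \<subseteq> S"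
  shows "\<sigma> ` A \<subseteq> S"
  using assms permutes_image[OF assms(1)] by blast

lemma star_matroids_permute:
  assumes rk: "rk \<in> star_matroids s d r" and \<sigma>: "\<sigma> permutes {1..d}"
  shows "(\<lambda>A. rk (\<sigma> ` A)) \<in> star_matroids s d r"
proof -
  note sub = image_permutes_subset[OF \<sigma>]
  note img = permutes_image[OF \<sigma>]
  note inter = image_Int[OF permutes_inj[OF \<sigma>]]
  have mega: "megamatroid d (\<lambda>A. rk (\<sigma> ` A))" if "megamatroid d rk"
  proof -
    note mm = that[unfolded megamatroid_def]
    show ?thesis
      unfolding megamatroid_def img image_empty image_Un inter
    proof (intro conjI allI impI)
      fix A B assume "A \<subseteq> {1..d}" "B \<subseteq> {1..d}" "rk (\<sigma> ` A) \<in> ereal ` \<int>" "rk (\<sigma> ` B) \<in> ereal ` \<int>"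
      then have "rk (\<sigma> ` A \<union> \<sigma> ` B) \<in> ereal ` \<int> \<and> rk (\<sigma> ` A \<inter> \<sigma> ` B) \<in> ereal ` \<int> \<and>
          rk (\<sigma> ` A \<union> \<sigma> ` B) + rk (\<sigma> ` A \<inter> \<sigma> ` B) \<le> rk (\<sigma> ` A) + rk (\<sigma> ` B)"
        using mm sub[of A] sub[of B] by blast
      then show "rk (\<sigma> ` A \<union> \<sigma> ` B) \<in> ereal ` \<int>" "rk (\<sigma> ` A \<inter> \<sigma> ` B) \<in> ereal ` \<int>"
          "rk (\<sigma> ` A \<union> \<sigma> ` B) + rk (\<sigma> ` A \<inter> \<sigma> ` B) \<le> rk (\<sigma> ` A) + rk (\<sigma> ` B)"
        by blast+
    next
      fix A :: "nat set" assume "A \<subseteq> {1..d}"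
      then show "rk (\<sigma> ` A) \<in> ereal ` \<int> \<union> {\<infinity>}"
        using mm sub[of A] by blast
    qed (use mm in blast)+
  qed
  have poly: "polymatroid d (\<lambda>A. rk (\<sigma> ` A))" if "polymatroid d rk"
  proof -
    note pm = that[unfolded polymatroid_def]
    have mono: "rk (\<sigma> ` A) \<le> rk (\<sigma> ` B)" if "B \<subseteq> {1..d}" "A \<subseteq> B" for A B
      using pm sub[OF that(1)] image_mono[OF that(2), of \<sigma>] by blast
    have nat: "rk (\<sigma> ` A) \<in> ereal ` \<nat>" if "A \<subseteq> {1..d}" for A
      using pm sub[OF that] by blast
    show ?thesis
      unfolding polymatroid_def by (intro conjI allI impI mega conjunct1[OF pm] mono nat)
  qed
  have mat: "matroid d (\<lambda>A. rk (\<sigma> ` A))" if "matroid d rk"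
    using that poly permutes_in_image[OF \<sigma>] unfolding matroid_def by simp
  show ?thesis
    using rk mega poly mat img unfolding star_matroids_def by (cases s) simp_all
qed

text \<open>If \<open>B\<close> is the image of \<open>A\<close> under \<sigma>, the sum of
  \<open>y\<close> over \<open>A\<close> is the sum over \<open>B\<close> of \<open>y\<close>
  composed with the inverse of \<sigma>; hence the inverse on the right.\<close>

lemma base_polyhedron_permute:
  assumes \<sigma>: "\<sigma> permutes {1..d}" and y: "y \<in> Rspace d"
  shows "y \<in> base_polyhedron d (\<lambda>A. rk (\<sigma> ` A)) \<longleftrightarrow> y \<circ> inv_into UNIV \<sigma> \<in> base_polyhedron d rk"
proof -
  have inv: "inv_into UNIV \<sigma> permutes {1..d}"
    by (rule permutes_inv[OF \<sigma>])
  have cancel: "inv_into UNIV \<sigma> ` \<sigma> ` A = A" "\<sigma> ` inv_into UNIV \<sigma> ` A = A" for A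
    using permutes_inverses[OF \<sigma>] by (auto simp: image_comp comp_def)
  have "(\<forall>A\<subseteq>{1..d}. ereal (sum y A) \<le> rk (\<sigma> ` A)) \<longleftrightarrow> (\<forall>B\<subseteq>{1..d}. ereal (sum y (inv_into UNIV \<sigma> ` B)) \<le> rk B)"
  proof (intro iffI allI impI)
    fix B assume *: "\<forall>A\<subseteq>{1..d}. ereal (sum y A) \<le> rk (\<sigma> ` A)" "B \<subseteq> {1..d}"
    have "ereal (sum y (inv_into UNIV \<sigma> ` B)) \<le> rk (\<sigma> ` inv_into UNIV \<sigma> ` B)"
      using *(1) image_permutes_subset[OF inv *(2)] by blast
    then show "ereal (sum y (inv_into UNIV \<sigma> ` B)) \<le> rk B"
      unfolding cancel .
  next
    fix A assume *: "\<forall>B\<subseteq>{1..d}. ereal (sum y (inv_into UNIV \<sigma> ` B)) \<le> rk B" "A \<subseteq> {1..d}"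
    have "ereal (sum y (inv_into UNIV \<sigma> ` \<sigma> ` A)) \<le> rk (\<sigma> ` A)"
      using *(1) image_permutes_subset[OF \<sigma> *(2)] by blast
    then show "ereal (sum y A) \<le> rk (\<sigma> ` A)"
      unfolding cancel .
  qed
  then show ?thesis
    unfolding base_polyhedron_def mem_Collect_eq sum_comp_permutes[OF inv]
      permutes_image[OF inv] permutes_image[OF \<sigma>]
    using y comp_permutes_Rspace[OF inv y] by blast
qed

lemma p_MM_permute:
  assumes p: "(Xs, rs) \<in> p_MM d r" and \<sigma>: "\<sigma> permutes {1..d}"
  shows "(map ((`) \<sigma>) Xs, rs) \<in> p_MM d r"
proof -
  have len: "length rs = length Xs" and sorted: "sorted_wrt (\<subset>) ({} # Xs)"
    and last: "last ({} # Xs) = {1..d}" "last (0 # rs) = r"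
    using p unfolding p_MM_def by blast+
  have eq: "{} # map ((`) \<sigma>) Xs = map ((`) \<sigma>) ({} # Xs)"
    by simp
  have "sorted_wrt (\<subset>) ({} # map ((`) \<sigma>) Xs)"
    unfolding eq sorted_wrt_map
    by (rule sorted_wrt_mono_rel[OF _ sorted]) (simp add: image_strict_mono permutes_inj_on[OF \<sigma>])
  moreover have "last ({} # map ((`) \<sigma>) Xs) = {1..d}"
    unfolding eq by (subst last_map) (simp_all only: list.distinct last(1) permutes_image[OF \<sigma>] not_False_eq_True simp_thms)
  ultimately show ?thesis
    using len last(2) unfolding p_MM_def by simp
qed

lemma p_star_permute:
  assumes p: "(Xs, rs) \<in> p_star s d r" and \<sigma>: "\<sigma> permutes {1..d}"
  shows "(map ((`) \<sigma>) Xs, rs) \<in> p_star s d r"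
proof -
  have "card (({} # map ((`) \<sigma>) Xs) ! j) = card (({} # Xs) ! j)" if "j \<le> length Xs" for j
    using that card_image[OF permutes_inj_on[OF \<sigma>]] by (cases j) auto
  then have corank: "corank (map ((`) \<sigma>) Xs) rs j = corank Xs rs j" if "j \<le> length Xs" for j
    using that unfolding corank_def by simp
  have PM: "(map ((`) \<sigma>) Xs, rs) \<in> p_PM d r" if "(Xs, rs) \<in> p_PM d r"
    using that p_MM_permute[OF _ \<sigma>] unfolding p_PM_def by blast
  have M: "(map ((`) \<sigma>) Xs, rs) \<in> p_M d r" if "(Xs, rs) \<in> p_M d r"
    using that PM corank unfolding p_M_def by simp
  show ?thesis
    using p PM M p_MM_permute[OF _ \<sigma>] by (cases s) auto
qed

lemma ambient_permute:
  assumes \<sigma>: "\<sigma> permutes {1..d}" and y: "y \<in> Rspace d"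
  shows "y \<circ> \<sigma> \<in> ambient s d r \<longleftrightarrow> y \<in> ambient s d r"
proof -
  have total: "sum (y \<circ> \<sigma>) {1..d} = sum y {1..d}"
    unfolding sum_comp_permutes[OF \<sigma>] permutes_image[OF \<sigma>] ..
  have all: "(\<forall>i\<in>{1..d}. P ((y \<circ> \<sigma>) i)) \<longleftrightarrow> (\<forall>i\<in>{1..d}. P (y i))" for P
  proof -
    have "(\<forall>i\<in>{1..d}. P ((y \<circ> \<sigma>) i)) \<longleftrightarrow> (\<forall>i\<in>\<sigma> ` {1..d}. P (y i))"
      by simp
    then show ?thesis
      unfolding permutes_image[OF \<sigma>] .
  qed
  show ?thesis
    using y total all[of "\<lambda>x. 0 \<le> x"] all[of "\<lambda>x. 0 \<le> x \<and> x \<le> 1"] comp_permutes_Rspace[OF \<sigma> y]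
    by (cases s) (simp_all only: ambient.simps Delta_PM_def Delta_M_def mem_Collect_eq simp_thms)
qed

lemma R_star_permute:
  assumes p: "(Xs, rs) \<in> p_MM d r" and \<sigma>: "\<sigma> permutes {1..d}" and y: "y \<in> Rspace d"
  shows "y \<circ> \<sigma> \<in> R_star s d r Xs rs \<longleftrightarrow> y \<in> R_star s d r (map ((`) \<sigma>) Xs) rs"
  unfolding mem_R_star_iff[OF p] mem_R_star_iff[OF p_MM_permute[OF p \<sigma>]] ambient_permute[OF \<sigma> y]
    sum_comp_permutes[OF \<sigma>] by (force simp: zip_map1)

text \<open>Elements are numbered in the order in which the chain acquires them: a numbering of the
  previous set is extended to the new elements by the next consecutive integers.\<close>

lemma chain_standardize:
  assumes "sorted_wrt (\<subset>) Xs" "\<And>X. X \<in> set Xs \<Longrightarrow> finite X" "Xs \<noteq> []"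
  shows "\<exists>f. bij_betw f (last Xs) {1..card (last Xs)} \<and> (\<forall>X\<in>set Xs. f ` X = {1..card X})"
  using assms(3,1,2)
proof (induction Xs rule: rev_nonempty_induct)
  case (single A)
  then obtain f where f: "bij_betw f A {1..card A}"
    using finite_same_card_bij[of A "{1..card A}"] by auto
  then show ?case
    by (auto simp: bij_betw_def intro!: exI[of _ f])
next
  case (snoc B Xs)
  define A where "A = last Xs"
  have sorted: "sorted_wrt (\<subset>) Xs" and AB: "A \<subset> B" and fin: "finite A" "finite B"
    using snoc.prems snoc.hyps unfolding A_def by (auto simp: sorted_wrt_append)
  obtain f where f: "bij_betw f A {1..card A}" "\<And>X. X \<in> set Xs \<Longrightarrow> f ` X = {1..card X}"
    using snoc.IH[OF sorted] snoc.prems(2) unfolding A_def by auto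
  have "card A \<le> card B"
    using AB fin by (simp add: card_mono less_imp_le)
  then have "card (B - A) = card {card A + 1..card B}"
    using AB fin by (simp add: card_Diff_subset)
  then obtain g where g: "bij_betw g (B - A) {card A + 1..card B}"
    using finite_same_card_bij[of "B - A" "{card A + 1..card B}"] fin by auto
  define h where "h x = (if x \<in> A then f x else g x)" for x
  have "bij_betw h (A \<union> (B - A)) ({1..card A} \<union> {card A + 1..card B})"
  proof (rule bij_betw_combine)
    show "bij_betw h A {1..card A}"
      by (rule bij_betw_cong[THEN iffD1, OF _ f(1)]) (simp add: h_def)
    show "bij_betw h (B - A) {card A + 1..card B}"
      by (rule bij_betw_cong[THEN iffD1, OF _ g]) (simp add: h_def)
  qed auto
  moreover have "A \<union> (B - A) = B" "{1..card A} \<union> {card A + 1..card B} = {1..card B}"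
    using AB \<open>card A \<le> card B\<close> by auto
  ultimately have h: "bij_betw h B {1..card B}"
    by simp
  have "h ` X = {1..card X}" if X: "X \<in> set (Xs @ [B])" for X
  proof (cases "X = B")
    case True
    then show ?thesis
      using h by (simp add: bij_betw_def)
  next
    case False
    then have X': "X \<in> set Xs"
      using X by simp
    have "X \<subseteq> A"
    proof -
      obtain Ys where "Xs = Ys @ [A]"
        using snoc.hyps unfolding A_def by (metis append_butlast_last_id)
      then show ?thesis
        using X' sorted by (auto simp: sorted_wrt_append)
    qed
    then have "h ` X = f ` X"
      unfolding h_def by (intro image_cong) auto
    then show ?thesis
      using f(2)[OF X'] by simp
  qed
  then show ?case
    using h by (intro exI[of _ h]) auto
qed

text \<open>Every orbit of the symmetric group thus meets \<open>p_sym\<close>; this is what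
  spanning in the quotient needs.\<close>

lemma p_star_standardize:
  assumes p: "(Xs, rs) \<in> p_star s d r"
  obtains \<sigma> where "\<sigma> permutes {1..d}" "(map ((`) \<sigma>) Xs, rs) \<in> p_sym s d r"
proof (cases "Xs = []")
  case True
  then show ?thesis
    using that[OF permutes_id] p by (simp add: p_sym_def)
next
  case False
  have pMM: "(Xs, rs) \<in> p_MM d r"
    using p p_star_subset_p_MM by blast
  then have sorted: "sorted_wrt (\<subset>) Xs" and last: "last Xs = {1..d}"
    using False unfolding p_MM_def by auto
  have sub: "X \<subseteq> {1..d}" if "X \<in> set Xs" for X
  proof -
    obtain Ys where "Xs = Ys @ [{1..d}]"
      using False last by (metis append_butlast_last_id)
    then show ?thesis
      using that sorted by (auto simp: sorted_wrt_append)
  qed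
  obtain f where f: "bij_betw f {1..d} {1..d}" "\<And>X. X \<in> set Xs \<Longrightarrow> f ` X = {1..card X}"
    using chain_standardize[OF sorted _ False] finite_subset[OF sub] last by auto
  define \<sigma> where "\<sigma> i = (if i \<in> {1..d} then f i else i)" for i
  have "\<sigma> permutes {1..d}"
  proof (rule bij_imp_permutes)
    show "bij_betw \<sigma> {1..d} {1..d}"
      by (rule bij_betw_cong[THEN iffD1, OF _ f(1)]) (simp add: \<sigma>_def)
  qed (auto simp: \<sigma>_def)
  moreover have "\<sigma> ` X = {1..card X}" if "X \<in> set Xs" for X
  proof -
    have "\<sigma> ` X = f ` X"
      using sub[OF that] by (intro image_cong) (auto simp: \<sigma>_def)
    then show ?thesis
      using f(2)[OF that] by simp
  qed
  ultimately have "(map ((`) \<sigma>) Xs, rs) \<in> p_sym s d r"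
    using p_star_permute[OF p] unfolding p_sym_def by auto
  then show ?thesis
    using that \<open>\<sigma> permutes {1..d}\<close> by blast
qed

text \<open>An initial segment is determined by its cardinality, which permutations preserve. So an
  orbit meets \<open>p_sym\<close> at most once.\<close>

lemma p_sym_orbit_unique:
  assumes "(Xs, rs) \<in> p_sym s d r" "(map ((`) \<sigma>) Xs, rs) \<in> p_sym s d r" "\<sigma> permutes {1..d}"
  shows "map ((`) \<sigma>) Xs = Xs"
proof -
  have "\<sigma> ` X = X" if X: "X \<in> set Xs" for X
  proof -
    obtain i where i: "X = {1..i}"
      using X assms(1) unfolding p_sym_def by blast
    obtain j where j: "\<sigma> ` X = {1..j}"
      using imageI[OF X, of "(`) \<sigma>"] assms(2) unfolding p_sym_def set_map[symmetric] by blast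
    have "card (\<sigma> ` X) = card X"
      by (rule card_image[OF permutes_inj_on[OF assms(3)]])
    then show ?thesis
      unfolding j unfolding i by simp
  qed
  then show ?thesis
    by (simp add: map_idI)
qed

section \<open>The quotient group\<close>

lemma group_fun_group: "group (fun_group d)"
  unfolding fun_group_def by simp

lemma comm_group_fun_group: "comm_group (fun_group d)"
proof (rule group.group_comm_groupI[OF group_fun_group])
  show "f \<otimes>\<^bsub>fun_group d\<^esub> g = g \<otimes>\<^bsub>fun_group d\<^esub> f" for f g
    by (simp add: fun_group_def add.commute)
qed

lemma fun_group_simps:
  "carrier (fun_group d) = Rspace d \<rightarrow>\<^sub>E UNIV"
  "f \<otimes>\<^bsub>fun_group d\<^esub> g = (\<lambda>y\<in>Rspace d. f y + g y)"
  "\<one>\<^bsub>fun_group d\<^esub> = (\<lambda>y\<in>Rspace d. 0)"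
  by (simp_all add: fun_group_def)

lemma inv_fun_group:
  "f \<in> carrier (fun_group d) \<Longrightarrow> inv\<^bsub>fun_group d\<^esub> f = (\<lambda>y\<in>Rspace d. - f y)"
  unfolding fun_group_def by (subst inv_product_group) simp_all

lemma comm_group_P_group: "comm_group (P_group s d r)"
  unfolding P_group_def by (rule group.abelian_subgroup_generated[OF group_fun_group comm_group_fun_group])

lemma group_P_group: "group (P_group s d r)"
  using comm_group_P_group comm_group.axioms(2) by blast

lemma P_group_simps:
  "f \<otimes>\<^bsub>P_group s d r\<^esub> g = (\<lambda>y\<in>Rspace d. f y + g y)"
  "\<one>\<^bsub>P_group s d r\<^esub> = (\<lambda>y\<in>Rspace d. 0)"
  by (simp_all add: P_group_def fun_group_simps)

lemma carrier_P_group_subset: "carrier (P_group s d r) \<subseteq> carrier (fun_group d)"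
  unfolding P_group_def by (rule group.carrier_subgroup_generated_subset[OF group_fun_group])

lemma inv_P_group:
  assumes "f \<in> carrier (P_group s d r)"
  shows "inv\<^bsub>P_group s d r\<^esub> f = (\<lambda>y\<in>Rspace d. - f y)"
  using assms inv_fun_group[OF subsetD[OF carrier_P_group_subset assms]]
  unfolding P_group_def by (simp add: group.inv_subgroup_generated[OF group_fun_group])

lemma P_group_diff:
  assumes "f \<in> carrier (P_group s d r)" "g \<in> carrier (P_group s d r)"
  shows "f \<otimes>\<^bsub>P_group s d r\<^esub> inv\<^bsub>P_group s d r\<^esub> g = (\<lambda>y\<in>Rspace d. f y - g y)"
  unfolding P_group_simps inv_P_group[OF assms(2)] by (intro restrict_ext) simp

lemma ind_in_P_group:
  assumes "rk \<in> star_matroids s d r"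
  shows "ind d (base_polyhedron d rk) \<in> carrier (P_group s d r)"
proof -
  have "ind d (base_polyhedron d rk) \<in> carrier (fun_group d)" for rk
    unfolding fun_group_simps ind_def by simp
  then have "{ind d (base_polyhedron d rk) |rk. rk \<in> star_matroids s d r} \<subseteq> carrier (P_group s d r)"
    unfolding P_group_def
    by (intro group.subgroup_generated_subset_carrier_subset[OF group_fun_group]) blast
  then show ?thesis
    using assms by blast
qed

lemma ind_R_star_in_P_group:
  "(Xs, rs) \<in> p_star s d r \<Longrightarrow> ind d (R_star s d r Xs rs) \<in> carrier (P_group s d r)"
  using ind_in_P_group R_star_realised by metis

lemma sym_relation_in_P_group:
  assumes "rk \<in> star_matroids s d r" "\<sigma> permutes {1..d}"
  shows "(\<lambda>y\<in>Rspace d. ind d (base_polyhedron d rk) y - ind d (base_polyhedron d (\<lambda>A. rk (\<sigma> ` A))) y)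
    \<in> carrier (P_group s d r)"
proof -
  interpret P: group "P_group s d r"
    by (rule group_P_group)
  note mem = ind_in_P_group[OF assms(1)] ind_in_P_group[OF star_matroids_permute[OF assms]]
  show ?thesis
    unfolding P_group_diff[OF mem, symmetric] using mem by (intro P.m_closed P.inv_closed)
qed

lemma subgroup_sym_relations: "subgroup (sym_relations s d r) (P_group s d r)"
  unfolding sym_relations_def
  by (rule group.generate_is_subgroup[OF group_P_group]) (use sym_relation_in_P_group in blast)

text \<open>
  Summing over all coordinate permutations kills the relations defining \<open>P_sym\<close>. No division is
  needed, as only the vanishing of coefficients is tested.
\<close>

lemma sym_relation_symmetrized:
  assumes \<tau>: "\<tau> permutes {1..d}" and y: "y \<in> Rspace d"
    and f: "f = (\<lambda>y\<in>Rspace d. ind d (base_polyhedron d rk) y - ind d (base_polyhedron d (\<lambda>A. rk (\<tau> ` A))) y)"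
  shows "(\<Sum>\<sigma> | \<sigma> permutes {1..d}. f (y \<circ> \<sigma>)) = 0"
proof -
  note \<tau>' = permutes_inv[OF \<tau>]
  \<comment> \<open>Twisting the rank function by \<tau> becomes a translation of the summation
    variable \<sigma>, which a sum over the whole group does not see.\<close>
  have "f (y \<circ> \<sigma>) = ind d (base_polyhedron d rk) (y \<circ> \<sigma>) - ind d (base_polyhedron d rk) (y \<circ> (\<sigma> \<circ> inv_into UNIV \<tau>))"
    if \<sigma>: "\<sigma> permutes {1..d}" for \<sigma>
  proof -
    have mem: "y \<circ> \<sigma> \<in> Rspace d" "y \<circ> (\<sigma> \<circ> inv_into UNIV \<tau>) \<in> Rspace d"
      using comp_permutes_Rspace[OF \<sigma> y] comp_permutes_Rspace[OF permutes_compose[OF \<tau>' \<sigma>] y] .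
    then show ?thesis
      using base_polyhedron_permute[OF \<tau> mem(1), of rk]
      unfolding f ind_def by (simp add: indicator_def comp_assoc)
  qed
  then have "(\<Sum>\<sigma> | \<sigma> permutes {1..d}. f (y \<circ> \<sigma>)) =
      (\<Sum>\<sigma> | \<sigma> permutes {1..d}. ind d (base_polyhedron d rk) (y \<circ> \<sigma>)) -
      (\<Sum>\<sigma> | \<sigma> permutes {1..d}. ind d (base_polyhedron d rk) (y \<circ> (\<sigma> \<circ> inv_into UNIV \<tau>)))"
    by (simp add: sum_subtractf)
  also have "(\<Sum>\<sigma> | \<sigma> permutes {1..d}. ind d (base_polyhedron d rk) (y \<circ> (\<sigma> \<circ> inv_into UNIV \<tau>)))
      = (\<Sum>\<sigma> | \<sigma> permutes {1..d}. ind d (base_polyhedron d rk) (y \<circ> \<sigma>))"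
    by (rule sum_permutations_compose_right[OF \<tau>', symmetric])
  finally show ?thesis
    by (simp only: diff_self)
qed

lemma sym_relations_symmetrized:
  assumes f: "f \<in> sym_relations s d r" and y: "y \<in> Rspace d"
  shows "(\<Sum>\<sigma> | \<sigma> permutes {1..d}. f (y \<circ> \<sigma>)) = 0"
  using f unfolding sym_relations_def
proof (induction f rule: generate.induct)
  case one
  show ?case
    unfolding P_group_simps
    by (intro sum.neutral ballI) (simp only: restrict_apply' comp_permutes_Rspace[OF _ y] mem_Collect_eq)
next
  case *: (incl f)
  then show ?case
    using sym_relation_symmetrized[OF _ y] by blast
next
  case *: (inv f)
  then have "f \<in> carrier (P_group s d r)"
    using sym_relation_in_P_group by blast
  moreover have "(\<Sum>\<sigma> | \<sigma> permutes {1..d}. f (y \<circ> \<sigma>)) = 0"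
    using * sym_relation_symmetrized[OF _ y] by blast
  moreover have "(\<Sum>\<sigma> | \<sigma> permutes {1..d}. (\<lambda>y\<in>Rspace d. - f y) (y \<circ> \<sigma>)) = (\<Sum>\<sigma> | \<sigma> permutes {1..d}. - f (y \<circ> \<sigma>))"
    by (intro sum.cong refl) (simp only: restrict_apply' comp_permutes_Rspace[OF _ y] mem_Collect_eq)
  ultimately show ?case
    by (simp only: inv_P_group sum_negf minus_zero)
next
  case *: (eng f g)
  have "(\<Sum>\<sigma> | \<sigma> permutes {1..d}. (\<lambda>y\<in>Rspace d. f y + g y) (y \<circ> \<sigma>)) = (\<Sum>\<sigma> | \<sigma> permutes {1..d}. f (y \<circ> \<sigma>) + g (y \<circ> \<sigma>))"
    by (intro sum.cong refl) (simp only: restrict_apply' comp_permutes_Rspace[OF _ y] mem_Collect_eq)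
  then show ?case
    using *(3,4) by (simp only: P_group_simps sum.distrib add_0)
qed

text \<open>Regrouping the double sum by permuted pairs gives a relation between distinct members of
  \<open>p_star\<close>, so every collected coefficient \<open>C j\<close> vanishes. At
  \<open>p\<close> no other member of \<open>I\<close> contributes, because different members of
  \<open>p_sym\<close> lie in different orbits; hence \<open>C p\<close> is \<open>c p\<close> times
  the order of the stabilizer of \<open>p\<close>.\<close>

lemma R_star_orbits_independent:
  fixes c :: "nat set list \<times> int list \<Rightarrow> int"
  assumes fin: "finite I" and I: "I \<subseteq> p_sym s d r"
    and zero: "\<And>y. y \<in> Rspace d \<Longrightarrow>
      (\<Sum>\<sigma> | \<sigma> permutes {1..d}. \<Sum>q\<in>I. c q * of_bool (y \<circ> \<sigma> \<in> R_star s d r (fst q) (snd q))) = 0"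
    and p: "p \<in> I"
  shows "c p = 0"
proof -
  let ?perms = "{\<sigma>. \<sigma> permutes {1..d}}"
  have fin_perms: "finite ?perms"
    by (simp add: finite_permutations)
  define act where "act \<sigma> q = (map ((`) \<sigma>) (fst q), snd q :: int list)" for \<sigma> :: "nat \<Rightarrow> nat" and q
  define J where "J = (\<lambda>(\<sigma>, q). act \<sigma> q) ` (?perms \<times> I)"
  define C where "C j = (\<Sum>(\<sigma>, q)\<in>{x \<in> ?perms \<times> I. (\<lambda>(\<sigma>, q). act \<sigma> q) x = j}. c q)" for j
  have Ip: "(fst q, snd q) \<in> p_star s d r" if "q \<in> I" for q
    using that I unfolding p_sym_def by auto
  have "J \<subseteq> p_star s d r"
    using p_star_permute[OF Ip] unfolding J_def act_def by auto
  have "C j = 0" if "j \<in> J" for j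
  proof (rule R_star_independent[OF _ \<open>J \<subseteq> p_star s d r\<close> _ that])
    show "finite J"
      unfolding J_def using fin_perms fin by simp
    fix y assume y: "y \<in> Rspace d"
    have mem: "y \<circ> \<sigma> \<in> R_star s d r (fst q) (snd q) \<longleftrightarrow> y \<in> R_star s d r (fst (act \<sigma> q)) (snd (act \<sigma> q))"
      if "\<sigma> permutes {1..d}" "q \<in> I" for \<sigma> q
      using R_star_permute[OF subsetD[OF p_star_subset_p_MM Ip[OF that(2)]] that(1) y]
      unfolding act_def by simp
    have "0 = (\<Sum>\<sigma>\<in>?perms. \<Sum>q\<in>I. c q * of_bool (y \<in> R_star s d r (fst (act \<sigma> q)) (snd (act \<sigma> q))))"
      using zero[OF y] mem by simp
    also have "\<dots> = (\<Sum>(\<sigma>, q)\<in>?perms \<times> I. c q * of_bool (y \<in> R_star s d r (fst (act \<sigma> q)) (snd (act \<sigma> q))))"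
      by (rule sum.cartesian_product)
    also have "\<dots> = (\<Sum>j\<in>J. \<Sum>x\<in>{x \<in> ?perms \<times> I. (\<lambda>(\<sigma>, q). act \<sigma> q) x = j}.
        (\<lambda>(\<sigma>, q). c q * of_bool (y \<in> R_star s d r (fst (act \<sigma> q)) (snd (act \<sigma> q)))) x)"
      unfolding J_def by (rule sum.image_gen) (use fin_perms fin in simp)
    also have "\<dots> = (\<Sum>j\<in>J. C j * of_bool (y \<in> R_star s d r (fst j) (snd j)))"
      unfolding C_def sum_distrib_right by (intro sum.cong refl) auto
    finally show "(\<Sum>j\<in>J. C j * of_bool (y \<in> R_star s d r (fst j) (snd j))) = 0"
      by simp
  qed
  moreover have act_id: "act id q = q" for q
    by (simp add: act_def)
  then have "p \<in> J"
    unfolding J_def using p permutes_id[of "{1..d}"] by (intro image_eqI[of _ _ "(id, p)"]) simp_all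
  ultimately have "C p = 0"
    by blast
  moreover have "{x \<in> ?perms \<times> I. (\<lambda>(\<sigma>, q). act \<sigma> q) x = p} = {\<sigma> \<in> ?perms. act \<sigma> p = p} \<times> {p}"
  proof -
    have "q = p" if "\<sigma> permutes {1..d}" "q \<in> I" "act \<sigma> q = p" for \<sigma> q
    proof -
      have "(fst q, snd q) \<in> p_sym s d r" "(map ((`) \<sigma>) (fst q), snd q) \<in> p_sym s d r"
        using that p I unfolding act_def by auto
      from p_sym_orbit_unique[OF this that(1)] show ?thesis
        using that(3) unfolding act_def by (metis prod.collapse)
    qed
    then have q: "act \<sigma> q = p \<longleftrightarrow> q = p \<and> act \<sigma> p = p" if "\<sigma> permutes {1..d}" "q \<in> I" for \<sigma> q
      using that by metis
    show ?thesis
    proof (rule Set.set_eqI)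
      fix x :: "(nat \<Rightarrow> nat) \<times> nat set list \<times> int list"
      obtain \<sigma> q where x: "x = (\<sigma>, q)" by (cases x)
      show "x \<in> {x \<in> ?perms \<times> I. (\<lambda>(\<sigma>, q). act \<sigma> q) x = p} \<longleftrightarrow> x \<in> {\<sigma> \<in> ?perms. act \<sigma> p = p} \<times> {p}"
        unfolding x mem_Collect_eq mem_Sigma_iff case_prod_conv singleton_iff using q[of \<sigma> q] p by blast
    qed
  qed
  then have "C p = card {\<sigma> \<in> ?perms. act \<sigma> p = p} * c p"
    unfolding C_def by (simp add: sum.cartesian_product[symmetric])
  moreover have "card {\<sigma> \<in> ?perms. act \<sigma> p = p} \<noteq> 0"
  proof -
    have "id \<in> {\<sigma> \<in> ?perms. act \<sigma> p = p}"
      using act_id[of p] permutes_id[of "{1..d}"] by blast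
    moreover have "finite {\<sigma> \<in> ?perms. act \<sigma> p = p}"
      using fin_perms by simp
    ultimately show ?thesis
      using card_gt_0_iff by blast
  qed
  ultimately show ?thesis
    by simp
qed

section \<open>The projection to the quotient\<close>

lemma rho_hom: "rho s d r \<in> hom (P_group s d r) (P_sym s d r)"
proof -
  have "sym_relations s d r \<lhd> P_group s d r"
    using comm_group.subgroup_imp_normal[OF comm_group_P_group subgroup_sym_relations] .
  from normal.r_coset_hom_Mod[OF this] show ?thesis
    unfolding rho_def P_sym_def .
qed

lemma rho_eq_one_iff:
  assumes "f \<in> carrier (P_group s d r)"
  shows "rho s d r f = \<one>\<^bsub>P_sym s d r\<^esub> \<longleftrightarrow> f \<in> sym_relations s d r"
  using group.coset_join1[OF group_P_group _ assms subgroup_sym_relations]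
    group.coset_join2[OF group_P_group assms subgroup_sym_relations]
  unfolding rho_def P_sym_def by auto

lemma comm_group_P_sym: "comm_group (P_sym s d r)"
  unfolding P_sym_def by (rule comm_group.abelian_FactGroup[OF comm_group_P_group subgroup_sym_relations])

text \<open>If \<open>rk\<close> realizes the polyhedron of a chain, then \<open>rk\<close> composed
  with the inverse of \<sigma> realizes that of the permuted chain. The difference of the two
  indicators is thus one of the generating relations.\<close>

lemma rho_permute:
  assumes p: "(Xs, rs) \<in> p_star s d r" and \<sigma>: "\<sigma> permutes {1..d}"
  shows "rho s d r (ind d (R_star s d r (map ((`) \<sigma>) Xs) rs)) = rho s d r (ind d (R_star s d r Xs rs))"
    (is "rho s d r ?g = rho s d r ?f")
proof -
  obtain rk where rk: "rk \<in> star_matroids s d r" "base_polyhedron d rk = R_star s d r Xs rs"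
    using R_star_realised[OF p] by blast
  define \<tau> where "\<tau> = inv_into UNIV \<sigma>"
  have \<tau>: "\<tau> permutes {1..d}" "inv_into UNIV \<tau> = \<sigma>"
    unfolding \<tau>_def using permutes_inv[OF \<sigma>] permutes_inv_inv[OF \<sigma>] by simp_all
  have f: "?f \<in> carrier (P_group s d r)" and g: "?g \<in> carrier (P_group s d r)"
    using ind_R_star_in_P_group[OF p] ind_R_star_in_P_group[OF p_star_permute[OF p \<sigma>]] .
  have "ind d (base_polyhedron d (\<lambda>A. rk (\<tau> ` A))) y = ?g y" if y: "y \<in> Rspace d" for y
    using base_polyhedron_permute[OF \<tau>(1) y, of rk] y
      R_star_permute[OF subsetD[OF p_star_subset_p_MM p] \<sigma> y, of s]
    unfolding \<tau>(2) rk(2) ind_def by (simp add: indicator_def)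
  then have "(\<lambda>y\<in>Rspace d. ?f y - ?g y) =
      (\<lambda>y\<in>Rspace d. ind d (base_polyhedron d rk) y - ind d (base_polyhedron d (\<lambda>A. rk (\<tau> ` A))) y)"
    unfolding rk(2) by (intro restrict_ext) simp
  then have diff: "(\<lambda>y\<in>Rspace d. ?f y - ?g y) \<in> sym_relations s d r"
    unfolding sym_relations_def using rk(1) \<tau>(1) by (intro generate.incl) blast
  interpret P: comm_group "P_group s d r" by (rule comm_group_P_group)
  interpret S: comm_group "P_sym s d r" by (rule comm_group_P_sym)
  interpret rho: group_hom "P_group s d r" "P_sym s d r" "rho s d r"
    by unfold_locales (rule rho_hom)
  have "?f \<otimes>\<^bsub>P_group s d r\<^esub> inv\<^bsub>P_group s d r\<^esub> ?g \<in> carrier (P_group s d r)"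
    using f g by (intro P.m_closed P.inv_closed)
  from rho_eq_one_iff[OF this] have "rho s d r (?f \<otimes>\<^bsub>P_group s d r\<^esub> inv\<^bsub>P_group s d r\<^esub> ?g) = \<one>\<^bsub>P_sym s d r\<^esub>"
    using diff unfolding P_group_diff[OF f g] by blast
  then have "rho s d r ?f \<otimes>\<^bsub>P_sym s d r\<^esub> inv\<^bsub>P_sym s d r\<^esub> rho s d r ?g = \<one>\<^bsub>P_sym s d r\<^esub>"
    using f g by (simp add: rho.hom_mult)
  then show ?thesis
    using f g by (metis S.inv_equality S.inv_inv rho.hom_closed S.inv_closed)
qed

text \<open>Both sides are additive in \<open>c\<close>, so it suffices to compare them on
  generators.\<close>

lemma hom_free_Abelian_group_eval:
  assumes H: "H \<in> hom (free_Abelian_group S) (P_group s d r)"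
    and gen: "\<And>i. i \<in> S \<Longrightarrow> H (frag_of i) = ind d (Q i)"
    and c: "Poly_Mapping.keys c \<subseteq> S" and y: "y \<in> Rspace d"
  shows "H c y = (\<Sum>i\<in>Poly_Mapping.keys c. Poly_Mapping.lookup c i * of_bool (y \<in> Q i))"
proof -
  interpret H: group_hom "free_Abelian_group S" "P_group s d r" H
    by (intro group_hom.intro group_hom_axioms.intro H group_P_group group_free_Abelian_group)
  \<comment> \<open>Sums over keys are moved to a common finite set, since a difference may have
    fewer keys than its two terms together.\<close>
  have ext: "(\<Sum>i\<in>Poly_Mapping.keys c. Poly_Mapping.lookup c i * of_bool (y \<in> Q i))
      = (\<Sum>i\<in>T. Poly_Mapping.lookup c i * of_bool (y \<in> Q i))"
    if "finite T" "Poly_Mapping.keys c \<subseteq> T" for c :: "'a \<Rightarrow>\<^sub>0 int" and T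
    using that by (intro sum.mono_neutral_left) (auto simp: in_keys_iff)
  show ?thesis
  proof (rule free_Abelian_group_induct[OF c])
    show "H 0 y = (\<Sum>i\<in>Poly_Mapping.keys 0. Poly_Mapping.lookup 0 i * of_bool (y \<in> Q i))"
      using H.hom_one y by (simp add: P_group_simps)
  next
    fix a b :: "'a \<Rightarrow>\<^sub>0 int"
    assume keys: "Poly_Mapping.keys a \<subseteq> S" "Poly_Mapping.keys b \<subseteq> S"
      and IH: "H a y = (\<Sum>i\<in>Poly_Mapping.keys a. Poly_Mapping.lookup a i * of_bool (y \<in> Q i))"
        "H b y = (\<Sum>i\<in>Poly_Mapping.keys b. Poly_Mapping.lookup b i * of_bool (y \<in> Q i))"
    define T where "T = Poly_Mapping.keys a \<union> Poly_Mapping.keys b"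
    have T: "finite T" "Poly_Mapping.keys a \<subseteq> T" "Poly_Mapping.keys b \<subseteq> T" "Poly_Mapping.keys (a - b) \<subseteq> T"
      unfolding T_def using keys_diff[of a b] by auto
    have a: "a \<in> carrier (free_Abelian_group S)" and b: "b \<in> carrier (free_Abelian_group S)"
      using keys by simp_all
    have eq: "a - b = a \<otimes>\<^bsub>free_Abelian_group S\<^esub> inv\<^bsub>free_Abelian_group S\<^esub> b"
      using keys(2) by simp
    have "H (a - b) = H a \<otimes>\<^bsub>P_group s d r\<^esub> inv\<^bsub>P_group s d r\<^esub> H b"
      unfolding eq H.hom_mult[OF a H.G.inv_closed[OF b]] H.hom_inv[OF b] ..
    also have "\<dots> = (\<lambda>y\<in>Rspace d. H a y - H b y)"
      by (rule P_group_diff[OF H.hom_closed[OF a] H.hom_closed[OF b]])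
    finally have "H (a - b) y = H a y - H b y"
      using y by simp
    then show "H (a - b) y = (\<Sum>i\<in>Poly_Mapping.keys (a - b). Poly_Mapping.lookup (a - b) i * of_bool (y \<in> Q i))"
      unfolding IH ext[OF T(1,2)] ext[OF T(1,3)] ext[OF T(1,4)]
      unfolding lookup_minus left_diff_distrib sum_subtractf .
  next
    fix i assume "i \<in> S"
    then show "H (frag_of i) y = (\<Sum>j\<in>Poly_Mapping.keys (frag_of i). Poly_Mapping.lookup (frag_of i) j * of_bool (y \<in> Q j))"
      using gen y by (simp add: ind_def indicator_def)
  qed
qed

theorem theorem6p3:
  fixes s :: kind and d :: nat and r :: int
  shows "freely_generated_by (P_sym s d r)
           (\<lambda>(Xs, rs). rho s d r (ind d (R_star s d r Xs rs))) (p_sym s d r)"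
proof -
  let ?G = "P_group s d r" and ?K = "P_sym s d r" and ?F = "free_Abelian_group (p_sym s d r)"
  let ?b = "\<lambda>(Xs, rs). rho s d r (ind d (R_star s d r Xs rs))"
  interpret G: comm_group ?G by (rule comm_group_P_group)
  interpret K: comm_group ?K by (rule comm_group_P_sym)
  interpret rho: group_hom ?G ?K "rho s d r"
    by unfold_locales (rule rho_hom)
  define e where "e q = ind d (R_star s d r (fst q) (snd q))" for q
  have e: "e q \<in> carrier ?G" if "q \<in> p_sym s d r" for q
    using that ind_R_star_in_P_group[of "fst q" "snd q"] unfolding e_def p_sym_def by auto
  have b: "?b q = rho s d r (e q)" for q
    unfolding e_def by (cases q) simp
  obtain H where H: "H \<in> hom ?F ?G" "\<And>q. q \<in> p_sym s d r \<Longrightarrow> H (frag_of q) = e q"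
    using G.free_Abelian_group_universal[of e "p_sym s d r"] e by blast
  define h where "h = rho s d r \<circ> H"
  interpret h: group_hom ?F ?K h
    by (intro group_hom.intro group_hom_axioms.intro group_free_Abelian_group K.is_group)
      (use H(1) rho_hom in \<open>auto simp: h_def intro: hom_compose\<close>)
  have h_frag: "h (frag_of q) = ?b q" if "q \<in> p_sym s d r" for q
    unfolding h_def b using H(2)[OF that] by simp
  have "c = \<one>\<^bsub>?F\<^esub>" if c: "c \<in> carrier ?F" "h c = \<one>\<^bsub>?K\<^esub>" for c
  proof -
    have keys: "Poly_Mapping.keys c \<subseteq> p_sym s d r"
      using c(1) by simp
    have Hc: "H c \<in> sym_relations s d r"
      using c(2) rho_eq_one_iff[of "H c"] hom_in_carrier[OF H(1) c(1)] unfolding h_def by simp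
    have eval: "H c y = (\<Sum>q\<in>Poly_Mapping.keys c. Poly_Mapping.lookup c q * of_bool (y \<in> R_star s d r (fst q) (snd q)))"
      if "y \<in> Rspace d" for y
      by (rule hom_free_Abelian_group_eval[OF H(1) _ keys that]) (simp add: H(2) e_def)
    have "Poly_Mapping.lookup c q = 0" if q: "q \<in> Poly_Mapping.keys c" for q
    proof (rule R_star_orbits_independent[OF finite_keys keys _ q])
      fix y assume y: "y \<in> Rspace d"
      show "(\<Sum>\<sigma> | \<sigma> permutes {1..d}. \<Sum>q\<in>Poly_Mapping.keys c.
          Poly_Mapping.lookup c q * of_bool (y \<circ> \<sigma> \<in> R_star s d r (fst q) (snd q))) = 0"
        using sym_relations_symmetrized[OF Hc y] eval[OF comp_permutes_Rspace[OF _ y]] by simp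
    qed
    then show ?thesis
      by (metis in_keys_iff one_free_Abelian_group poly_mapping_eqI lookup_zero)
  qed
  moreover have "carrier ?K \<subseteq> h ` carrier ?F"
  proof -
    \<comment> \<open>The preimage of the image of \<open>h\<close>. It is a subgroup containing all
      chain indicators, hence by the expansion all generators of the group.\<close>
    define W where "W = {f \<in> carrier ?G. rho s d r f \<in> h ` carrier ?F}"
    have W: "subgroup W ?G"
    proof -
      interpret img: subgroup "h ` carrier ?F" ?K
        by (rule h.img_is_subgroup)
      show ?thesis
        unfolding W_def by unfold_locales auto
    qed
    have gen: "ind d (R_star s d r Xs rs) \<in> W" if p: "(Xs, rs) \<in> p_star s d r" for Xs rs
    proof -
      obtain \<sigma> where \<sigma>: "\<sigma> permutes {1..d}" "(map ((`) \<sigma>) Xs, rs) \<in> p_sym s d r"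
        using p_star_standardize[OF p] by blast
      have "rho s d r (ind d (R_star s d r Xs rs)) = h (frag_of (map ((`) \<sigma>) Xs, rs))"
        using rho_permute[OF p \<sigma>(1)] h_frag[OF \<sigma>(2)] by simp
      then show ?thesis
        using ind_R_star_in_P_group[OF p] \<sigma>(2) unfolding W_def by auto
    qed
    have "ind d (base_polyhedron d rk) \<in> W" if rk: "rk \<in> star_matroids s d r" for rk
    proof (rule base_polyhedron_in_span[OF rk gen])
      show "(\<lambda>y\<in>Rspace d. 0) \<in> W"
        using subgroup.one_closed[OF W] unfolding P_group_simps .
      fix f g assume fg: "f \<in> W" "g \<in> W"
      show "(\<lambda>y\<in>Rspace d. f y + g y) \<in> W"
        using subgroup.m_closed[OF W fg] unfolding P_group_simps .
      have "f \<in> carrier ?G" "g \<in> carrier ?G"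
        using fg unfolding W_def by auto
      then show "(\<lambda>y\<in>Rspace d. f y - g y) \<in> W"
        using subgroup.m_closed[OF W fg(1) subgroup.m_inv_closed[OF W fg(2)]] by (simp add: P_group_diff)
    qed
    moreover have "subgroup W (fun_group d)"
      using W unfolding P_group_def by (simp add: group.subgroup_subgroup_generated_iff[OF group_fun_group])
    ultimately have "carrier ?G \<subseteq> W"
      unfolding P_group_def by (intro group.subgroup_generated_minimal[OF group_fun_group]) auto
    \<comment> \<open>Every element of the quotient is a coset of some group element, so its class
      is reached by \<open>h\<close>.\<close>
    then show ?thesis
      unfolding P_sym_def carrier_FactGroup W_def rho_def by blast
  qed
  ultimately have "h \<in> iso ?F ?K"
    unfolding h.iso_iff by blast
  moreover have "?b q \<in> carrier ?K" if "q \<in> p_sym s d r" for q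
    unfolding b using e[OF that] by simp
  ultimately show ?thesis
    unfolding freely_generated_by_def using K.comm_group_axioms h_frag by blast
qed

end
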